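(* Let $d=1$. Suppose that $\psi$ has one of the following forms (for $x\ne0$): (i) $\psi(x)=|x|^{-\alpha}$ with $\alpha>2$; (ii) $\psi(x)=e^{-\tilde c|x|^{\eta}}$ with $\tilde c>0$ and $\eta\in(0,1)$. Then there exists $C_->0$ such that for any $x\in\mathbb{Z}$, $$C_-\ \le\ e^{\rho(x)}\,\Phi_{\beta_{\mathrm{sat}}(1)}(0\leftrightarrow x)\ \le\ 1 .$$
   Context: Here $d=1$ and $\rho$ is a norm on $\mathbb{R}$. The graph is the complete graph on $\mathbb{Z}$. Coupling constants: $J_{i,j}=J_{i-j}$ with $J_x=\psi(x)e^{-\rho(x)}$ for $x\ne0$ and $J_0=0$. $\Lambda_N=\{-N,\dots,N\}$. Ising model: for $\beta\ge0$, $\mu^+_\beta$ is the weak limit as $N\to\infty$ of the measures on $\{-1,1\}^{\Lambda_N}$ with weight proportional to $\exp\bigl(\beta\sum_{\{i,j\}\subset\Lambda_N}J_{ij}\sigma_i\sigma_j+\beta\sum_{i\in\Lambda_N,\,j\in\mathbb{Z}\setminus\Lambda_N}J_{ij}\sigma_i\bigr)$. $\langle\sigma_0;\sigma_x\rangle_\beta$ is the covariance of $\sigma_0,\sigma_x$ under $\mu^+_\beta$, and $\nu_\beta(1)=-\lim_{n\to\infty}\frac1n\log\langle\sigma_0;\sigma_n\rangle_\beta$ is the inverse correlation length in direction $1\in\mathbb{S}^0=\{-1,1\}$. $\beta_c=\inf\{\beta\ge0:\mu^+_\beta(\sigma_0)>0\}$ is the critical inverse temperature; in the present one-dimensional setting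 $\beta_c=\infty$. $\beta_{\mathrm{sat}}(1)=\sup\{\beta\ge0:\nu_\beta(1)=\rho(1)\}$. FK-Ising model: $\Phi_{\Lambda_N;\beta}$ is the probability measure on $\omega\in\{0,1\}^{E_{\Lambda_N}}$ ($E_{\Lambda_N}$: all pairs $\{i,j\}\subset\Lambda_N$) with weight proportional to $2^{\kappa(\omega)}\prod_{\{i,j\}:\,\omega_{i,j}=1}(e^{\beta J_{ij}}-1)$, where $\kappa(\omega)$ is the number of connected components of the graph with vertex set $\Lambda_N$ and edges the open edges of $\omega$; $\Phi_\beta$ is its weak limit as $N\to\infty$. $\{0\leftrightarrow x\}$ is the event that $0$ and $x$ are joined by a path of open edges. (One has $\Phi_\beta(0\leftrightarrow x)=\langle\sigma_0\sigma_x\rangle_\beta$, the Ising two-point function.)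
   Formalization: The FK edge weight is taken as e^{2βJ}−1 instead of e^{βJ}−1: with the stated Ising weight, the latter contradicts Φ_β(0↔x)=⟨σ_0σ_x⟩_β (a single edge gives tanh(βJ/2) instead of tanh(βJ)) and would make the lower bound fail. *)

theory Defs
  imports "HOL-Probability.Probability"
begin

definition is_norm :: "(real \<Rightarrow> real) \<Rightarrow> bool" where
  "is_norm \<rho> \<longleftrightarrow>
     (\<forall>x. \<rho> x = 0 \<longleftrightarrow> x = 0) \<and>
     (\<forall>a x. \<rho> (a * x) = \<bar>a\<bar> * \<rho> x) \<and>
     (\<forall>x y. \<rho> (x + y) \<le> \<rho> x + \<rho> y)"

definition coupling :: "(int \<Rightarrow> real) \<Rightarrow> (real \<Rightarrow> real) \<Rightarrow> int \<Rightarrow> real" where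
  "coupling \<psi> \<rho> x = (if x = 0 then 0 else \<psi> x * exp (- \<rho> (of_int x)))"

definition int_box :: "nat \<Rightarrow> int set" where
  "int_box N = {- int N..int N}"

text \<open>An unordered pair \<open>{i, j}\<close> is encoded as the ordered pair with \<open>i < j\<close>; this keeps the
  index type of the edge configurations countable.\<close>

definition edges :: "int set \<Rightarrow> (int \<times> int) set" where
  "edges V = {(i, j). i \<in> V \<and> j \<in> V \<and> i < j}"


subsection \<open>Finite-volume measures and weak limits\<close>

text \<open>The probability measure on the finite set \<open>S\<close> with weights proportional to \<open>w\<close>, regarded as a
  Borel measure on the ambient space.\<close>

definition weighted_measure :: "'a set \<Rightarrow> ('a \<Rightarrow> real) \<Rightarrow> 'a::topological_space measure" where
  "weighted_measure S w =
     distr (point_measure S (\<lambda>s. ennreal (w s / (\<Sum>t\<in>S. w t)))) borel (\<lambda>s. s)"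

definition converges_weakly :: "(nat \<Rightarrow> 'a measure) \<Rightarrow> 'a::topological_space measure \<Rightarrow> bool" where
  "converges_weakly M \<mu> \<longleftrightarrow>
     (\<forall>f :: 'a \<Rightarrow> real. continuous_on UNIV f \<and> bounded (range f) \<longrightarrow>
        (\<lambda>N. \<integral>s. f s \<partial>M N) \<longlonglongrightarrow> (\<integral>s. f s \<partial>\<mu>))"

text \<open>On the configuration spaces below (countable products of the real line, hence metrizable) a
  weak limit is unique if it exists.\<close>

definition weak_limit :: "(nat \<Rightarrow> 'a measure) \<Rightarrow> 'a::topological_space measure" where
  "weak_limit M = (THE \<mu>. prob_space \<mu> \<and> sets \<mu> = sets borel \<and> converges_weakly M \<mu>)"


subsection \<open>Ising model\<close>

text \<open>Configurations in the box are extended by the boundary value \<open>+1\<close>, so that all finite-volume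
  measures live on the same space, with its product topology.\<close>

definition spin_configs :: "nat \<Rightarrow> (int \<Rightarrow> real) set" where
  "spin_configs N =
     {\<sigma>. (\<forall>i\<in>int_box N. \<sigma> i \<in> {-1, 1}) \<and> (\<forall>i. i \<notin> int_box N \<longrightarrow> \<sigma> i = 1)}"

definition ising_weight :: "(int \<Rightarrow> real) \<Rightarrow> real \<Rightarrow> nat \<Rightarrow> (int \<Rightarrow> real) \<Rightarrow> real" where
  "ising_weight J \<beta> N \<sigma> =
     exp (\<beta> * (\<Sum>(i, j)\<in>edges (int_box N). J (i - j) * \<sigma> i * \<sigma> j)
        + \<beta> * (\<Sum>i\<in>int_box N. \<Sum>\<^sub>\<infinity>j\<in>- int_box N. J (i - j) * \<sigma> i))"

definition ising_finite :: "(int \<Rightarrow> real) \<Rightarrow> real \<Rightarrow> nat \<Rightarrow> (int \<Rightarrow> real) measure" where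
  "ising_finite J \<beta> N = weighted_measure (spin_configs N) (ising_weight J \<beta> N)"

definition ising_plus :: "(int \<Rightarrow> real) \<Rightarrow> real \<Rightarrow> (int \<Rightarrow> real) measure" where
  "ising_plus J \<beta> = weak_limit (ising_finite J \<beta>)"

definition spin_cov :: "(int \<Rightarrow> real) \<Rightarrow> real \<Rightarrow> int \<Rightarrow> int \<Rightarrow> real" where
  "spin_cov J \<beta> x y =
     (\<integral>\<sigma>. \<sigma> x * \<sigma> y \<partial>ising_plus J \<beta>)
       - (\<integral>\<sigma>. \<sigma> x \<partial>ising_plus J \<beta>) * (\<integral>\<sigma>. \<sigma> y \<partial>ising_plus J \<beta>)"

text \<open>The argument \<open>s\<close> is the direction, \<open>1\<close> or \<open>-1\<close>. At \<open>\<beta> = 0\<close> the covariances vanish for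
  \<open>n > 0\<close>, and the mathematical value \<open>\<infinity>\<close> is replaced by \<open>0\<close>, because \<open>ln 0 = 0\<close>. Neither value
  equals \<open>\<rho> s > 0\<close>, so this does not affect \<open>beta_sat\<close>.\<close>

definition inv_corr_length :: "(int \<Rightarrow> real) \<Rightarrow> real \<Rightarrow> int \<Rightarrow> real" where
  "inv_corr_length J \<beta> s = - lim (\<lambda>n::nat. 1 / real n * ln (spin_cov J \<beta> 0 (int n * s)))"

definition beta_sat :: "(int \<Rightarrow> real) \<Rightarrow> (real \<Rightarrow> real) \<Rightarrow> int \<Rightarrow> real" where
  "beta_sat \<psi> \<rho> s =
     Sup {\<beta>. 0 \<le> \<beta> \<and> inv_corr_length (coupling \<psi> \<rho>) \<beta> s = \<rho> (of_int s)}"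


subsection \<open>FK-Ising model\<close>

definition edge_configs :: "nat \<Rightarrow> (int \<times> int \<Rightarrow> real) set" where
  "edge_configs N =
     {\<omega>. (\<forall>e\<in>edges (int_box N). \<omega> e \<in> {0, 1}) \<and> (\<forall>e. e \<notin> edges (int_box N) \<longrightarrow> \<omega> e = 0)}"

definition open_rel :: "(int \<times> int \<Rightarrow> real) \<Rightarrow> (int \<times> int) set" where
  "open_rel \<omega> = {(i, j). i \<noteq> j \<and> \<omega> (min i j, max i j) = 1}"

definition num_components :: "nat \<Rightarrow> (int \<times> int \<Rightarrow> real) \<Rightarrow> nat" where
  "num_components N \<omega> = card (int_box N // (open_rel \<omega> \<inter> int_box N \<times> int_box N)\<^sup>*)"

text \<open>Since the Ising weight is \<open>exp (\<beta> * J (i - j) * \<sigma> i * \<sigma> j)\<close> per edge, the edge weight for which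
  the connection probabilities are the Ising two-point functions is \<open>exp (2 * \<beta> * J (i - j)) - 1\<close>:
  for a single edge, the connection probability is then \<open>tanh (\<beta> * J (i - j))\<close>.\<close>

definition fk_weight :: "(int \<Rightarrow> real) \<Rightarrow> real \<Rightarrow> nat \<Rightarrow> (int \<times> int \<Rightarrow> real) \<Rightarrow> real" where
  "fk_weight J \<beta> N \<omega> =
     2 ^ num_components N \<omega> *
     (\<Prod>(i, j)\<in>{e \<in> edges (int_box N). \<omega> e = 1}. exp (2 * \<beta> * J (i - j)) - 1)"

definition fk_finite :: "(int \<Rightarrow> real) \<Rightarrow> real \<Rightarrow> nat \<Rightarrow> (int \<times> int \<Rightarrow> real) measure" where
  "fk_finite J \<beta> N = weighted_measure (edge_configs N) (fk_weight J \<beta> N)"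

definition fk :: "(int \<Rightarrow> real) \<Rightarrow> real \<Rightarrow> (int \<times> int \<Rightarrow> real) measure" where
  "fk J \<beta> = weak_limit (fk_finite J \<beta>)"

definition connected_event :: "int \<Rightarrow> int \<Rightarrow> (int \<times> int \<Rightarrow> real) set" where
  "connected_event x y = {\<omega>. (x, y) \<in> (open_rel \<omega>)\<^sup>*}"

end

theory Submission
  imports Defs "HOL-Real_Asymp.Real_Asymp"
begin

text \<open>
  Write \<open>c = \<rho> 1\<close> and let \<open>G \<beta> x\<close> be the free infinite-volume two-point function. By Griffiths'
  inequalities \<open>G\<close> is increasing in \<open>\<beta>\<close>, lower semicontinuous in \<open>\<beta>\<close> and supermultiplicative in \<open>x\<close>, so
  \<open>G \<beta> n \<le> exp (- c * n)\<close> whenever the inverse correlation length is \<open>c\<close>, and this bound passes to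
  \<open>\<beta> = \<beta>_sat\<close> by left continuity. For the lower bound, Lieb's inequality in the box \<open>{-k..k}\<close> shows
  that the inverse correlation length is still \<open>c\<close> as soon as \<open>lieb_sum k \<beta> < 1\<close>, and
  \<open>lieb_sum k\<close> is continuous; hence \<open>lieb_sum k \<beta>_sat \<ge> 1\<close> for every \<open>k\<close>. Up to a term that vanishes for large
  \<open>k\<close>, \<open>lieb_sum k \<beta>_sat\<close> is at most \<open>\<beta>_sat * (\<Sum>m. a (k - m) * (\<Sum>r>m. \<psi> r))\<close> with
  \<open>a n = exp (c * n) * G \<beta>_sat n\<close>, and \<open>\<psi>\<close> has a finite first moment. So \<open>a\<close> is bounded below
  somewhere in every window of fixed length, and everywhere by supermultiplicativity.

  In the plus state, Lieb's inequality bounds the magnetization, and the difference to the free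
  two-point function, by a sum of free two-point functions weighted by the boundary field. The
  total boundary field is bounded and the free two-point function decays (by domination by
  Bernoulli percolation, which has many cut points), so in the limit the magnetization vanishes
  and the covariances are given by \<open>G\<close>.
\<close>

section \<open>Griffiths inequalities\<close>

text \<open>The tilt \<open>exp (c * n)\<close> explains the hypotheses on \<psi>. For an edge
  leaving \<open>{-k..k}\<close> to the right it cancels the exponential decay and leaves \<psi> of
  the length; to the left it doubles the decay. So a site at distance m from the right end is
  weighted by the tail of \<psi> beyond m. These tails sum to the first moment of \<psi>, finite for
  \<alpha> > 2. At \<open>beta_sat\<close> this bounds \<open>lieb_sum k\<close> uniformly in k and
  concentrates it near the right end.

  Two-sided continuity in \<beta> is used in finite boxes only, and \<open>beta_sat\<close> is not
  known to belong to the set of which it is the supremum; both bounds are therefore transported from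
  one side.

  Two obstacles come from the definitions. The states are weak limits selected by
  \<open>THE\<close>, so the limits must be constructed before anything can be computed. And the
  event that 0 and x are joined is not determined by finitely many edges, so weak convergence does
  not give its probability; summability of the two-point function at \<open>beta_sat\<close> does,
  by excluding detours through distant sites.\<close>

definition spins :: "'a set \<Rightarrow> ('a \<Rightarrow> real) set" where
  "spins V = {\<sigma>. (\<forall>i\<in>V. \<sigma> i \<in> {-1, 1}) \<and> (\<forall>i. i \<notin> V \<longrightarrow> \<sigma> i = 1)}"

definition smul :: "('a \<Rightarrow> real) \<Rightarrow> ('a \<Rightarrow> real) \<Rightarrow> 'a \<Rightarrow> real" where
  "smul \<sigma> \<tau> = (\<lambda>i. \<sigma> i * \<tau> i)"

text \<open>These are the characters of the group \<open>spins V\<close>. With lists, a product of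
  characters is an append, and repeated sites cancel because spins square to 1.\<close>

definition mon :: "'a list \<Rightarrow> ('a \<Rightarrow> real) \<Rightarrow> real" where
  "mon xs \<sigma> = prod_list (map \<sigma> xs)"

lemma mon_simps [simp]: "mon [] \<sigma> = 1" "mon (x # xs) \<sigma> = \<sigma> x * mon xs \<sigma>"
  by (auto simp: mon_def)

lemma mon_append [simp]: "mon (xs @ ys) \<sigma> = mon xs \<sigma> * mon ys \<sigma>"
  by (simp add: mon_def)

lemma mon_smul: "mon xs (smul \<sigma> \<tau>) = mon xs \<sigma> * mon xs \<tau>"
  by (induction xs) (auto simp: smul_def)

lemma spins_cases: "\<sigma> \<in> spins V \<Longrightarrow> \<sigma> i = 1 \<or> \<sigma> i = -1"
  by (auto simp: spins_def)

lemma spins_sq [simp]: "\<sigma> \<in> spins V \<Longrightarrow> \<sigma> i * \<sigma> i = 1" "\<sigma> \<in> spins V \<Longrightarrow> \<sigma> i * (\<sigma> i * a) = a"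
  using spins_cases[of \<sigma> V i] by auto

lemma mon_cases: "\<sigma> \<in> spins V \<Longrightarrow> mon xs \<sigma> = 1 \<or> mon xs \<sigma> = -1"
  by (induction xs) (use spins_cases in \<open>force+\<close>)

lemma abs_mon: "\<sigma> \<in> spins V \<Longrightarrow> \<bar>mon xs \<sigma>\<bar> = 1"
  using mon_cases[of \<sigma> V xs] by force

lemma one_in_spins [simp]: "(\<lambda>_. 1) \<in> spins V"
  by (auto simp: spins_def)

lemma spins_mono: "S \<subseteq> V \<Longrightarrow> spins S \<subseteq> spins V"
  by (auto simp: spins_def)

text \<open>Spins outside the volume are frozen at 1, so \<open>spins V\<close> is a finite group
  under \<open>smul\<close> with subgroups \<open>spins S\<close> for
  \<open>S \<subseteq> V\<close>. Translations of this group drive both the vanishing arguments and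
  Ginibre's change of variables.\<close>

lemma smul_in_spins: "\<sigma> \<in> spins V \<Longrightarrow> \<tau> \<in> spins V \<Longrightarrow> smul \<sigma> \<tau> \<in> spins V"
  by (fastforce simp: spins_def smul_def)

lemma smul_smul: "\<tau> \<in> spins V \<Longrightarrow> smul (smul \<sigma> \<tau>) \<tau> = \<sigma>"
  by (auto simp: smul_def fun_eq_iff mult.assoc)

lemma smul_commute: "smul \<sigma> \<tau> = smul \<tau> \<sigma>"
  by (auto simp: smul_def fun_eq_iff)

lemma spins_nonempty [simp]: "spins V \<noteq> {}"
  using one_in_spins by blast

lemma finite_spins [simp]:
  assumes "finite V" shows "finite (spins V)"
proof -
  have "spins V \<subseteq> (\<lambda>A i. if i \<in> A then -1 else 1) ` Pow V"
  proof
    fix \<sigma> assume s: "\<sigma> \<in> spins V"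
    have "\<sigma> = (\<lambda>i. if i \<in> {i\<in>V. \<sigma> i = -1} then -1 else 1)"
      using s by (auto simp: spins_def fun_eq_iff)
    then show "\<sigma> \<in> (\<lambda>A i. if i \<in> A then -1 else 1) ` Pow V" by blast
  qed
  then show ?thesis by (rule finite_subset) (use assms in auto)
qed

lemma sum_spins_shift:
  assumes "\<tau> \<in> spins V"
  shows "(\<Sum>\<sigma>\<in>spins V. f (smul \<sigma> \<tau>)) = (\<Sum>\<sigma>\<in>spins V. f \<sigma>)"
  by (rule sum.reindex_bij_witness[where i = "\<lambda>\<sigma>. smul \<sigma> \<tau>" and j = "\<lambda>\<sigma>. smul \<sigma> \<tau>"])
     (use assms in \<open>auto simp: smul_smul intro: smul_in_spins\<close>)

lemma sum_spins_shift':
  assumes "\<sigma> \<in> spins V"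
  shows "(\<Sum>\<tau>\<in>spins V. f (smul \<sigma> \<tau>)) = (\<Sum>\<tau>\<in>spins V. f \<tau>)"
  using sum_spins_shift[OF assms] by (simp add: smul_commute)

lemma sum_spins_flip:
  fixes f :: "('a \<Rightarrow> real) \<Rightarrow> real"
  assumes "\<tau> \<in> spins V" "\<And>\<sigma>. \<sigma> \<in> spins V \<Longrightarrow> f (smul \<sigma> \<tau>) = - f \<sigma>"
  shows "(\<Sum>\<sigma>\<in>spins V. f \<sigma>) = 0"
proof -
  have "(\<Sum>\<sigma>\<in>spins V. f \<sigma>) = (\<Sum>\<sigma>\<in>spins V. - f \<sigma>)"
    unfolding sum_spins_shift[OF assms(1), of f, symmetric] by (intro sum.cong) (auto simp: assms)
  then show ?thesis by (simp add: sum_negf)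
qed

text \<open>Orthogonality of characters: a nontrivial one is -1 at some \<tau>, and translation by
  \<tau> reverses its sum.\<close>

lemma sum_mon_nonneg: "0 \<le> (\<Sum>\<sigma>\<in>spins V. mon xs \<sigma>)"
proof (cases "\<forall>\<tau>\<in>spins V. mon xs \<tau> = 1")
  case False
  then obtain \<tau> where t: "\<tau> \<in> spins V" "mon xs \<tau> = -1" using mon_cases by metis
  then have "(\<Sum>\<sigma>\<in>spins V. mon xs \<sigma>) = 0" by (intro sum_spins_flip[of \<tau>]) (auto simp: mon_smul)
  then show ?thesis by simp
qed (simp add: sum_nonneg)

text \<open>Functions with nonnegative Fourier coefficients on the group of spin configurations.\<close>

inductive gcone :: "'a set \<Rightarrow> (('a \<Rightarrow> real) \<Rightarrow> real) \<Rightarrow> bool" for V where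
  mon: "gcone V (mon xs)"
| scale: "gcone V f \<Longrightarrow> 0 \<le> c \<Longrightarrow> gcone V (\<lambda>\<sigma>. c * f \<sigma>)"
| add: "gcone V f \<Longrightarrow> gcone V g \<Longrightarrow> gcone V (\<lambda>\<sigma>. f \<sigma> + g \<sigma>)"
| cong: "gcone V f \<Longrightarrow> (\<And>\<sigma>. \<sigma> \<in> spins V \<Longrightarrow> g \<sigma> = f \<sigma>) \<Longrightarrow> gcone V g"

lemma gcone_const: "0 \<le> c \<Longrightarrow> gcone V (\<lambda>_. c)"
  using gcone.scale[OF gcone.mon[of V "[]"], of c] by simp

lemma gcone_spin: "gcone V (\<lambda>\<sigma>. \<sigma> i)"
  using gcone.mon[of V "[i]"] by (rule gcone.cong) simp

lemma gcone_mult: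
  assumes "gcone V f" "gcone V g" shows "gcone V (\<lambda>\<sigma>. f \<sigma> * g \<sigma>)"
  using assms(1)
proof induction
  case (mon xs)
  from assms(2) show ?case
  proof induction
    case (mon ys)
    show ?case using gcone.mon[of V "xs @ ys"] by (rule gcone.cong) simp
  next
    case (scale f c)
    show ?case using gcone.scale[OF scale.IH scale.hyps(2)] by (rule gcone.cong) simp
  next
    case (add f g)
    show ?case using gcone.add[OF add.IH] by (rule gcone.cong) (simp add: algebra_simps)
  next
    case (cong f g)
    show ?case using cong.IH by (rule gcone.cong) (simp add: cong)
  qed
next
  case (scale f c)
  show ?case using gcone.scale[OF scale.IH scale.hyps(2)] by (rule gcone.cong) simp
next
  case (add f g)
  show ?case using gcone.add[OF add.IH] by (rule gcone.cong) (simp add: algebra_simps)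
next
  case (cong f g)
  show ?case using cong.IH by (rule gcone.cong) (simp add: cong)
qed

lemma gcone_prod: "(\<And>k. k \<in> K \<Longrightarrow> gcone V (f k)) \<Longrightarrow> gcone V (\<lambda>\<sigma>. \<Prod>k\<in>K. f k \<sigma>)"
  by (induction K rule: infinite_finite_induct) (auto intro: gcone_const gcone_mult)

lemma gcone_sum_nonneg: "gcone V f \<Longrightarrow> 0 \<le> (\<Sum>\<sigma>\<in>spins V. f \<sigma>)"
proof (induction rule: gcone.induct)
  case (mon xs) show ?case by (rule sum_mon_nonneg)
qed (auto simp: sum.distrib sum_distrib_left[symmetric])

lemma exp_mon:
  assumes "\<sigma> \<in> spins V"
  shows "exp (J * mon xs \<sigma>) = cosh J + sinh J * mon xs \<sigma>"
  using mon_cases[OF assms, of xs] by (auto simp: cosh_plus_sinh cosh_minus_sinh)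

lemma gcone_exp_mon: "0 \<le> J \<Longrightarrow> gcone V (\<lambda>\<sigma>. exp (J * mon xs \<sigma>))"
  by (rule gcone.cong[where f = "\<lambda>\<sigma>. cosh J + sinh J * mon xs \<sigma>"])
     (auto simp: exp_mon intro!: gcone.add gcone_const gcone.scale gcone.mon)

text \<open>The condition on \<open>w \<sigma> * w (\<sigma> \<tau>)\<close> is what Ginibre's duplication \<open>\<sigma>' = \<sigma> \<tau>\<close> needs; unlike a
  description by couplings it is stable under products.\<close>

definition ferro :: "'a set \<Rightarrow> (('a \<Rightarrow> real) \<Rightarrow> real) \<Rightarrow> bool" where
  "ferro V w \<longleftrightarrow> (\<forall>\<sigma>\<in>spins V. 0 < w \<sigma>) \<and> gcone V w \<and>
     (\<forall>\<tau>\<in>spins V. gcone V (\<lambda>\<sigma>. w \<sigma> * w (smul \<sigma> \<tau>)))"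

lemma ferro_one: "ferro V (\<lambda>_. 1)"
  by (auto simp: ferro_def gcone_const)

lemma ferro_mult:
  assumes "ferro V w" "ferro V w'" shows "ferro V (\<lambda>\<sigma>. w \<sigma> * w' \<sigma>)"
  unfolding ferro_def
proof (intro conjI ballI)
  fix \<tau> assume "\<tau> \<in> spins V"
  then have "gcone V (\<lambda>\<sigma>. (w \<sigma> * w (smul \<sigma> \<tau>)) * (w' \<sigma> * w' (smul \<sigma> \<tau>)))"
    using assms by (intro gcone_mult[of V "\<lambda>\<sigma>. w \<sigma> * w (smul \<sigma> \<tau>)"]) (auto simp: ferro_def)
  then show "gcone V (\<lambda>\<sigma>. w \<sigma> * w' \<sigma> * (w (smul \<sigma> \<tau>) * w' (smul \<sigma> \<tau>)))"
    by (rule gcone.cong) simp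
qed (use assms in \<open>auto simp: ferro_def intro!: gcone_mult[of V w w']\<close>)

lemma ferro_prod: "(\<And>k. k \<in> K \<Longrightarrow> ferro V (f k)) \<Longrightarrow> ferro V (\<lambda>\<sigma>. \<Prod>k\<in>K. f k \<sigma>)"
  by (induction K rule: infinite_finite_induct) (auto intro: ferro_one ferro_mult)

lemma ferro_exp_mon:
  assumes "0 \<le> J" shows "ferro V (\<lambda>\<sigma>. exp (J * mon xs \<sigma>))"
  unfolding ferro_def
proof (intro conjI ballI)
  fix \<tau> assume t: "\<tau> \<in> spins V"
  \<comment> \<open>The factor \<open>1 + mon xs \<tau>\<close> is 0 or 2: the doubled interaction
    disappears or is again ferromagnetic.\<close>
  have "gcone V (\<lambda>\<sigma>. exp (J * (1 + mon xs \<tau>) * mon xs \<sigma>))"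
    using assms mon_cases[OF t, of xs] by (intro gcone_exp_mon) auto
  then show "gcone V (\<lambda>\<sigma>. exp (J * mon xs \<sigma>) * exp (J * mon xs (smul \<sigma> \<tau>)))"
    by (rule gcone.cong) (simp add: mon_smul algebra_simps flip: exp_add)
qed (use assms gcone_exp_mon in auto)

section \<open>Gibbs expectations and the two Griffiths inequalities\<close>

definition gibbs :: "'a set \<Rightarrow> (('a \<Rightarrow> real) \<Rightarrow> real) \<Rightarrow> (('a \<Rightarrow> real) \<Rightarrow> real) \<Rightarrow> real" where
  "gibbs V w f = (\<Sum>\<sigma>\<in>spins V. f \<sigma> * w \<sigma>) / (\<Sum>\<sigma>\<in>spins V. w \<sigma>)"

lemma ferro_Z_pos: "finite V \<Longrightarrow> ferro V w \<Longrightarrow> 0 < (\<Sum>\<sigma>\<in>spins V. w \<sigma>)"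
  by (intro sum_pos) (auto simp: ferro_def)

lemma gibbs_cong: "(\<And>\<sigma>. \<sigma> \<in> spins V \<Longrightarrow> f \<sigma> = g \<sigma>) \<Longrightarrow> gibbs V w f = gibbs V w g"
  unfolding gibbs_def by (auto cong: sum.cong)

lemma gibbs_cong_weight: "(\<And>\<sigma>. \<sigma> \<in> spins V \<Longrightarrow> w \<sigma> = w' \<sigma>) \<Longrightarrow> gibbs V w f = gibbs V w' f"
  unfolding gibbs_def by (auto cong: sum.cong)

lemma gibbs_const: "finite V \<Longrightarrow> ferro V w \<Longrightarrow> gibbs V w (\<lambda>_. c) = c"
  using ferro_Z_pos[of V w] by (simp add: gibbs_def sum_distrib_left[symmetric])

lemma gibbs_mono:
  assumes "finite V" "ferro V w" "\<And>\<sigma>. \<sigma> \<in> spins V \<Longrightarrow> f \<sigma> \<le> g \<sigma>"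
  shows "gibbs V w f \<le> gibbs V w g"
  unfolding gibbs_def using ferro_Z_pos[OF assms(1,2)] assms
  by (intro divide_right_mono sum_mono mult_right_mono) (auto simp: ferro_def less_imp_le)

lemma gibbs_abs_le:
  assumes "finite V" "ferro V w" "\<And>\<sigma>. \<sigma> \<in> spins V \<Longrightarrow> \<bar>f \<sigma>\<bar> \<le> c"
  shows "\<bar>gibbs V w f\<bar> \<le> c"
proof -
  have "gibbs V w f \<le> gibbs V w (\<lambda>_. c)" "gibbs V w (\<lambda>_. - c) \<le> gibbs V w f"
    using assms(3) by (intro gibbs_mono[OF assms(1,2)]; force)+
  then show ?thesis using gibbs_const[OF assms(1,2)] by auto
qed

theorem gks1: "finite V \<Longrightarrow> ferro V w \<Longrightarrow> gcone V f \<Longrightarrow> 0 \<le> gibbs V w f"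
  unfolding gibbs_def using ferro_Z_pos[of V w]
  by (intro divide_nonneg_pos gcone_sum_nonneg gcone_mult) (auto simp: ferro_def)

text \<open>The claim is linear in \<open>g\<close>. For a character the difference is
  \<open>(1 - mon xs \<tau>) * mon xs \<sigma>\<close>, whose first factor is 0 or 2 and independent
  of \<sigma>.\<close>

lemma ginibre:
  assumes "gcone V g" "\<tau> \<in> spins V" "gcone V p"
  shows "0 \<le> (\<Sum>\<sigma>\<in>spins V. (g \<sigma> - g (smul \<sigma> \<tau>)) * p \<sigma>)"
  using assms(1)
proof induction
  case (mon xs)
  have "0 \<le> (1 - mon xs \<tau>) * (\<Sum>\<sigma>\<in>spins V. mon xs \<sigma> * p \<sigma>)"
    using mon_cases[OF assms(2), of xs] by (auto intro!: gcone_sum_nonneg gcone_mult gcone.mon assms)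
  then show ?case by (simp add: mon_smul algebra_simps sum_distrib_left)
next
  case (scale f c)
  have "0 \<le> c * (\<Sum>\<sigma>\<in>spins V. (f \<sigma> - f (smul \<sigma> \<tau>)) * p \<sigma>)" using scale by auto
  then show ?case by (simp add: algebra_simps sum_distrib_left)
next
  case (add f g)
  then show ?case by (simp add: algebra_simps sum.distrib sum_subtractf)
next
  case (cong f g)
  then show ?case using smul_in_spins[OF _ assms(2)] by simp
qed

text \<open>The covariance times the squared partition function is a double sum over two replicas.
  With the second replica written as \<sigma> \<tau> and \<tau> fixed, each inner sum is an instance
  of \<open>ginibre\<close>.\<close>

theorem gks2:
  assumes "finite V" "ferro V w" "gcone V f" "gcone V g"
  shows "gibbs V w f * gibbs V w g \<le> gibbs V w (\<lambda>\<sigma>. f \<sigma> * g \<sigma>)"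
proof -
  let ?S = "\<lambda>h. \<Sum>\<sigma>\<in>spins V. h \<sigma> * w \<sigma>" and ?Z = "\<Sum>\<sigma>\<in>spins V. w \<sigma>"
  have Z: "?Z > 0" using ferro_Z_pos[OF assms(1,2)] .
  have "0 \<le> (\<Sum>\<tau>\<in>spins V. \<Sum>\<sigma>\<in>spins V. (g \<sigma> - g (smul \<sigma> \<tau>)) * (f \<sigma> * (w \<sigma> * w (smul \<sigma> \<tau>))))"
    using assms by (intro sum_nonneg ginibre gcone_mult[of V f]) (auto simp: ferro_def)
  also have "\<dots> = (\<Sum>\<sigma>\<in>spins V. \<Sum>\<tau>\<in>spins V. (g \<sigma> - g (smul \<sigma> \<tau>)) * (f \<sigma> * (w \<sigma> * w (smul \<sigma> \<tau>))))"
    by (rule sum.swap)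
  also have "\<dots> = (\<Sum>\<sigma>\<in>spins V. \<Sum>\<tau>\<in>spins V. (g \<sigma> - g \<tau>) * (f \<sigma> * (w \<sigma> * w \<tau>)))"
    by (intro sum.cong refl sum_spins_shift'[where f = "\<lambda>\<tau>. (g _ - g \<tau>) * (f _ * (w _ * w \<tau>))"])
  also have "\<dots> = (\<Sum>\<sigma>\<in>spins V. \<Sum>\<tau>\<in>spins V. (f \<sigma> * g \<sigma> * w \<sigma>) * w \<tau> - (f \<sigma> * w \<sigma>) * (g \<tau> * w \<tau>))"
    by (simp add: algebra_simps)
  also have "\<dots> = ?S (\<lambda>\<sigma>. f \<sigma> * g \<sigma>) * ?Z - ?S f * ?S g"
    by (simp add: sum_subtractf sum_product)
  finally have "?S f * ?S g \<le> ?S (\<lambda>\<sigma>. f \<sigma> * g \<sigma>) * ?Z" by simp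
  with Z show ?thesis unfolding gibbs_def by (simp add: field_simps)
qed

text \<open>The new expectation of \<open>f\<close> is that of \<open>f * r\<close> divided by that
  of \<open>r\<close>, so \<open>gks2\<close> applies with \<open>g = r\<close>. Enlarging the
  volume, raising \<beta> and switching on a field are all of this form.\<close>

lemma gibbs_weight_mono:
  assumes "finite V" "ferro V w" "gcone V f" "gcone V r" "\<And>\<sigma>. \<sigma> \<in> spins V \<Longrightarrow> 0 \<le> r \<sigma>" "r (\<lambda>_. 1) > 0"
  shows "gibbs V w f \<le> gibbs V (\<lambda>\<sigma>. w \<sigma> * r \<sigma>) f"
proof -
  let ?S = "\<lambda>h. \<Sum>\<sigma>\<in>spins V. h \<sigma> * w \<sigma>" and ?Z = "\<Sum>\<sigma>\<in>spins V. w \<sigma>"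
  have Z: "?Z > 0" using ferro_Z_pos[OF assms(1,2)] .
  have R: "?S r > 0" 
    using assms by (intro sum_pos2[where i = "\<lambda>_. 1"]) (auto simp: ferro_def less_imp_le)
  have "?S f * ?S r \<le> ?S (\<lambda>\<sigma>. f \<sigma> * r \<sigma>) * ?Z"
    using gks2[OF assms(1-4)] Z unfolding gibbs_def by (simp add: field_simps)
  then show ?thesis using Z R unfolding gibbs_def by (simp add: field_simps mult_ac)
qed

section \<open>Lieb's inequality\<close>

definition pair_w :: "('a \<times> 'a \<Rightarrow> real) \<Rightarrow> ('a \<times> 'a) set \<Rightarrow> ('a \<Rightarrow> real) \<Rightarrow> real" where
  "pair_w J E \<sigma> = (\<Prod>e\<in>E. exp (J e * (\<sigma> (fst e) * \<sigma> (snd e))))"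

lemma pair_w_as_mon: "exp (J e * (\<sigma> (fst e) * \<sigma> (snd e))) = exp (J e * mon [fst e, snd e] \<sigma>)"
  by simp

lemma ferro_pair_w: "(\<And>e. e \<in> E \<Longrightarrow> 0 \<le> J e) \<Longrightarrow> ferro V (pair_w J E)"
  unfolding pair_w_def pair_w_as_mon by (intro ferro_prod ferro_exp_mon)

lemma gcone_ferro: "ferro V w \<Longrightarrow> gcone V w"
  by (simp add: ferro_def)

definition adj :: "('a \<times> 'a) set \<Rightarrow> ('a \<times> 'a) set" where
  "adj \<omega> = {(i, j). (i, j) \<in> \<omega> \<or> (j, i) \<in> \<omega>}"

definition agree :: "('a \<times> 'a) set \<Rightarrow> ('a \<Rightarrow> real) \<Rightarrow> bool" where
  "agree \<omega> \<tau> \<longleftrightarrow> (\<forall>e\<in>\<omega>. \<tau> (fst e) = \<tau> (snd e))"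

lemma agree_path:
  assumes "agree \<omega> \<tau>" "(i, j) \<in> (adj \<omega>)\<^sup>*" shows "\<tau> i = \<tau> j"
  using assms(2) by (induction rule: rtrancl_induct) (use assms(1) in \<open>force simp: agree_def adj_def\<close>)+

definition flip :: "'a set \<Rightarrow> 'a \<Rightarrow> real" where
  "flip C = (\<lambda>i. if i \<in> C then -1 else 1)"

lemma flip_in_spins: "C \<subseteq> V \<Longrightarrow> flip C \<in> spins V"
  by (auto simp: flip_def spins_def)

lemma cluster_subset:
  assumes "\<omega> \<subseteq> S \<times> S" "a \<in> S" shows "(adj \<omega>)\<^sup>* `` {a} \<subseteq> S"
proof -
  have "j \<in> S" if "(a, j) \<in> (adj \<omega>)\<^sup>*" for j
    using that by (induction rule: rtrancl_induct) (use assms in \<open>auto simp: adj_def\<close>)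
  then show ?thesis by auto
qed

lemma agree_flip_cluster: "agree \<omega> (flip ((adj \<omega>)\<^sup>* `` {a}))"
proof -
  have "(a, fst e) \<in> (adj \<omega>)\<^sup>* \<longleftrightarrow> (a, snd e) \<in> (adj \<omega>)\<^sup>*" if "e \<in> \<omega>" for e
  proof -
    have "(fst e, snd e) \<in> adj \<omega>" "(snd e, fst e) \<in> adj \<omega>" using that by (auto simp: adj_def)
    then show ?thesis by (meson rtrancl.rtrancl_into_rtrancl)
  qed
  then show ?thesis by (auto simp: agree_def flip_def)
qed

text \<open>Agreement along one edge has as indicator half of 1 plus the product of the two end
  spins, which lies in the cone.\<close>

lemma gcone_agree:
  assumes "finite \<omega>" shows "gcone V (\<lambda>\<tau>. of_bool (agree \<omega> \<tau>))"
proof (rule gcone.cong)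
  show "gcone V (\<lambda>\<tau>. \<Prod>e\<in>\<omega>. (1/2) * (1 + mon [fst e, snd e] \<tau>))"
    by (intro gcone_prod gcone.scale gcone.add gcone_const gcone.mon) auto
  fix \<tau> assume t: "\<tau> \<in> spins V"
  have "(1/2) * (1 + mon [fst e, snd e] \<tau>) = of_bool (\<tau> (fst e) = \<tau> (snd e))" for e
    using spins_cases[OF t, of "fst e"] spins_cases[OF t, of "snd e"] by auto
  then have "(\<Prod>e\<in>\<omega>. (1/2) * (1 + mon [fst e, snd e] \<tau>)) = (\<Prod>e\<in>\<omega>. of_bool (\<tau> (fst e) = \<tau> (snd e)))"
    by simp
  also have "\<dots> = of_bool (agree \<omega> \<tau>)"
    using assms by (induction \<omega>) (auto simp: agree_def)
  finally show "of_bool (agree \<omega> \<tau>) = (\<Prod>e\<in>\<omega>. (1/2) * (1 + mon [fst e, snd e] \<tau>))" by simp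
qed

lemma prod_of_bool_agree:
  "finite \<omega> \<Longrightarrow> (\<Prod>e\<in>\<omega>. of_bool (\<tau> (fst e) = \<tau> (snd e)) * f e) = of_bool (agree \<omega> \<tau>) * (\<Prod>e\<in>\<omega>. f e :: real)"
  by (induction \<omega> rule: finite_induct) (auto simp: agree_def)

text \<open>On an edge where \<tau> disagrees the two replicas cancel to the factor 1. Where it
  agrees they double, and 1 is split off from the exponential to expand the product over
  edges.\<close>

lemma pair_w_smul_expand:
  assumes "finite E" "\<tau> \<in> spins V"
  shows "pair_w J E \<sigma> * pair_w J E (smul \<sigma> \<tau>) =
    (\<Sum>\<omega>\<in>Pow E. of_bool (agree \<omega> \<tau>) * (\<Prod>e\<in>\<omega>. exp (2 * J e * (\<sigma> (fst e) * \<sigma> (snd e))) - 1))"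
proof -
  have "pair_w J E \<sigma> * pair_w J E (smul \<sigma> \<tau>) =
      (\<Prod>e\<in>E. of_bool (\<tau> (fst e) = \<tau> (snd e)) * (exp (2 * J e * (\<sigma> (fst e) * \<sigma> (snd e))) - 1) + 1)"
    unfolding pair_w_def prod.distrib[symmetric]
  proof (rule prod.cong[OF refl])
    fix e assume "e \<in> E"
    show "exp (J e * (\<sigma> (fst e) * \<sigma> (snd e))) * exp (J e * (smul \<sigma> \<tau> (fst e) * smul \<sigma> \<tau> (snd e))) =
       of_bool (\<tau> (fst e) = \<tau> (snd e)) * (exp (2 * J e * (\<sigma> (fst e) * \<sigma> (snd e))) - 1) + 1"
      using spins_cases[OF assms(2), of "fst e"] spins_cases[OF assms(2), of "snd e"]
      by (auto simp: smul_def simp flip: exp_add)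
  qed
  also have "\<dots> = (\<Sum>\<omega>\<in>Pow E. \<Prod>e\<in>\<omega>. of_bool (\<tau> (fst e) = \<tau> (snd e)) * (exp (2 * J e * (\<sigma> (fst e) * \<sigma> (snd e))) - 1))"
    by (subst prod_add[OF assms(1)]) simp
  also have "\<dots> = (\<Sum>\<omega>\<in>Pow E. of_bool (agree \<omega> \<tau>) * (\<Prod>e\<in>\<omega>. exp (2 * J e * (\<sigma> (fst e) * \<sigma> (snd e))) - 1))"
    using assms(1) by (intro sum.cong refl prod_of_bool_agree) (auto intro: finite_subset)
  finally show ?thesis .
qed

lemma gcone_exp_minus_one:
  assumes "0 \<le> J" shows "gcone V (\<lambda>\<sigma>. exp (2 * J * (\<sigma> i * \<sigma> j)) - 1)"
proof (rule gcone.cong)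
  show "gcone V (\<lambda>\<sigma>. (cosh (2 * J) - 1) + sinh (2 * J) * mon [i, j] \<sigma>)"
    using assms cosh_real_ge_1[of "2*J"] by (intro gcone.add gcone_const gcone.scale gcone.mon) auto
  show "exp (2 * J * (\<sigma> i * \<sigma> j)) - 1 = cosh (2 * J) - 1 + sinh (2 * J) * mon [i, j] \<sigma>"
    if "\<sigma> \<in> spins V" for \<sigma> using exp_mon[OF that, of "2*J" "[i,j]"] by simp
qed

text \<open>Used to pass from the tanh of a coupling, which the expansion produces, to the coupling
  that appears in Lieb's inequality.\<close>

lemma sinh_le_mult_cosh:
  assumes "0 \<le> x" shows "sinh (x::real) \<le> x * cosh x"
proof -
  have "0 * cosh 0 - sinh 0 \<le> x * cosh x - sinh x"
  proof (rule DERIV_nonneg_imp_nondecreasing[OF assms])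
    fix y :: real assume "0 \<le> y" "y \<le> x"
    then show "\<exists>d. ((\<lambda>x. x * cosh x - sinh x) has_real_derivative d) (at y) \<and> 0 \<le> d"
      by (intro exI[of _ "y * sinh y"]) (auto intro!: derivative_eq_intros)
  qed
  then show ?thesis by simp
qed

text \<open>The weight has three layers: pair couplings inside \<open>S\<close>, the factor
  \<open>wc\<close> that does not feel the spins in \<open>S\<close>, and the terms linking
  \<open>S\<close> to the rest, which are added only in \<open>wsum\<close>.\<close>

locale lieb =
  fixes V S :: "'a set" and E :: "('a \<times> 'a) set" and J :: "'a \<times> 'a \<Rightarrow> real"
    and wc :: "('a \<Rightarrow> real) \<Rightarrow> real" and a :: 'a
  assumes finV: "finite V" and SV: "S \<subseteq> V" and E: "E \<subseteq> S \<times> S" and J: "\<And>e. e \<in> E \<Longrightarrow> 0 \<le> J e"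
    and a: "a \<in> S" and wc: "gcone V wc"
    and wc_inv: "\<And>\<sigma> \<tau>. \<sigma> \<in> spins V \<Longrightarrow> \<tau> \<in> spins S \<Longrightarrow> wc (smul \<sigma> \<tau>) = wc \<sigma>"
begin

definition gS :: "'a \<Rightarrow> real" where
  "gS i = (\<Sum>\<sigma>\<in>spins S. \<sigma> a * \<sigma> i * pair_w J E \<sigma>)"

definition ZS :: real where "ZS = (\<Sum>\<sigma>\<in>spins S. pair_w J E \<sigma>)"

lemma finS: "finite S" and finE: "finite E"
proof -
  show "finite S" using SV finV by (rule finite_subset)
  then show "finite E" using E by (meson finite_SigmaI finite_subset)
qed

lemma gS_nonneg: "0 \<le> gS i"
proof -
  have "gcone S (\<lambda>\<sigma>. mon [a, i] \<sigma> * pair_w J E \<sigma>)"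
    by (intro gcone_mult[OF gcone.mon gcone_ferro] ferro_pair_w J)
  from gcone_sum_nonneg[OF this] show ?thesis by (simp add: gS_def)
qed

text \<open>Once the set \<omega> of expanded edges is fixed, the duplicated sum factors into this
  \<sigma>-sum and the \<tau>-sum \<open>tau_part\<close>.\<close>

definition sigma_part :: "'a list \<Rightarrow> ('a \<times> 'a) set \<Rightarrow> real" where
  "sigma_part B \<omega> = (\<Sum>\<sigma>\<in>spins V. mon (a # B) \<sigma> * wc \<sigma> * (\<Prod>e\<in>\<omega>. exp (2 * J e * (\<sigma> (fst e) * \<sigma> (snd e))) - 1))"

definition tau_part :: "'a \<Rightarrow> ('a \<times> 'a) set \<Rightarrow> real" where
  "tau_part i \<omega> = (\<Sum>\<tau>\<in>spins S. \<tau> a * \<tau> i * of_bool (agree \<omega> \<tau>))"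

lemma sigma_part_nonneg:
  assumes "\<omega> \<subseteq> E" shows "0 \<le> sigma_part B \<omega>"
  unfolding sigma_part_def
  by (intro gcone_sum_nonneg gcone_mult[OF gcone_mult[OF gcone.mon wc]] gcone_prod gcone_exp_minus_one J)
     (use assms in auto)

lemma tau_part_nonneg:
  assumes "\<omega> \<subseteq> E" shows "0 \<le> tau_part i \<omega>"
proof -
  have "finite \<omega>" using assms finE by (rule finite_subset)
  from gcone_sum_nonneg[OF gcone_mult[OF gcone.mon[of S "[a,i]"] gcone_agree[OF this]]]
  show ?thesis by (simp add: tau_part_def)
qed

lemma sigma_part_zero:
  assumes "\<omega> \<subseteq> E" "\<And>i. i \<in> set B \<Longrightarrow> i \<in> S \<Longrightarrow> (a, i) \<notin> (adj \<omega>)\<^sup>*"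
  shows "sigma_part B \<omega> = 0"
  unfolding sigma_part_def
proof (rule sum_spins_flip)
  let ?C = "(adj \<omega>)\<^sup>* `` {a}"
  have C: "?C \<subseteq> S" using assms E a by (intro cluster_subset) auto
  show fV: "flip ?C \<in> spins V" using C SV by (intro flip_in_spins) auto
  fix \<sigma> assume s: "\<sigma> \<in> spins V"
  have B: "mon B (flip ?C) = 1"
  proof -
    have "flip ?C i = 1" if "i \<in> set B" for i
      using assms(2)[OF that] C by (auto simp: flip_def)
    then show ?thesis by (induction B) auto
  qed
  have e: "smul \<sigma> (flip ?C) (fst e) * smul \<sigma> (flip ?C) (snd e) = \<sigma> (fst e) * \<sigma> (snd e)" if "e \<in> \<omega>" for e
    using agree_flip_cluster[of \<omega> a] that spins_cases[OF fV, of "snd e"] by (auto simp: agree_def smul_def)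
  have "flip ?C a = -1" by (auto simp: flip_def)
  then have "mon (a # B) (smul \<sigma> (flip ?C)) = - mon (a # B) \<sigma>"
    unfolding mon_smul using B by simp
  moreover have "wc (smul \<sigma> (flip ?C)) = wc \<sigma>" using s C by (intro wc_inv flip_in_spins)
  ultimately show "mon (a # B) (smul \<sigma> (flip ?C)) * wc (smul \<sigma> (flip ?C)) *
      (\<Prod>e\<in>\<omega>. exp (2 * J e * (smul \<sigma> (flip ?C) (fst e) * smul \<sigma> (flip ?C) (snd e))) - 1) =
      - (mon (a # B) \<sigma> * wc \<sigma> * (\<Prod>e\<in>\<omega>. exp (2 * J e * (\<sigma> (fst e) * \<sigma> (snd e))) - 1))"
    using e by simp
qed

lemma duplicate:
  assumes "\<And>\<sigma> \<tau>. (\<And>i. i \<in> S \<Longrightarrow> \<sigma> i = \<tau> i) \<Longrightarrow> g \<sigma> = g \<tau>"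
  shows "(\<Sum>\<sigma>\<in>spins V. f \<sigma> * (pair_w J E \<sigma> * wc \<sigma>)) * (\<Sum>\<sigma>\<in>spins S. g \<sigma> * pair_w J E \<sigma>) =
    (\<Sum>\<omega>\<in>Pow E. \<Sum>\<sigma>\<in>spins V. \<Sum>\<tau>\<in>spins S. f \<sigma> * g (smul \<sigma> \<tau>) * wc \<sigma> *
      (of_bool (agree \<omega> \<tau>) * (\<Prod>e\<in>\<omega>. exp (2 * J e * (\<sigma> (fst e) * \<sigma> (snd e))) - 1)))"
proof -
  have shift: "(\<Sum>\<sigma>'\<in>spins S. g \<sigma>' * pair_w J E \<sigma>') = (\<Sum>\<tau>\<in>spins S. g (smul \<sigma> \<tau>) * pair_w J E (smul \<sigma> \<tau>))"
    if "\<sigma> \<in> spins V" for \<sigma>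
  proof -
    let ?r = "\<lambda>i. if i \<in> S then \<sigma> i else 1"
    have r: "?r \<in> spins S" using that SV by (auto simp: spins_def)
    have "(\<Sum>\<sigma>'\<in>spins S. g \<sigma>' * pair_w J E \<sigma>') = (\<Sum>\<tau>\<in>spins S. g (smul ?r \<tau>) * pair_w J E (smul ?r \<tau>))"
      by (rule sum_spins_shift'[OF r, symmetric])
    also have "\<dots> = (\<Sum>\<tau>\<in>spins S. g (smul \<sigma> \<tau>) * pair_w J E (smul \<sigma> \<tau>))"
    proof (rule sum.cong[OF refl])
      fix \<tau>
      have "g (smul ?r \<tau>) = g (smul \<sigma> \<tau>)" by (rule assms) (simp add: smul_def)
      moreover have "pair_w J E (smul ?r \<tau>) = pair_w J E (smul \<sigma> \<tau>)"
        unfolding pair_w_def by (rule prod.cong) (use E in \<open>auto simp: smul_def\<close>)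
      ultimately show "g (smul ?r \<tau>) * pair_w J E (smul ?r \<tau>) = g (smul \<sigma> \<tau>) * pair_w J E (smul \<sigma> \<tau>)" by simp
    qed
    finally show ?thesis .
  qed
  have "(\<Sum>\<sigma>\<in>spins V. f \<sigma> * (pair_w J E \<sigma> * wc \<sigma>)) * (\<Sum>\<sigma>\<in>spins S. g \<sigma> * pair_w J E \<sigma>) =
    (\<Sum>\<sigma>\<in>spins V. f \<sigma> * (pair_w J E \<sigma> * wc \<sigma>) * (\<Sum>\<tau>\<in>spins S. g (smul \<sigma> \<tau>) * pair_w J E (smul \<sigma> \<tau>)))"
    unfolding sum_distrib_right by (intro sum.cong refl) (simp add: shift)
  also have "\<dots> = (\<Sum>\<sigma>\<in>spins V. \<Sum>\<tau>\<in>spins S. f \<sigma> * g (smul \<sigma> \<tau>) * wc \<sigma> * (pair_w J E \<sigma> * pair_w J E (smul \<sigma> \<tau>)))"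
    by (simp add: sum_distrib_left mult_ac)
  also have "\<dots> = (\<Sum>\<sigma>\<in>spins V. \<Sum>\<tau>\<in>spins S. \<Sum>\<omega>\<in>Pow E. f \<sigma> * g (smul \<sigma> \<tau>) * wc \<sigma> *
      (of_bool (agree \<omega> \<tau>) * (\<Prod>e\<in>\<omega>. exp (2 * J e * (\<sigma> (fst e) * \<sigma> (snd e))) - 1)))"
    by (intro sum.cong refl) (simp add: pair_w_smul_expand[OF finE] sum_distrib_left)
  also have "\<dots> = (\<Sum>\<omega>\<in>Pow E. \<Sum>\<sigma>\<in>spins V. \<Sum>\<tau>\<in>spins S. f \<sigma> * g (smul \<sigma> \<tau>) * wc \<sigma> *
      (of_bool (agree \<omega> \<tau>) * (\<Prod>e\<in>\<omega>. exp (2 * J e * (\<sigma> (fst e) * \<sigma> (snd e))) - 1)))"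
    unfolding sum.swap[of _ "Pow E" "spins S"] by (rule sum.swap)
  finally show ?thesis .
qed

text \<open>Duplicate the spins in \<open>S\<close> and expand in open edges \<open>\<omega>\<close>. If the \<open>\<omega>\<close>-cluster of \<open>a\<close> contains no
  element of \<open>B\<close>, flipping this cluster shows that the term vanishes (\<open>sigma_part_zero\<close>). Otherwise some \<open>i\<close>
  in \<open>B\<close> has \<open>\<tau> a = \<tau> i\<close> in this term.\<close>

lemma gaussian:
  "(\<Sum>\<sigma>\<in>spins V. mon (a # B) \<sigma> * (pair_w J E \<sigma> * wc \<sigma>)) * ZS
    \<le> (\<Sum>i\<leftarrow>filter (\<lambda>i. i \<in> S) B. gS i * (\<Sum>\<sigma>\<in>spins V. mon (i # B) \<sigma> * (pair_w J E \<sigma> * wc \<sigma>)))"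
proof -
  have gi: "gS i * (\<Sum>\<sigma>\<in>spins V. mon (i # B) \<sigma> * (pair_w J E \<sigma> * wc \<sigma>)) = (\<Sum>\<omega>\<in>Pow E. sigma_part B \<omega> * tau_part i \<omega>)"
    if "i \<in> S" for i
  proof -
    have "gS i * (\<Sum>\<sigma>\<in>spins V. mon (i # B) \<sigma> * (pair_w J E \<sigma> * wc \<sigma>)) =
      (\<Sum>\<sigma>\<in>spins V. mon (i # B) \<sigma> * (pair_w J E \<sigma> * wc \<sigma>)) * (\<Sum>\<sigma>\<in>spins S. (\<sigma> a * \<sigma> i) * pair_w J E \<sigma>)"
      unfolding gS_def by (rule mult.commute)
    also have "\<dots> = (\<Sum>\<omega>\<in>Pow E. \<Sum>\<sigma>\<in>spins V. \<Sum>\<tau>\<in>spins S. mon (i # B) \<sigma> * (smul \<sigma> \<tau> a * smul \<sigma> \<tau> i) * wc \<sigma> *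
      (of_bool (agree \<omega> \<tau>) * (\<Prod>e\<in>\<omega>. exp (2 * J e * (\<sigma> (fst e) * \<sigma> (snd e))) - 1)))"
      by (rule duplicate) (simp add: a that)
    \<comment> \<open>The spin at i occurs twice in the \<sigma>-product and cancels, which turns
      the list \<open>i # B\<close> into \<open>a # B\<close>; hence the same
      \<open>sigma_part\<close> serves for every i.\<close>
    also have "\<dots> = (\<Sum>\<omega>\<in>Pow E. sigma_part B \<omega> * tau_part i \<omega>)"
      unfolding sigma_part_def tau_part_def sum_product
      by (intro sum.cong refl) (simp add: smul_def mult_ac)
    finally show ?thesis .
  qed
  have "(\<Sum>\<sigma>\<in>spins V. mon (a # B) \<sigma> * (pair_w J E \<sigma> * wc \<sigma>)) * ZS =
     (\<Sum>\<omega>\<in>Pow E. \<Sum>\<sigma>\<in>spins V. \<Sum>\<tau>\<in>spins S. mon (a # B) \<sigma> * 1 * wc \<sigma> *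
      (of_bool (agree \<omega> \<tau>) * (\<Prod>e\<in>\<omega>. exp (2 * J e * (\<sigma> (fst e) * \<sigma> (snd e))) - 1)))"
    using duplicate[where g = "\<lambda>_. 1" and f = "mon (a # B)"] by (simp add: ZS_def)
  also have "\<dots> = (\<Sum>\<omega>\<in>Pow E. sigma_part B \<omega> * tau_part a \<omega>)"
    unfolding sigma_part_def tau_part_def sum_product
    by (intro sum.cong refl) (simp add: mult_ac)
  also have "\<dots> \<le> (\<Sum>\<omega>\<in>Pow E. \<Sum>i\<leftarrow>filter (\<lambda>i. i \<in> S) B. sigma_part B \<omega> * tau_part i \<omega>)"
  proof (rule sum_mono)
    fix \<omega> assume w: "\<omega> \<in> Pow E"
    have nn: "0 \<le> sigma_part B \<omega> * tau_part i \<omega>" for i using w sigma_part_nonneg tau_part_nonneg by auto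
    show "sigma_part B \<omega> * tau_part a \<omega> \<le> (\<Sum>i\<leftarrow>filter (\<lambda>i. i \<in> S) B. sigma_part B \<omega> * tau_part i \<omega>)"
    proof (cases "\<exists>i\<in>set B. i \<in> S \<and> (a, i) \<in> (adj \<omega>)\<^sup>*")
      case True
      then obtain i where i: "i \<in> set B" "i \<in> S" "(a, i) \<in> (adj \<omega>)\<^sup>*" by auto
      have "tau_part i \<omega> = tau_part a \<omega>"
        unfolding tau_part_def by (intro sum.cong refl) (auto dest: agree_path[OF _ i(3)])
      then have "sigma_part B \<omega> * tau_part a \<omega> \<in> set (map (\<lambda>i. sigma_part B \<omega> * tau_part i \<omega>) (filter (\<lambda>i. i \<in> S) B))"
        using i by (auto simp: image_iff intro: bexI[of _ i])
      then show ?thesis using nn by (intro member_le_sum_list) auto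
    next
      case False
      then have "sigma_part B \<omega> = 0" using w by (intro sigma_part_zero) auto
      then show ?thesis by simp
    qed
  qed
  also have "\<dots> = (\<Sum>i\<leftarrow>filter (\<lambda>i. i \<in> S) B. \<Sum>\<omega>\<in>Pow E. sigma_part B \<omega> * tau_part i \<omega>)"
    by (induction ("filter (\<lambda>i. i \<in> S) B")) (auto simp: sum.distrib)
  also have "\<dots> = (\<Sum>i\<leftarrow>filter (\<lambda>i. i \<in> S) B. gS i * (\<Sum>\<sigma>\<in>spins V. mon (i # B) \<sigma> * (pair_w J E \<sigma> * wc \<sigma>)))"
    by (intro arg_cong[where f = sum_list] map_cong refl) (simp del: mon_simps add: gi)
  finally show ?thesis .
qed

section \<open>Interactions that link the region to its complement\<close>

definition wsum :: "'k set \<Rightarrow> ('k \<Rightarrow> real) \<Rightarrow> ('k \<Rightarrow> 'a list) \<Rightarrow> 'a list \<Rightarrow> real" where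
  "wsum K c M B = (\<Sum>\<sigma>\<in>spins V. mon B \<sigma> * (pair_w J E \<sigma> * wc \<sigma> * (\<Prod>k\<in>K. exp (c k * mon (M k) \<sigma>))))"

lemma wsum_insert:
  assumes "finite K" "k \<notin> K"
  shows "wsum (insert k K) c M B = cosh (c k) * wsum K c M B + sinh (c k) * wsum K c M (M k @ B)"
  using assms by (simp add: wsum_def exp_mon sum_distrib_left sum.distrib[symmetric] algebra_simps cong: sum.cong)

lemma wsum_nonneg: "(\<And>k. k \<in> K \<Longrightarrow> 0 \<le> c k) \<Longrightarrow> 0 \<le> wsum K c M B"
  unfolding wsum_def
  by (intro gcone_sum_nonneg gcone_mult[OF gcone.mon gcone_mult[OF gcone_mult[OF gcone_ferro[OF ferro_pair_w] wc]]]
      gcone_prod gcone_exp_mon) (auto simp: J)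

lemma wsum_perm: "mset B = mset B' \<Longrightarrow> wsum K c M B = wsum K c M B'"
  unfolding wsum_def mon_def by (metis (no_types, lifting) mset_map prod_mset_prod_list)

text \<open>Induction over the linking terms. Writing \<open>exp (c k * mon (M k) \<sigma>)\<close>
  as cosh plus sinh times the monomial moves \<open>M k\<close> into the list \<open>B\<close>, so
  its sites in \<open>S\<close> become new endpoints, at the cost of the factor
  \<open>sinh (c k)\<close>.\<close>

theorem lieb_inequality:
  assumes "finite K" "\<And>k. k \<in> K \<Longrightarrow> 0 \<le> c k"
  shows "wsum K c M (a # B) * ZS \<le> (\<Sum>i\<leftarrow>filter (\<lambda>i. i \<in> S) B. gS i * wsum K c M (i # B)) +
     (\<Sum>k\<in>K. c k * (\<Sum>i\<leftarrow>filter (\<lambda>i. i \<in> S) (M k). gS i * wsum K c M (i # M k @ B)))"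
  using assms
proof (induction K arbitrary: B rule: finite_induct)
  case empty
  then show ?case using gaussian[of B] by (simp add: wsum_def)
next
  case (insert k K)
  let ?f = "\<lambda>B. filter (\<lambda>i. i \<in> S) B"
  let ?N = "wsum K c M" and ?N' = "wsum (insert k K) c M"
  note ins = wsum_insert[OF insert.hyps]
  have c0: "0 \<le> c k" "\<And>l. l \<in> K \<Longrightarrow> 0 \<le> c l" using insert.prems by auto
  have sc: "0 \<le> sinh (c k)" "0 \<le> cosh (c k)" using c0 by auto
  have sinh_le: "sinh (c k) \<le> c k * cosh (c k)"
    using c0(1) by (rule sinh_le_mult_cosh)
  have p1: "?N (k' # M k @ B) = ?N (M k @ k' # B)" for k' by (rule wsum_perm) simp
  have p2: "?N (i # M l @ M k @ B) = ?N (M k @ i # M l @ B)" for i l by (rule wsum_perm) simp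
  have "?N' (a # B) * ZS = cosh (c k) * (?N (a # B) * ZS) + sinh (c k) * (?N (a # M k @ B) * ZS)"
    by (simp add: ins p1 algebra_simps)
  also have "\<dots> \<le> cosh (c k) * ((\<Sum>i\<leftarrow>?f B. gS i * ?N (i # B)) + (\<Sum>l\<in>K. c l * (\<Sum>i\<leftarrow>?f (M l). gS i * ?N (i # M l @ B))))
    + sinh (c k) * ((\<Sum>i\<leftarrow>?f (M k @ B). gS i * ?N (i # M k @ B)) + (\<Sum>l\<in>K. c l * (\<Sum>i\<leftarrow>?f (M l). gS i * ?N (i # M l @ M k @ B))))"
    by (intro add_mono mult_left_mono insert.IH sc c0)
  also have "\<dots> = (\<Sum>i\<leftarrow>?f B. gS i * ?N' (i # B)) + sinh (c k) * (\<Sum>i\<leftarrow>?f (M k). gS i * ?N (i # M k @ B))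
     + (\<Sum>l\<in>K. c l * (\<Sum>i\<leftarrow>?f (M l). gS i * ?N' (i # M l @ B)))"
    by (simp add: ins p1 p2 algebra_simps sum_list_addf sum_list_const_mult sum.distrib sum_distrib_left)
  \<comment> \<open>The factor \<open>cosh (c k)\<close> left over from the sinh bound is absorbed
    by the cosh part of \<open>wsum_insert\<close> alone.\<close>
  also have "sinh (c k) * (\<Sum>i\<leftarrow>?f (M k). gS i * ?N (i # M k @ B)) \<le> c k * (\<Sum>i\<leftarrow>?f (M k). gS i * ?N' (i # M k @ B))"
  proof -
    have "sinh (c k) * ?N X \<le> c k * ?N' X" for X
    proof -
      have "sinh (c k) * ?N X \<le> c k * cosh (c k) * ?N X"
        using sinh_le wsum_nonneg[of K c M X] c0 by (intro mult_right_mono) auto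
      also have "\<dots> \<le> c k * ?N' X"
        unfolding ins using c0 sc wsum_nonneg[of K c M "M k @ X"] by (simp add: algebra_simps)
      finally show ?thesis .
    qed
    then have "(\<Sum>i\<leftarrow>?f (M k). gS i * (sinh (c k) * ?N (i # M k @ B))) \<le> (\<Sum>i\<leftarrow>?f (M k). gS i * (c k * ?N' (i # M k @ B)))"
      by (intro sum_list_mono mult_left_mono gS_nonneg)
    then show ?thesis by (simp add: sum_list_const_mult[symmetric] mult_ac)
  qed
  finally show ?case using insert.hyps by (simp add: algebra_simps)
qed

end

section \<open>The Ising two-point function in finite volume\<close>

lemma bij_betw_spins_Un:
  assumes "A \<inter> B = {}"
  shows "bij_betw (\<lambda>(\<sigma>, \<tau>). smul \<sigma> \<tau>) (spins A \<times> spins B) (spins (A \<union> B))"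
proof (rule bij_betw_byWitness[where f' = "\<lambda>\<sigma>. (\<lambda>i. if i \<in> A then \<sigma> i else 1, \<lambda>i. if i \<in> B then \<sigma> i else 1)"])
  show "\<forall>p\<in>spins A \<times> spins B. (\<lambda>\<sigma>. (\<lambda>i. if i \<in> A then \<sigma> i else 1, \<lambda>i. if i \<in> B then \<sigma> i else 1)) (case p of (\<sigma>, \<tau>) \<Rightarrow> smul \<sigma> \<tau>) = p"
    using assms by (auto simp: spins_def smul_def fun_eq_iff)
  show "\<forall>\<sigma>\<in>spins (A \<union> B). (case (\<lambda>i. if i \<in> A then \<sigma> i else 1, \<lambda>i. if i \<in> B then \<sigma> i else 1) of (\<sigma>, \<tau>) \<Rightarrow> smul \<sigma> \<tau>) = \<sigma>"
    using assms by (auto simp: spins_def smul_def fun_eq_iff)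
  have "spins A \<subseteq> spins (A \<union> B)" "spins B \<subseteq> spins (A \<union> B)" by (auto intro: spins_mono[THEN subsetD])
  then show "(\<lambda>(\<sigma>, \<tau>). smul \<sigma> \<tau>) ` (spins A \<times> spins B) \<subseteq> spins (A \<union> B)"
    by (auto intro!: smul_in_spins)
  show "(\<lambda>\<sigma>. (\<lambda>i. if i \<in> A then \<sigma> i else 1, \<lambda>i. if i \<in> B then \<sigma> i else 1)) ` spins (A \<union> B) \<subseteq> spins A \<times> spins B"
    by (auto simp: spins_def)
qed

lemma sum_spins_local:
  fixes f :: "('a \<Rightarrow> real) \<Rightarrow> real"
  assumes "V \<subseteq> W" "\<And>\<sigma> \<tau>. (\<And>i. i \<in> V \<Longrightarrow> \<sigma> i = \<tau> i) \<Longrightarrow> f \<sigma> = f \<tau>"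
  shows "(\<Sum>\<sigma>\<in>spins W. f \<sigma>) = real (card (spins (W - V))) * (\<Sum>\<sigma>\<in>spins V. f \<sigma>)"
proof -
  have W: "V \<union> (W - V) = W" using assms(1) by auto
  have "(\<Sum>\<sigma>\<in>spins W. f \<sigma>) = (\<Sum>p\<in>spins V \<times> spins (W - V). f (case p of (\<sigma>, \<tau>) \<Rightarrow> smul \<sigma> \<tau>))"
    using sum.reindex_bij_betw[OF bij_betw_spins_Un[of V "W - V"], of f] unfolding W by simp
  also have "\<dots> = (\<Sum>\<sigma>\<in>spins V. \<Sum>\<tau>\<in>spins (W - V). f (smul \<sigma> \<tau>))"
    by (simp add: sum.cartesian_product split_def)
  also have "\<dots> = (\<Sum>\<sigma>\<in>spins V. \<Sum>\<tau>\<in>spins (W - V). f \<sigma>)"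
    by (intro sum.cong refl assms(2)) (auto simp: smul_def spins_def)
  finally show ?thesis by (simp add: sum_distrib_left)
qed

lemma gibbs_local:
  assumes "finite W" "V \<subseteq> W" "\<And>\<sigma> \<tau>. (\<And>i. i \<in> V \<Longrightarrow> \<sigma> i = \<tau> i) \<Longrightarrow> f \<sigma> = f \<tau>"
    "\<And>\<sigma> \<tau>. (\<And>i. i \<in> V \<Longrightarrow> \<sigma> i = \<tau> i) \<Longrightarrow> w \<sigma> = w \<tau>"
  shows "gibbs W w f = gibbs V w f"
proof -
  have c: "card (spins (W - V)) \<noteq> 0" using assms(1) by simp
  have "(\<Sum>\<sigma>\<in>spins W. f \<sigma> * w \<sigma>) = real (card (spins (W - V))) * (\<Sum>\<sigma>\<in>spins V. f \<sigma> * w \<sigma>)"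
    by (rule sum_spins_local[OF assms(2)]) (metis assms(3,4))
  moreover have "(\<Sum>\<sigma>\<in>spins W. w \<sigma>) = real (card (spins (W - V))) * (\<Sum>\<sigma>\<in>spins V. w \<sigma>)"
    by (rule sum_spins_local[OF assms(2)]) (metis assms(4))
  ultimately show ?thesis using c by (simp add: gibbs_def)
qed

definition Jb :: "(int \<Rightarrow> real) \<Rightarrow> real \<Rightarrow> int \<times> int \<Rightarrow> real" where
  "Jb J \<beta> e = \<beta> * J (fst e - snd e)"

definition free_w :: "(int \<Rightarrow> real) \<Rightarrow> real \<Rightarrow> int set \<Rightarrow> (int \<Rightarrow> real) \<Rightarrow> real" where
  "free_w J \<beta> V = pair_w (Jb J \<beta>) (edges V)"

definition corr :: "(int \<Rightarrow> real) \<Rightarrow> real \<Rightarrow> int set \<Rightarrow> int \<Rightarrow> int \<Rightarrow> real" where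
  "corr J \<beta> V x y = gibbs V (free_w J \<beta> V) (\<lambda>\<sigma>. \<sigma> x * \<sigma> y)"

lemma finite_edges [simp]: "finite V \<Longrightarrow> finite (edges V)"
  by (rule finite_subset[of _ "V \<times> V"]) (auto simp: edges_def)

lemma edges_mono: "V \<subseteq> W \<Longrightarrow> edges V \<subseteq> edges W"
  by (auto simp: edges_def)

lemma free_w_local: "(\<And>i. i \<in> V \<Longrightarrow> \<sigma> i = \<tau> i) \<Longrightarrow> free_w J \<beta> V \<sigma> = free_w J \<beta> V \<tau>"
  unfolding free_w_def pair_w_def by (intro prod.cong refl) (auto simp: edges_def)

lemma gcone_pair: "gcone V (\<lambda>\<sigma>. \<sigma> x * \<sigma> y)"
  by (rule gcone.cong[OF gcone.mon[of V "[x, y]"]]) simp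

text \<open>Edges are stored with the smaller end first, whereas Lieb's double sum distinguishes the
  inner from the outer end.\<close>

lemma bij_betw_cross_edges:
  assumes "S \<subseteq> V"
  shows "bij_betw (\<lambda>(u, v). (min u v, max u v)) (S \<times> (V - S)) (edges V - edges S - edges (V - S))"
proof (rule bij_betw_byWitness[where f' = "\<lambda>(i, j). if i \<in> S then (i, j) else (j, i)"])
  show "\<forall>p\<in>S \<times> (V - S). (case (case p of (u, v) \<Rightarrow> (min u v, max u v)) of (i, j) \<Rightarrow> if i \<in> S then (i, j) else (j, i)) = p"
    by (auto simp: min_def max_def)
  show "\<forall>p\<in>edges V - edges S - edges (V - S). (case (case p of (i, j) \<Rightarrow> if i \<in> S then (i, j) else (j, i)) of (u, v) \<Rightarrow> (min u v, max u v)) = p"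
    using assms by (auto simp: edges_def)
  show "(\<lambda>(u, v). (min u v, max u v)) ` (S \<times> (V - S)) \<subseteq> edges V - edges S - edges (V - S)"
  proof (clarsimp)
    fix u v assume *: "u \<in> S" "v \<in> V" "v \<notin> S"
    then have "u \<noteq> v" by auto
    with * assms show "(min u v, max u v) \<in> edges V \<and> (min u v, max u v) \<notin> edges S \<and> (min u v, max u v) \<notin> edges (V - S)"
      by (auto simp: edges_def min_def max_def)
  qed
  show "(\<lambda>(i, j). if i \<in> S then (i, j) else (j, i)) ` (edges V - edges S - edges (V - S)) \<subseteq> S \<times> (V - S)"
    using assms by (auto simp: edges_def)
qed

locale ising =
  fixes J :: "int \<Rightarrow> real" and \<beta> :: real
  assumes J_nonneg: "\<And>x. 0 \<le> J x" and J_even: "\<And>x. J (- x) = J x" and beta: "0 \<le> \<beta>"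
begin

lemma Jb_nonneg: "0 \<le> Jb J \<beta> e"
  using J_nonneg beta by (auto simp: Jb_def)

lemma ferro_free_w: "ferro W (free_w J \<beta> V)"
  unfolding free_w_def by (intro ferro_pair_w Jb_nonneg)

lemma Z_pos: "finite V \<Longrightarrow> 0 < (\<Sum>\<sigma>\<in>spins V. free_w J \<beta> V \<sigma>)"
  by (intro ferro_Z_pos ferro_free_w)

lemma corr_nonneg: "finite V \<Longrightarrow> 0 \<le> corr J \<beta> V x y"
  unfolding corr_def by (intro gks1 ferro_free_w gcone_pair)

lemma corr_abs_le_1: "finite V \<Longrightarrow> \<bar>corr J \<beta> V x y\<bar> \<le> 1"
  unfolding corr_def
  by (intro gibbs_abs_le ferro_free_w) (use abs_mon[where xs = "[x, y]"] in auto)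

lemma corr_le_1: "finite V \<Longrightarrow> corr J \<beta> V x y \<le> 1"
  using corr_abs_le_1[of V x y] by auto

lemma corr_sym: "corr J \<beta> V x y = corr J \<beta> V y x"
  by (simp add: corr_def mult.commute)

lemma corr_diag: "finite V \<Longrightarrow> corr J \<beta> V x x = 1"
  unfolding corr_def using gibbs_const[OF _ ferro_free_w, of V V 1] by (subst gibbs_cong[where g = "\<lambda>_. 1"]) auto

lemma corr_triangle:
  assumes "finite V" shows "corr J \<beta> V x y * corr J \<beta> V y z \<le> corr J \<beta> V x z"
proof -
  have "corr J \<beta> V x y * corr J \<beta> V y z \<le> gibbs V (free_w J \<beta> V) (\<lambda>\<sigma>. (\<sigma> x * \<sigma> y) * (\<sigma> y * \<sigma> z))"
    unfolding corr_def by (intro gks2 assms ferro_free_w gcone_pair)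
  also have "\<dots> = corr J \<beta> V x z"
    unfolding corr_def by (rule gibbs_cong) (simp add: mult.assoc)
  finally show ?thesis .
qed

lemma free_w_split:
  assumes "finite W" "V \<subseteq> W"
  shows "free_w J \<beta> W \<sigma> = free_w J \<beta> V \<sigma> * pair_w (Jb J \<beta>) (edges W - edges V) \<sigma>"
  unfolding free_w_def pair_w_def
  using prod.subset_diff[OF edges_mono[OF assms(2)] finite_edges[OF assms(1)]] by (simp add: mult.commute)

text \<open>The volume grows in two moves: first free sites without couplings, which change nothing,
  then the missing couplings, which can only increase the expectation.\<close>

lemma gibbs_free_w_mono:
  assumes "finite W" "V \<subseteq> W" "\<And>\<sigma> \<tau>. (\<And>i. i \<in> V \<Longrightarrow> \<sigma> i = \<tau> i) \<Longrightarrow> f \<sigma> = f \<tau>" "gcone W f"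
  shows "gibbs V (free_w J \<beta> V) f \<le> gibbs W (free_w J \<beta> W) f"
proof -
  have "gibbs V (free_w J \<beta> V) f = gibbs W (free_w J \<beta> V) f"
    by (intro gibbs_local[symmetric] assms free_w_local)
  also have "\<dots> \<le> gibbs W (\<lambda>\<sigma>. free_w J \<beta> V \<sigma> * pair_w (Jb J \<beta>) (edges W - edges V) \<sigma>) f"
  proof -
    have f: "ferro W (pair_w (Jb J \<beta>) (edges W - edges V))" by (intro ferro_pair_w Jb_nonneg)
    then show ?thesis
      by (intro gibbs_weight_mono assms ferro_free_w gcone_ferro) (auto simp: ferro_def less_imp_le)
  qed
  also have "\<dots> = gibbs W (free_w J \<beta> W) f"
    by (intro gibbs_cong_weight) (simp add: free_w_split[OF assms(1,2)])
  finally show ?thesis .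
qed

lemma corr_mono_vol:
  assumes "finite W" "V \<subseteq> W" "x \<in> V" "y \<in> V"
  shows "corr J \<beta> V x y \<le> corr J \<beta> W x y"
  unfolding corr_def by (rule gibbs_free_w_mono) (use assms gcone_pair in auto)

lemma corr_translate:
  "corr J \<beta> ((+) t ` V) (t + x) (t + y) = corr J \<beta> V x y"
proof -
  let ?h = "\<lambda>\<sigma> i. \<sigma> (i - t)"
  have bij: "bij_betw ?h (spins V) (spins ((+) t ` V))"
    by (rule bij_betw_byWitness[where f' = "\<lambda>\<sigma> i. \<sigma> (i + t)"])
       (auto simp: spins_def image_iff algebra_simps, (metis add_diff_cancel_left' add.commute diff_add_cancel)+)
  have ed: "edges ((+) t ` V) = (\<lambda>(i, j). (t + i, t + j)) ` edges V"
    by (auto simp: edges_def image_iff)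
  have inj: "inj_on (\<lambda>(i, j). (t + i, t + j)) (edges V)" by (auto simp: inj_on_def)
  have w: "free_w J \<beta> ((+) t ` V) (?h \<sigma>) = free_w J \<beta> V \<sigma>" for \<sigma>
    unfolding free_w_def pair_w_def ed prod.reindex[OF inj] by (intro prod.cong refl) (auto simp: Jb_def)
  have "(\<Sum>\<sigma>\<in>spins ((+) t ` V). \<sigma> (t + x) * \<sigma> (t + y) * free_w J \<beta> ((+) t ` V) \<sigma>) = (\<Sum>\<sigma>\<in>spins V. \<sigma> x * \<sigma> y * free_w J \<beta> V \<sigma>)"
    unfolding sum.reindex_bij_betw[OF bij, symmetric] w by simp
  moreover have "(\<Sum>\<sigma>\<in>spins ((+) t ` V). free_w J \<beta> ((+) t ` V) \<sigma>) = (\<Sum>\<sigma>\<in>spins V. free_w J \<beta> V \<sigma>)"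
    unfolding sum.reindex_bij_betw[OF bij, symmetric] w by simp
  ultimately show ?thesis by (simp add: corr_def gibbs_def)
qed

text \<open>In the volume consisting of x and y alone the correlation is exactly this tanh; every
  larger volume increases it.\<close>

lemma corr_tanh:
  assumes "finite V" "x \<in> V" "y \<in> V" "x \<noteq> y"
  shows "tanh (\<beta> * J (x - y)) \<le> corr J \<beta> V x y"
proof -
  have *: "tanh (\<beta> * J (x - y)) \<le> corr J \<beta> V x y" if "x \<in> V" "y \<in> V" "x < y" for x y
  proof -
    have ed: "edges {x, y} = {(x, y)}" using that by (auto simp: edges_def)
    let ?b = "\<beta> * J (x - y)"
    let ?fx = "\<lambda>i. if i = x then -1 else 1 :: real" and ?fy = "\<lambda>i. if i = y then -1 else 1 :: real"
    have w: "free_w J \<beta> {x, y} \<sigma> = cosh ?b + sinh ?b * mon [x, y] \<sigma>" if "\<sigma> \<in> spins {x, y}" for \<sigma>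
      using exp_mon[OF that, of ?b "[x, y]"] by (simp add: free_w_def pair_w_def ed Jb_def)
    let ?S = "spins {x, y}" 
    have z: "(\<Sum>\<sigma>\<in>?S. mon [x, y] \<sigma>) = 0"
      by (rule sum_spins_flip[of "flip {x}"]) (use that in \<open>auto simp: flip_def smul_def spins_def\<close>)
    have c: "real (card ?S) > 0" by (simp add: card_gt_0_iff)
    have "(\<Sum>\<sigma>\<in>?S. free_w J \<beta> {x, y} \<sigma>) = (\<Sum>\<sigma>\<in>?S. cosh ?b + sinh ?b * mon [x, y] \<sigma>)"
      by (intro sum.cong refl w)
    also have "\<dots> = card ?S * cosh ?b"
      unfolding sum.distrib sum_distrib_left[symmetric] z by simp
    finally have 1: "(\<Sum>\<sigma>\<in>?S. free_w J \<beta> {x, y} \<sigma>) = card ?S * cosh ?b" .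
    have "(\<Sum>\<sigma>\<in>?S. \<sigma> x * \<sigma> y * free_w J \<beta> {x, y} \<sigma>) = (\<Sum>\<sigma>\<in>?S. cosh ?b * mon [x, y] \<sigma> + sinh ?b)"
      by (intro sum.cong refl) (auto simp: w algebra_simps)
    also have "\<dots> = card ?S * sinh ?b"
      unfolding sum.distrib sum_distrib_left[symmetric] z by simp
    finally have 2: "(\<Sum>\<sigma>\<in>?S. \<sigma> x * \<sigma> y * free_w J \<beta> {x, y} \<sigma>) = card ?S * sinh ?b" .
    have "tanh ?b = corr J \<beta> {x, y} x y"
      using c by (simp add: corr_def gibbs_def 1 2 tanh_def)
    also have "\<dots> \<le> corr J \<beta> V x y" using that assms by (intro corr_mono_vol) auto
    finally show ?thesis .
  qed
  show ?thesis
  proof (cases "x < y")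
    case True then show ?thesis using * assms by auto
  next
    case False
    then have "tanh (\<beta> * J (y - x)) \<le> corr J \<beta> V y x" using assms by (intro *) auto
    then show ?thesis using J_even[of "x - y"] corr_sym[of V x y] by simp
  qed
qed

text \<open>Instance of \<open>lieb_inequality\<close> in which \<open>wc\<close> holds the edges
  avoiding \<open>S\<close> and the linking terms are the edges from \<open>S\<close> to
  \<open>V - S\<close>, each with its two ends as monomial.\<close>

lemma corr_lieb:
  assumes V: "finite V" and S: "S \<subseteq> V" and a: "a \<in> S" and x: "x \<notin> S"
  shows "corr J \<beta> V a x \<le> (\<Sum>u\<in>S. \<Sum>v\<in>V - S. \<beta> * J (u - v) * corr J \<beta> S a u * corr J \<beta> V v x)"
proof -
  define wc where "wc = pair_w (Jb J \<beta>) (edges (V - S))"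
  interpret L: lieb V S "edges S" "Jb J \<beta>" wc a
  proof
    show "gcone V wc" unfolding wc_def by (intro gcone_ferro ferro_pair_w Jb_nonneg)
    show "wc (smul \<sigma> \<tau>) = wc \<sigma>" if "\<tau> \<in> spins S" for \<sigma> \<tau>
      unfolding wc_def pair_w_def
      by (intro prod.cong refl) (use that in \<open>auto simp: edges_def spins_def smul_def\<close>)
  qed (use assms Jb_nonneg in \<open>auto simp: edges_def\<close>)
  define K where "K = edges V - edges S - edges (V - S)"
  have finS: "finite S" using V S by (rule finite_subset[rotated])
  have K: "finite K" using V by (simp add: K_def)
  let ?M = "\<lambda>e::int \<times> int. [fst e, snd e]"
  have eV: "edges V = edges S \<union> (edges (V - S) \<union> K)" and d: "edges S \<inter> (edges (V - S) \<union> K) = {}" "edges (V - S) \<inter> K = {}"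
    using S by (auto simp: K_def edges_def)
  have wsum: "L.wsum K (Jb J \<beta>) ?M B = (\<Sum>\<sigma>\<in>spins V. mon B \<sigma> * free_w J \<beta> V \<sigma>)" for B
    unfolding L.wsum_def free_w_def eV
    by (intro sum.cong refl) (simp add: pair_w_def wc_def prod.union_disjoint[OF _ _ d(1)] prod.union_disjoint[OF _ _ d(2)] V finS K mult_ac)
  let ?Z = "\<Sum>\<sigma>\<in>spins V. free_w J \<beta> V \<sigma>"
  have Z: "?Z > 0" "L.ZS > 0" using Z_pos[OF V] Z_pos[OF finS] by (auto simp: L.ZS_def free_w_def)
  have NNG: "L.wsum K (Jb J \<beta>) ?M [v, x] = corr J \<beta> V v x * ?Z" for v
    using Z by (simp add: wsum corr_def gibbs_def mult.assoc)
  have gS: "L.gS u = corr J \<beta> S a u * L.ZS" for u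
    using Z by (simp add: L.gS_def L.ZS_def corr_def gibbs_def free_w_def)
  \<comment> \<open>Only the inner end u of a crossing edge passes the filter. It cancels against
    its copy in the edge monomial, which leaves the correlation from the outer end v to x.\<close>
  have NN4: "L.wsum K (Jb J \<beta>) ?M (u # [u, v] @ [x]) = L.wsum K (Jb J \<beta>) ?M [v, x]"
     "L.wsum K (Jb J \<beta>) ?M (u # [v, u] @ [x]) = L.wsum K (Jb J \<beta>) ?M [v, x]" for u v
    unfolding wsum by (intro sum.cong refl; simp; metis spins_sq(2) mult.left_commute)+
  define F where "F u v = \<beta> * J (u - v) * corr J \<beta> S a u * L.ZS * (corr J \<beta> V v x * ?Z)" for u v
  have Jb2: "Jb J \<beta> (u, v) = \<beta> * J (v - u)" "Jb J \<beta> (u, v) = \<beta> * J (u - v)" for u v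
    using J_even[of "u - v"] by (auto simp: Jb_def)
  let ?R = "\<lambda>e. Jb J \<beta> e * (\<Sum>i\<leftarrow>filter (\<lambda>i. i \<in> S) (?M e). L.gS i * L.wsum K (Jb J \<beta>) ?M (i # ?M e @ [x]))"
  \<comment> \<open>As x lies outside \<open>S\<close>, the first sum in Lieb's inequality is
    empty.\<close>
  have "corr J \<beta> V a x * ?Z * L.ZS \<le> (\<Sum>e\<in>K. ?R e)"
    using L.lieb_inequality[OF K, of "Jb J \<beta>" ?M "[x]"] Jb_nonneg x by (simp add: NNG)
  also have "\<dots> = (\<Sum>p\<in>S \<times> (V - S). ?R (case p of (u, v) \<Rightarrow> (min u v, max u v)))"
    unfolding K_def by (rule sum.reindex_bij_betw[OF bij_betw_cross_edges[OF S], symmetric])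
  also have "\<dots> = (\<Sum>(u, v)\<in>S \<times> (V - S). F u v)"
  proof (rule sum.cong[OF refl])
    fix p assume "p \<in> S \<times> (V - S)"
    then obtain u v where p: "p = (u, v)" "u \<in> S" "v \<notin> S" by auto
    then have "u \<noteq> v" by auto
    then consider "u < v" | "v < u" by linarith
    then show "?R (case p of (u, v) \<Rightarrow> (min u v, max u v)) = (case p of (u, v) \<Rightarrow> F u v)"
    proof cases
      case 1
      then show ?thesis using p NN4(1)[of u v] by (simp add: F_def gS NNG Jb2(2))
    next
      case 2
      then show ?thesis using p NN4(2)[of u v] by (simp add: F_def gS NNG Jb2(1))
    qed
  qed
  also have "\<dots> = (\<Sum>u\<in>S. \<Sum>v\<in>V - S. \<beta> * J (u - v) * corr J \<beta> S a u * corr J \<beta> V v x) * ?Z * L.ZS"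
    unfolding sum.cartesian_product[symmetric] F_def by (simp add: sum_distrib_left sum_distrib_right mult_ac)
  finally show ?thesis using Z by simp
qed

section \<open>Correlations in a boundary field\<close>

definition plus_w :: "(int \<Rightarrow> real) \<Rightarrow> int set \<Rightarrow> (int \<Rightarrow> real) \<Rightarrow> real" where
  "plus_w h V \<sigma> = free_w J \<beta> V \<sigma> * (\<Prod>i\<in>V. exp (h i * mon [i] \<sigma>))"

lemma ferro_plus_w: "(\<And>i. 0 \<le> h i) \<Longrightarrow> ferro W (plus_w h V)"
  unfolding plus_w_def by (intro ferro_mult ferro_prod ferro_exp_mon ferro_free_w)

text \<open>Lieb's inequality with \<open>S = V\<close>, where the linking terms are the one-site
  field terms. The empty list \<open>B\<close> gives the magnetization, and \<open>B = [x]\<close>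
  gives the pair.\<close>

lemma plus_w_lieb:
  assumes V: "finite V" and h: "\<And>i. 0 \<le> h i" and a: "a \<in> V" and x: "x \<in> V"
  shows "gibbs V (plus_w h V) (\<lambda>\<sigma>. \<sigma> a) \<le> (\<Sum>u\<in>V. h u * corr J \<beta> V a u)" (is ?A)
    and "gibbs V (plus_w h V) (\<lambda>\<sigma>. \<sigma> a * \<sigma> x) \<le> corr J \<beta> V a x + (\<Sum>u\<in>V. h u * corr J \<beta> V a u) * gibbs V (plus_w h V) (\<lambda>\<sigma>. \<sigma> x)" (is ?B)
proof -
  interpret L: lieb V V "edges V" "Jb J \<beta>" "\<lambda>_. 1" a
    by unfold_locales (use assms Jb_nonneg gcone_const[of 1] in \<open>auto simp: edges_def\<close>)
  let ?M = "\<lambda>i::int. [i]" and ?Z = "\<Sum>\<sigma>\<in>spins V. plus_w h V \<sigma>"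
  have wsum: "L.wsum V h ?M B = (\<Sum>\<sigma>\<in>spins V. mon B \<sigma> * plus_w h V \<sigma>)" for B
    unfolding L.wsum_def plus_w_def free_w_def by simp
  have Z: "?Z > 0" "L.ZS > 0" using ferro_Z_pos[OF V ferro_plus_w, OF h] Z_pos[OF V] by (auto simp: L.ZS_def free_w_def)
  have gS: "L.gS u = corr J \<beta> V a u * L.ZS" for u
    using Z by (simp add: L.gS_def L.ZS_def corr_def gibbs_def free_w_def)
  have NN1: "L.wsum V h ?M [u, u] = ?Z" for u unfolding wsum by (intro sum.cong) auto
  have NN2: "L.wsum V h ?M [u, u, x] = L.wsum V h ?M [x]" for u unfolding wsum by (intro sum.cong) auto
  have NN3: "L.wsum V h ?M [u] = gibbs V (plus_w h V) (\<lambda>\<sigma>. \<sigma> u) * ?Z" for u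
    using Z by (simp add: wsum gibbs_def)
  have NN5: "L.wsum V h ?M [u, v] = gibbs V (plus_w h V) (\<lambda>\<sigma>. \<sigma> u * \<sigma> v) * ?Z" for u v
    using Z by (simp add: wsum gibbs_def)
  have s: "(\<Sum>u\<in>V. h u * (\<Sum>i\<leftarrow>filter (\<lambda>i. i \<in> V) [u]. L.gS i * R i)) = (\<Sum>u\<in>V. h u * (corr J \<beta> V a u * L.ZS * R u))" for R
    by (intro sum.cong refl) (simp add: gS)
  have "gibbs V (plus_w h V) (\<lambda>\<sigma>. \<sigma> a) * ?Z * L.ZS \<le> (\<Sum>u\<in>V. h u * (\<Sum>i\<leftarrow>filter (\<lambda>i. i \<in> V) [u]. L.gS i * L.wsum V h ?M [i, u]))"
    using L.lieb_inequality[OF V, of h ?M "[]"] h by (simp add: NN3 cong: if_cong)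
  also have "\<dots> = (\<Sum>u\<in>V. h u * (corr J \<beta> V a u * L.ZS * ?Z))"
    by (intro sum.cong refl) (simp add: gS NN1)
  also have "\<dots> = (\<Sum>u\<in>V. h u * corr J \<beta> V a u) * ?Z * L.ZS"
    by (simp add: sum_distrib_left sum_distrib_right mult_ac)
  finally show ?A using Z by simp
  have "gibbs V (plus_w h V) (\<lambda>\<sigma>. \<sigma> a * \<sigma> x) * ?Z * L.ZS \<le> L.gS x * L.wsum V h ?M [x, x] + (\<Sum>u\<in>V. h u * (\<Sum>i\<leftarrow>filter (\<lambda>i. i \<in> V) [u]. L.gS i * L.wsum V h ?M [i, u, x]))"
    using L.lieb_inequality[OF V, of h ?M "[x]"] h x by (simp add: NN5 cong: if_cong)
  also have "\<dots> = corr J \<beta> V a x * L.ZS * ?Z + (\<Sum>u\<in>V. h u * (corr J \<beta> V a u * L.ZS * (gibbs V (plus_w h V) (\<lambda>\<sigma>. \<sigma> x) * ?Z)))"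
    unfolding NN1 gS by (intro arg_cong2[where f = "(+)"] sum.cong refl) (simp add: gS NN2 NN3)
  also have "\<dots> = (corr J \<beta> V a x + (\<Sum>u\<in>V. h u * corr J \<beta> V a u) * gibbs V (plus_w h V) (\<lambda>\<sigma>. \<sigma> x)) * ?Z * L.ZS"
    by (simp add: sum_distrib_left sum_distrib_right algebra_simps)
  finally show ?B using Z by simp
qed

lemma plus_w_ge_corr:
  assumes "finite V" "\<And>i. 0 \<le> h i"
  shows "corr J \<beta> V x y \<le> gibbs V (plus_w h V) (\<lambda>\<sigma>. \<sigma> x * \<sigma> y)"
proof -
  have "ferro V (\<lambda>\<sigma>. \<Prod>i\<in>V. exp (h i * mon [i] \<sigma>))" by (intro ferro_prod ferro_exp_mon assms)
  moreover have "(\<Prod>i\<in>V. exp (h i * mon [i] (\<lambda>_. 1))) > 0" by (intro prod_pos) auto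
  ultimately show ?thesis unfolding corr_def plus_w_def
    by (intro gibbs_weight_mono assms ferro_free_w gcone_pair) (auto simp: ferro_def less_imp_le simp del: mon_simps)
qed

end

lemma corr_mono_beta:
  assumes "ising J \<beta>" "\<beta> \<le> \<beta>'" "finite V"
  shows "corr J \<beta> V x y \<le> corr J \<beta>' V x y"
proof -
  interpret ising J \<beta> by fact
  have f: "ferro V (free_w J (\<beta>' - \<beta>) V)"
    unfolding free_w_def by (intro ferro_pair_w) (use assms J_nonneg in \<open>auto simp: Jb_def\<close>)
  have "corr J \<beta> V x y \<le> gibbs V (\<lambda>\<sigma>. free_w J \<beta> V \<sigma> * free_w J (\<beta>' - \<beta>) V \<sigma>) (\<lambda>\<sigma>. \<sigma> x * \<sigma> y)"
    unfolding corr_def using f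
    by (intro gibbs_weight_mono ferro_free_w assms gcone_pair gcone_ferro[OF f]) (auto simp: ferro_def less_imp_le)
  also have "\<dots> = corr J \<beta>' V x y"
    unfolding corr_def
    by (intro gibbs_cong_weight) (simp add: free_w_def pair_w_def Jb_def prod.distrib[symmetric] algebra_simps flip: exp_add)
  finally show ?thesis .
qed

lemma continuous_corr: 
  assumes "finite V" shows "continuous_on UNIV (\<lambda>\<beta>. corr J \<beta> V x y)"
proof -
  have "(\<Sum>\<sigma>\<in>spins V. free_w J \<beta> V \<sigma>) > 0" for \<beta>
    using assms by (intro sum_pos) (auto simp: free_w_def pair_w_def intro!: prod_pos)
  then have "(\<Sum>\<sigma>\<in>spins V. free_w J \<beta> V \<sigma>) \<noteq> 0" for \<beta> by (metis less_irrefl)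
  then show ?thesis
    unfolding corr_def gibbs_def free_w_def pair_w_def Jb_def by (intro continuous_intros) auto
qed

section \<open>Comparison with Bernoulli percolation\<close>

text \<open>The expectation of \<open>f\<close> for independent edges, edge e being open with
  probability \<open>p e\<close>.\<close>

definition bern :: "'e set \<Rightarrow> ('e \<Rightarrow> real) \<Rightarrow> ('e set \<Rightarrow> real) \<Rightarrow> real" where
  "bern E p f = (\<Sum>\<omega>\<in>Pow E. (\<Prod>e\<in>\<omega>. p e) * (\<Prod>e\<in>E - \<omega>. 1 - p e) * f \<omega>)"

lemma bern_empty [simp]: "bern {} p f = f {}"
  by (simp add: bern_def)

lemma bern_insert:
  assumes "finite E" "e \<notin> E"
  shows "bern (insert e E) p f = p e * bern E p (\<lambda>\<omega>. f (insert e \<omega>)) + (1 - p e) * bern E p f"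
proof -
  have inj: "inj_on (insert e) (Pow E)" using assms(2) by (auto simp: inj_on_def)
  have dis: "Pow E \<inter> insert e ` Pow E = {}" using assms(2) by auto
  have 1: "(\<Prod>i\<in>insert e E - \<omega>. 1 - p i) = (1 - p e) * (\<Prod>i\<in>E - \<omega>. 1 - p i)" if "\<omega> \<in> Pow E" for \<omega>
    using that assms by (subst insert_Diff_if) auto
  have 2: "(\<Prod>i\<in>insert e E - insert e \<omega>. 1 - p i) = (\<Prod>i\<in>E - \<omega>. 1 - p i)" "(\<Prod>i\<in>insert e \<omega>. p i) = p e * (\<Prod>i\<in>\<omega>. p i)"
    if "\<omega> \<in> Pow E" for \<omega>
  proof -
    have "insert e E - insert e \<omega> = E - \<omega>" using assms that by auto
    then show "(\<Prod>i\<in>insert e E - insert e \<omega>. 1 - p i) = (\<Prod>i\<in>E - \<omega>. 1 - p i)" by simp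
    show "(\<Prod>i\<in>insert e \<omega>. p i) = p e * (\<Prod>i\<in>\<omega>. p i)"
      using that assms finite_subset by (intro prod.insert) auto
  qed
  have "bern (insert e E) p f = (\<Sum>\<omega>\<in>Pow E. (1 - p e) * ((\<Prod>e\<in>\<omega>. p e) * (\<Prod>e\<in>E - \<omega>. 1 - p e) * f \<omega>)) +
     (\<Sum>\<omega>\<in>Pow E. p e * ((\<Prod>e\<in>\<omega>. p e) * (\<Prod>e\<in>E - \<omega>. 1 - p e) * f (insert e \<omega>)))"
    unfolding bern_def Pow_insert using assms dis
    by (subst sum.union_disjoint) (auto simp: sum.reindex[OF inj] 1 2 mult_ac intro!: sum.cong)
  then show ?thesis by (simp add: bern_def sum_distrib_left)
qed

lemma bern_mono:
  assumes "\<And>e. e \<in> E \<Longrightarrow> 0 \<le> p e \<and> p e \<le> 1" "\<And>\<omega>. \<omega> \<subseteq> E \<Longrightarrow> f \<omega> \<le> g \<omega>"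
  shows "bern E p f \<le> bern E p g"
  unfolding bern_def
  by (intro sum_mono mult_left_mono mult_nonneg_nonneg prod_nonneg) (use assms in \<open>auto simp: subset_iff\<close>)

lemma bern_add: "bern E p (\<lambda>\<omega>. f \<omega> + g \<omega>) = bern E p f + bern E p g"
  by (simp add: bern_def algebra_simps sum.distrib)

lemma bern_scale: "bern E p (\<lambda>\<omega>. c * f \<omega>) = c * bern E p f"
  by (simp add: bern_def algebra_simps sum_distrib_left)

lemma bern_sum: "bern E p (\<lambda>\<omega>. \<Sum>k\<in>K. f k \<omega>) = (\<Sum>k\<in>K. bern E p (f k))"
  by (simp add: bern_def sum_distrib_left) (rule sum.swap)

text \<open>Conditioning on one edge: within each of its two states the induction hypothesis
  applies, and what remains is the two-point case. With one function increasing and the other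
  decreasing, the correlation is negative.\<close>

lemma harris:
  assumes "finite E" "\<And>e. e \<in> E \<Longrightarrow> 0 \<le> p e \<and> p e \<le> 1"
    "\<And>\<omega> \<omega>'. \<omega> \<subseteq> \<omega>' \<Longrightarrow> \<omega>' \<subseteq> E \<Longrightarrow> f \<omega> \<le> f \<omega>'"
    "\<And>\<omega> \<omega>'. \<omega> \<subseteq> \<omega>' \<Longrightarrow> \<omega>' \<subseteq> E \<Longrightarrow> g \<omega>' \<le> g \<omega>"
  shows "bern E p (\<lambda>\<omega>. f \<omega> * g \<omega>) \<le> bern E p f * bern E p g"
  using assms
proof (induction E arbitrary: f g rule: finite_induct)
  case (insert e E)
  let ?f = "\<lambda>\<omega>. f (insert e \<omega>)" and ?g = "\<lambda>\<omega>. g (insert e \<omega>)"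
  let ?F1 = "bern E p ?f" and ?F0 = "bern E p f" and ?G1 = "bern E p ?g" and ?G0 = "bern E p g"
  have open_prob: "0 \<le> p e" "p e \<le> 1" and pE: "\<And>x. x \<in> E \<Longrightarrow> 0 \<le> p x \<and> p x \<le> 1" using insert.prems(1) by auto
  have m1: "bern E p (\<lambda>\<omega>. ?f \<omega> * ?g \<omega>) \<le> ?F1 * ?G1"
    by (rule insert.IH[OF pE]) (assumption, (rule insert.prems(2,3); auto)+)
  have m0: "bern E p (\<lambda>\<omega>. f \<omega> * g \<omega>) \<le> ?F0 * ?G0"
    by (rule insert.IH[OF pE]) (assumption, (rule insert.prems(2,3); auto)+)
  have F: "?F0 \<le> ?F1" by (rule bern_mono[OF pE]) (assumption, rule insert.prems(2), auto)
  have G: "?G1 \<le> ?G0" by (rule bern_mono[OF pE]) (assumption, rule insert.prems(3), auto)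
  \<comment> \<open>The two-point case: this is the product of the averages minus the average of the
    products over the state of e.\<close>
  have "0 \<le> p e * (1 - p e) * ((?F1 - ?F0) * (?G0 - ?G1))"
    using F G open_prob by (intro mult_nonneg_nonneg) auto
  then have "p e * (?F1 * ?G1) + (1 - p e) * (?F0 * ?G0) \<le>
      (p e * ?F1 + (1 - p e) * ?F0) * (p e * ?G1 + (1 - p e) * ?G0)"
    by (simp add: algebra_simps)
  moreover have "p e * bern E p (\<lambda>\<omega>. ?f \<omega> * ?g \<omega>) + (1 - p e) * bern E p (\<lambda>\<omega>. f \<omega> * g \<omega>)
      \<le> p e * (?F1 * ?G1) + (1 - p e) * (?F0 * ?G0)"
    using m1 m0 open_prob by (intro add_mono mult_left_mono) auto
  ultimately show ?case unfolding bern_insert[OF insert.hyps] by linarith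
qed simp

lemma bern_avoid:
  assumes "finite E" "D \<subseteq> E"
  shows "bern E p (\<lambda>\<omega>. of_bool (\<omega> \<inter> D = {})) = (\<Prod>e\<in>D. 1 - p e)"
proof -
  have "bern E p (\<lambda>\<omega>. of_bool (\<omega> \<inter> D = {})) = (\<Sum>\<omega>\<in>Pow E. (\<Prod>e\<in>\<omega>. of_bool (e \<notin> D) * p e) * (\<Prod>e\<in>E - \<omega>. 1 - p e))"
    unfolding bern_def
  proof (rule sum.cong[OF refl])
    fix \<omega> assume "\<omega> \<in> Pow E"
    then have "finite \<omega>" using assms(1) by (auto intro: finite_subset)
    then have "(\<Prod>e\<in>\<omega>. of_bool (e \<notin> D) * p e) = of_bool (\<omega> \<inter> D = {}) * (\<Prod>e\<in>\<omega>. p e)"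
      by (induction \<omega> rule: finite_induct) auto
    then show "(\<Prod>e\<in>\<omega>. p e) * (\<Prod>e\<in>E - \<omega>. 1 - p e) * of_bool (\<omega> \<inter> D = {}) = (\<Prod>e\<in>\<omega>. of_bool (e \<notin> D) * p e) * (\<Prod>e\<in>E - \<omega>. 1 - p e)"
      by simp
  qed
  also have "\<dots> = (\<Prod>e\<in>E. of_bool (e \<notin> D) * p e + (1 - p e))"
    by (rule prod_add[symmetric]) fact
  also have "\<dots> = (\<Prod>e\<in>E. if e \<in> D then 1 - p e else 1)" by (intro prod.cong) auto
  also have "\<dots> = (\<Prod>e\<in>D. 1 - p e)" using assms by (simp add: prod.inter_restrict[symmetric] Int_absorb1)
  finally show ?thesis .
qed

lemma bern_one: "finite E \<Longrightarrow> bern E p (\<lambda>_. 1) = 1"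
  using bern_avoid[of E "{}" p] by simp

section \<open>Edwards-Sokal expansion and the random-cluster representation\<close>

lemma agree_smul_flip: "\<sigma> \<in> spins V \<Longrightarrow> agree \<omega> (smul \<sigma> (flip ((adj \<omega>)\<^sup>* `` {a}))) = agree \<omega> \<sigma>"
proof -
  have "smul \<sigma> (flip ((adj \<omega>)\<^sup>* `` {a})) (fst e) = smul \<sigma> (flip ((adj \<omega>)\<^sup>* `` {a})) (snd e) \<longleftrightarrow> \<sigma> (fst e) = \<sigma> (snd e)" if "e \<in> \<omega>" for e
  proof -
    have "flip ((adj \<omega>)\<^sup>* `` {a}) (fst e) = flip ((adj \<omega>)\<^sup>* `` {a}) (snd e)"
      using agree_flip_cluster[of \<omega> a] that by (auto simp: agree_def)
    moreover have "flip ((adj \<omega>)\<^sup>* `` {a}) (snd e) \<noteq> 0" by (auto simp: flip_def)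
    ultimately show ?thesis by (simp add: smul_def)
  qed
  then show ?thesis by (simp add: agree_def)
qed

text \<open>The cluster weight of the FK model: 2 to the number of clusters, by
  \<open>nagree_eq_power\<close>. As a sum of indicators it is visibly decreasing in \<omega>,
  without counting components.\<close>

definition nagree :: "'a set \<Rightarrow> ('a \<times> 'a) set \<Rightarrow> real" where
  "nagree V \<omega> = (\<Sum>\<sigma>\<in>spins V. of_bool (agree \<omega> \<sigma>))"

text \<open>Given \<omega>, the spins are constant on clusters and independent between them. If y is
  not in the cluster of x, flipping that cluster changes the sign.\<close>

lemma sum_agree_pair:
  assumes "finite V" "\<omega> \<subseteq> V \<times> V" "x \<in> V"
  shows "(\<Sum>\<sigma>\<in>spins V. \<sigma> x * \<sigma> y * of_bool (agree \<omega> \<sigma>)) = of_bool ((x, y) \<in> (adj \<omega>)\<^sup>*) * nagree V \<omega>"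
proof (cases "(x, y) \<in> (adj \<omega>)\<^sup>*")
  case True
  then show ?thesis unfolding nagree_def by (auto intro!: sum.cong simp: agree_path[OF _ True])
next
  case False
  have "(\<Sum>\<sigma>\<in>spins V. \<sigma> x * \<sigma> y * of_bool (agree \<omega> \<sigma>)) = 0"
  proof (rule sum_spins_flip)
    show "flip ((adj \<omega>)\<^sup>* `` {x}) \<in> spins V"
      by (intro flip_in_spins cluster_subset assms)
    fix \<sigma> assume s: "\<sigma> \<in> spins V"
    show "smul \<sigma> (flip ((adj \<omega>)\<^sup>* `` {x})) x * smul \<sigma> (flip ((adj \<omega>)\<^sup>* `` {x})) y * of_bool (agree \<omega> (smul \<sigma> (flip ((adj \<omega>)\<^sup>* `` {x})))) =
       - (\<sigma> x * \<sigma> y * of_bool (agree \<omega> \<sigma>))"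
      unfolding agree_smul_flip[OF s] using False by (simp add: smul_def flip_def)
  qed
  then show ?thesis using False by simp
qed

text \<open>With p = 1 - exp(-2J), each edge factor is exp(J) times p on agreement plus 1 - p;
  expanding the product selects the open edges.\<close>

lemma pair_w_expand:
  assumes "finite E" "\<sigma> \<in> spins V"
  shows "pair_w J E \<sigma> = (\<Prod>e\<in>E. exp (J e)) * bern E (\<lambda>e. 1 - exp (- 2 * J e)) (\<lambda>\<omega>. of_bool (agree \<omega> \<sigma>))"
proof -
  let ?p = "\<lambda>e. 1 - exp (- 2 * J e)"
  have "pair_w J E \<sigma> = (\<Prod>e\<in>E. exp (J e)) * (\<Prod>e\<in>E. of_bool (\<sigma> (fst e) = \<sigma> (snd e)) * ?p e + (1 - ?p e))"
    unfolding pair_w_def prod.distrib[symmetric]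
  proof (rule prod.cong[OF refl])
    fix e
    show "exp (J e * (\<sigma> (fst e) * \<sigma> (snd e))) = exp (J e) * (of_bool (\<sigma> (fst e) = \<sigma> (snd e)) * ?p e + (1 - ?p e))"
      using spins_cases[OF assms(2), of "fst e"] spins_cases[OF assms(2), of "snd e"]
      by (auto simp flip: exp_add)
  qed
  also have "(\<Prod>e\<in>E. of_bool (\<sigma> (fst e) = \<sigma> (snd e)) * ?p e + (1 - ?p e)) =
     (\<Sum>\<omega>\<in>Pow E. (\<Prod>e\<in>\<omega>. of_bool (\<sigma> (fst e) = \<sigma> (snd e)) * ?p e) * (\<Prod>e\<in>E - \<omega>. 1 - ?p e))"
    by (rule prod_add) fact
  also have "\<dots> = bern E ?p (\<lambda>\<omega>. of_bool (agree \<omega> \<sigma>))"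
    unfolding bern_def
  proof (rule sum.cong[OF refl])
    fix \<omega> assume "\<omega> \<in> Pow E"
    then have "finite \<omega>" using assms(1) by (auto intro: finite_subset)
    from prod_of_bool_agree[OF this, of \<sigma> ?p]
    show "(\<Prod>e\<in>\<omega>. of_bool (\<sigma> (fst e) = \<sigma> (snd e)) * ?p e) * (\<Prod>e\<in>E - \<omega>. 1 - ?p e) =
      (\<Prod>e\<in>\<omega>. ?p e) * (\<Prod>e\<in>E - \<omega>. 1 - ?p e) * of_bool (agree \<omega> \<sigma>)" by simp
  qed
  finally show ?thesis .
qed

lemma sum_bern: "(\<Sum>\<sigma>\<in>A. f \<sigma> * bern E p (g \<sigma>)) = bern E p (\<lambda>\<omega>. \<Sum>\<sigma>\<in>A. f \<sigma> * g \<sigma> \<omega>)"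
  by (simp add: bern_sum bern_scale)

lemma sum_pair_w_expand:
  assumes "finite E"
  shows "(\<Sum>\<sigma>\<in>spins V. f \<sigma> * pair_w J E \<sigma>) =
    (\<Prod>e\<in>E. exp (J e)) * bern E (\<lambda>e. 1 - exp (- 2 * J e)) (\<lambda>\<omega>. \<Sum>\<sigma>\<in>spins V. f \<sigma> * of_bool (agree \<omega> \<sigma>))"
proof -
  have "(\<Sum>\<sigma>\<in>spins V. f \<sigma> * pair_w J E \<sigma>) = (\<Sum>\<sigma>\<in>spins V. (\<Prod>e\<in>E. exp (J e)) * (f \<sigma> * bern E (\<lambda>e. 1 - exp (- 2 * J e)) (\<lambda>\<omega>. of_bool (agree \<omega> \<sigma>))))"
    by (intro sum.cong refl) (simp add: pair_w_expand[OF assms])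
  then show ?thesis by (simp add: sum_distrib_left[symmetric] sum_bern)
qed

context ising begin

definition open_prob :: "int \<times> int \<Rightarrow> real" where "open_prob e = 1 - exp (- 2 * Jb J \<beta> e)"

lemma open_prob_bounds: "0 \<le> open_prob e \<and> open_prob e \<le> 1"
  using Jb_nonneg[of e] by (auto simp: open_prob_def)

lemma Z_bern:
  assumes V: "finite V"
  shows "(\<Sum>\<sigma>\<in>spins V. free_w J \<beta> V \<sigma>) = (\<Prod>e\<in>edges V. exp (Jb J \<beta> e)) * bern (edges V) open_prob (nagree V)"
    (is "_ = ?C * _")
  and "0 < bern (edges V) open_prob (nagree V)"
proof -
  have open_prob: "(\<lambda>e. 1 - exp (- (2 * Jb J \<beta> e))) = open_prob" by (simp add: open_prob_def fun_eq_iff)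
  show e: "(\<Sum>\<sigma>\<in>spins V. free_w J \<beta> V \<sigma>) = ?C * bern (edges V) open_prob (nagree V)"
    using sum_pair_w_expand[of "edges V" "\<lambda>_. 1" "Jb J \<beta>" V] V by (simp add: free_w_def open_prob nagree_def[abs_def])
  have "?C > 0" by (intro prod_pos) auto
  then show "0 < bern (edges V) open_prob (nagree V)" using Z_pos[OF V] unfolding e by (simp add: zero_less_mult_iff)
qed

lemma corr_eq_bern:
  assumes V: "finite V" and x: "x \<in> V"
  shows "corr J \<beta> V x y = bern (edges V) open_prob (\<lambda>\<omega>. of_bool ((x, y) \<in> (adj \<omega>)\<^sup>*) * nagree V \<omega>) / bern (edges V) open_prob (nagree V)"
proof -
  let ?C = "\<Prod>e\<in>edges V. exp (Jb J \<beta> e)" and ?B = "bern (edges V) open_prob"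
  have open_prob: "(\<lambda>e. 1 - exp (- (2 * Jb J \<beta> e))) = open_prob" by (simp add: open_prob_def fun_eq_iff)
  have "?B (\<lambda>\<omega>. \<Sum>\<sigma>\<in>spins V. \<sigma> x * \<sigma> y * of_bool (agree \<omega> \<sigma>)) = ?B (\<lambda>\<omega>. of_bool ((x, y) \<in> (adj \<omega>)\<^sup>*) * nagree V \<omega>)"
    unfolding bern_def by (intro sum.cong refl arg_cong2[where f = "(*)"] sum_agree_pair V x) (auto simp: edges_def)
  then have "(\<Sum>\<sigma>\<in>spins V. \<sigma> x * \<sigma> y * free_w J \<beta> V \<sigma>) = ?C * ?B (\<lambda>\<omega>. of_bool ((x, y) \<in> (adj \<omega>)\<^sup>*) * nagree V \<omega>)"
    using sum_pair_w_expand[of "edges V" "\<lambda>\<sigma>. \<sigma> x * \<sigma> y" "Jb J \<beta>" V] V by (simp add: free_w_def open_prob)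
  moreover have "?C \<noteq> 0" using V by simp
  ultimately show ?thesis unfolding corr_def gibbs_def Z_bern(1)[OF V] by simp
qed

text \<open>The FK measure has density \<open>nagree\<close> with respect to independent edges, up
  to normalization. The density is decreasing and connection is increasing, so \<open>harris\<close>
  removes it.\<close>

lemma corr_le_bern:
  assumes V: "finite V" and x: "x \<in> V"
  shows "corr J \<beta> V x y \<le> bern (edges V) open_prob (\<lambda>\<omega>. of_bool ((x, y) \<in> (adj \<omega>)\<^sup>*))"
proof -
  let ?B = "bern (edges V) open_prob"
  have "?B (\<lambda>\<omega>. of_bool ((x, y) \<in> (adj \<omega>)\<^sup>*) * nagree V \<omega>) \<le> ?B (\<lambda>\<omega>. of_bool ((x, y) \<in> (adj \<omega>)\<^sup>*)) * ?B (nagree V)"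
  proof (rule harris)
    fix \<omega> \<omega>' :: "(int \<times> int) set" assume s: "\<omega> \<subseteq> \<omega>'"
    then have "adj \<omega> \<subseteq> adj \<omega>'" by (auto simp: adj_def)
    then have "(adj \<omega>)\<^sup>* \<subseteq> (adj \<omega>')\<^sup>*" by (rule rtrancl_mono)
    then show "of_bool ((x, y) \<in> (adj \<omega>)\<^sup>*) \<le> (of_bool ((x, y) \<in> (adj \<omega>')\<^sup>*) :: real)" by auto
    show "nagree V \<omega>' \<le> nagree V \<omega>"
      unfolding nagree_def by (intro sum_mono) (use s in \<open>auto simp: agree_def\<close>)
  qed (use V open_prob_bounds in auto)
  then show ?thesis
    unfolding corr_eq_bern[OF V x] by (subst pos_divide_le_eq) (rule Z_bern(2)[OF V])
qed

text \<open>On the line an edge of length r can cross a given cut in r positions. So this sum bounds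
  the total coupling of the edges longer than m across one cut, uniformly in the volume.\<close>

definition tail_moment :: "nat \<Rightarrow> real" where
  "tail_moment m = (\<Sum>r. real (r + Suc m) * J (int (r + Suc m)))"

context
  assumes sumJ: "summable (\<lambda>r. real r * J (int r))"
begin

lemma summable_tail_moment: "summable (\<lambda>r. real (r + Suc m) * J (int (r + Suc m)))"
  using summable_ignore_initial_segment[OF sumJ, of "Suc m"] by simp

lemma tail_moment_nonneg: "0 \<le> tail_moment m"
  unfolding tail_moment_def by (intro suminf_nonneg summable_tail_moment) (simp add: J_nonneg)

lemma tail_moment_antimono: "m \<le> n \<Longrightarrow> tail_moment n \<le> tail_moment m"
proof -
  assume "m \<le> n"
  have "tail_moment (Suc m) \<le> tail_moment m" for m
  proof -
    have "tail_moment m = (\<Sum>r. real (Suc r + Suc m) * J (int (Suc r + Suc m))) + real (0 + Suc m) * J (int (0 + Suc m))"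
      unfolding tail_moment_def using suminf_split_head[OF summable_tail_moment[of m]] by simp
    then show ?thesis by (simp add: tail_moment_def J_nonneg)
  qed
  then show ?thesis using \<open>m \<le> n\<close> by (rule lift_Suc_antimono_le)
qed

lemma tail_moment_tendsto: "tail_moment \<longlonglongrightarrow> 0"
proof -
  have "(\<lambda>m. \<Sum>r. real (r + m) * J (int (r + m))) \<longlonglongrightarrow> 0"
    using suminf_exist_split2[OF sumJ] by simp
  then show ?thesis unfolding tail_moment_def by (rule LIMSEQ_Suc)
qed

lemma sum_cross_le:
  assumes "finite D" "\<And>e. e \<in> D \<Longrightarrow> fst e \<le> k \<and> k + int m < snd e"
  shows "(\<Sum>e\<in>D. J (fst e - snd e)) \<le> tail_moment m"
proof -
  \<comment> \<open>An edge is recorded by its length and the distance of its left end to the cut;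
    the second number is smaller than the first.\<close>
  define \<phi> where "\<phi> e = (nat (snd e - fst e), nat (k - fst e))" for e :: "int \<times> int"
  have inj: "inj_on \<phi> D"
  proof (rule inj_onI)
    fix e e' assume "e \<in> D" "e' \<in> D" "\<phi> e = \<phi> e'"
    then show "e = e'" using assms(2)[of e] assms(2)[of e'] by (auto simp: \<phi>_def prod_eq_iff eq_nat_nat_iff)
  qed
  define R where "R = (\<Sum>e\<in>D. nat (snd e - fst e))"
  have R: "nat (snd e - fst e) \<le> R" if "e \<in> D" for e
    unfolding R_def using that by (rule member_le_sum) (use assms(1) in auto)
  have sub: "\<phi> ` D \<subseteq> (SIGMA r:{Suc m..R}. {..<r})"
  proof
    fix p assume "p \<in> \<phi> ` D"
    then obtain e where e: "e \<in> D" "p = \<phi> e" by auto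
    with assms(2)[OF e(1)] R[OF e(1)] show "p \<in> (SIGMA r:{Suc m..R}. {..<r})" by (auto simp: \<phi>_def)
  qed
  have "(\<Sum>e\<in>D. J (fst e - snd e)) = (\<Sum>e\<in>D. (\<lambda>(r, q). J (int r)) (\<phi> e))"
  proof (rule sum.cong[OF refl])
    fix e assume "e \<in> D"
    then show "J (fst e - snd e) = (\<lambda>(r, q). J (int r)) (\<phi> e)"
      using assms(2)[of e] J_even[of "snd e - fst e"] by (simp add: \<phi>_def)
  qed
  also have "\<dots> = (\<Sum>p\<in>\<phi> ` D. (\<lambda>(r, q). J (int r)) p)"
    by (simp add: sum.reindex[OF inj])
  also have "\<dots> \<le> (\<Sum>p\<in>(SIGMA r:{Suc m..R}. {..<r}). (\<lambda>(r, q). J (int r)) p)"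
    by (intro sum_mono2 sub) (auto simp: J_nonneg)
  also have "\<dots> = (\<Sum>r\<in>{Suc m..R}. real r * J (int r))"
    by (subst sum.Sigma[symmetric]) auto
  also have "\<dots> = (\<Sum>r\<in>{0..<R - m}. real (r + Suc m) * J (int (r + Suc m)))"
    by (rule sum.reindex_bij_witness[where i = "\<lambda>r. r + Suc m" and j = "\<lambda>r. r - Suc m"]) auto
  also have "\<dots> \<le> tail_moment m"
    unfolding tail_moment_def by (intro sum_le_suminf summable_tail_moment) (auto simp: J_nonneg)
  finally show ?thesis .
qed

section \<open>Cut points and decay of the two-point function\<close>

lemma cut_separates:
  assumes "\<omega> \<subseteq> edges V" "\<omega> \<inter> {e \<in> edges V. fst e \<le> k \<and> k < snd e} = {}" "x \<le> k" "(x, y) \<in> (adj \<omega>)\<^sup>*"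
  shows "y \<le> k"
  using assms(4)
proof induction
  case (step y z)
  then have "(y, z) \<in> \<omega> \<or> (z, y) \<in> \<omega>" by (auto simp: adj_def)
  then show ?case
  proof
    assume "(y, z) \<in> \<omega>" then show ?thesis using assms(1,2) step.IH by force
  next
    assume "(z, y) \<in> \<omega>"
    then have "z < y" using assms(1) by (auto simp: edges_def)
    then show ?thesis using step.IH by simp
  qed
qed (fact assms(3))

text \<open>Let \<open>X\<close> be the normalized number of cut points among \<open>m\<close> positions of spacing \<open>L\<close>. A connection
  across all of them forces \<open>X = 0\<close>, which is bounded by the second moment of \<open>1 - X\<close>.\<close>

lemma corr_le_second_moment:
  assumes V: "finite V" "0 \<in> V" and n: "0 < m" "0 < L" "int (m * L) \<le> n"
  shows "corr J \<beta> V 0 n \<le> exp (2 * \<beta> * tail_moment 0) / m + exp (2 * \<beta> * tail_moment L) - 1"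
proof -
  define D where "D j = {e \<in> edges V. fst e \<le> int (j * L) \<and> int (j * L) < snd e}" for j
  define s where "s A = (\<Sum>e\<in>A. 2 * Jb J \<beta> e)" for A
  let ?E = "edges V" and ?B = "bern (edges V) open_prob"
  have fD: "finite (D j)" "D j \<subseteq> ?E" for j using V by (auto simp: D_def)
  have avoid: "?B (\<lambda>\<omega>. of_bool (\<omega> \<inter> A = {})) = exp (- s A)" if "A \<subseteq> ?E" for A
  proof -
    have "?B (\<lambda>\<omega>. of_bool (\<omega> \<inter> A = {})) = (\<Prod>e\<in>A. 1 - open_prob e)" using V that by (intro bern_avoid) auto
    also have "\<dots> = exp (- s A)"
      using finite_subset[OF that] V by (simp add: open_prob_def s_def exp_sum[symmetric] sum_negf)
    finally show ?thesis .
  qed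
  \<comment> \<open>The set \<open>D j\<close> of edges across the j-th cut is avoided with
    probability \<open>exp (- s (D j))\<close>; the weight normalizes X to mean 1.\<close>
  define X where "X \<omega> = (\<Sum>j<m. exp (s (D j)) * of_bool (\<omega> \<inter> D j = {})) / m" for \<omega>
  have BX: "?B X = 1"
  proof -
    have "X = (\<lambda>\<omega>. (1 / m) * (\<Sum>j<m. exp (s (D j)) * of_bool (\<omega> \<inter> D j = {})))" by (simp add: X_def[abs_def])
    then have "?B X = (1 / m) * (\<Sum>j<m. exp (s (D j)) * ?B (\<lambda>\<omega>. of_bool (\<omega> \<inter> D j = {})))"
      by (simp only: bern_scale bern_sum)
    also have "\<dots> = 1" using n by (simp add: avoid fD exp_add[symmetric])
    finally show ?thesis .
  qed
  have BX2: "?B (\<lambda>\<omega>. X \<omega> * X \<omega>) = (1 / m^2) * (\<Sum>i<m. \<Sum>j<m. exp (s (D i \<inter> D j)))"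
  proof -
    have "X \<omega> * X \<omega> = (1 / m^2) * (\<Sum>i<m. \<Sum>j<m. exp (s (D i) + s (D j)) * of_bool (\<omega> \<inter> (D i \<union> D j) = {}))" for \<omega>
    proof -
      have "(exp (s (D i)) * of_bool (\<omega> \<inter> D i = {})) * (exp (s (D j)) * of_bool (\<omega> \<inter> D j = {})) =
        exp (s (D i) + s (D j)) * of_bool (\<omega> \<inter> (D i \<union> D j) = {})" for i j
        by (cases "\<omega> \<inter> D i = {}"; cases "\<omega> \<inter> D j = {}") (auto simp: exp_add Int_Un_distrib)
      then show ?thesis
        unfolding X_def times_divide_times_eq sum_product power2_eq_square by (simp del: of_bool_def)
    qed
    then have "?B (\<lambda>\<omega>. X \<omega> * X \<omega>) = (1 / m^2) * (\<Sum>i<m. \<Sum>j<m. exp (s (D i) + s (D j)) * ?B (\<lambda>\<omega>. of_bool (\<omega> \<inter> (D i \<union> D j) = {})))"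
      by (simp only: bern_scale bern_sum)
    also have "\<dots> = (1 / m^2) * (\<Sum>i<m. \<Sum>j<m. exp (s (D i \<inter> D j)))"
    proof -
      \<comment> \<open>Avoiding both cuts costs only the union, so two cuts are correlated
        precisely through the edges crossing both.\<close>
      have "s (D i \<union> D j) = s (D i) + s (D j) - s (D i \<inter> D j)" for i j
        unfolding s_def by (rule sum_Un) (auto simp: fD)
      then show ?thesis by (simp add: avoid fD exp_add[symmetric])
    qed
    finally show ?thesis .
  qed
  have sb: "s (D i \<inter> D j) \<le> 2 * \<beta> * tail_moment (if i = j then 0 else L)" for i j
  proof -
    have *: "s (D i \<inter> D j) \<le> 2 * \<beta> * tail_moment (if i = j then 0 else L)" if "i \<le> j" for i j
    proof -
      let ?q = "if i = j then 0 else L"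
      have "(\<Sum>e\<in>D i \<inter> D j. J (fst e - snd e)) \<le> tail_moment ?q"
      proof (rule sum_cross_le[where k = "int (i * L)"])
        fix e assume e: "e \<in> D i \<inter> D j"
        \<comment> \<open>Distinct cuts are at least L apart, so an edge crossing both is longer
          than L and falls under \<open>tail_moment L\<close>.\<close>
        have "int (i * L) + int ?q \<le> int (j * L)"
        proof (cases "i = j")
          case False
          then have "(i + 1) * L \<le> j * L" using that by (intro mult_right_mono) auto
          then have "int (i * L + L) \<le> int (j * L)" by (subst of_nat_le_iff) simp
          then show ?thesis using False by (simp only: of_nat_add if_False)
        qed simp
        then show "fst e \<le> int (i * L) \<and> int (i * L) + int ?q < snd e"
          using e by (auto simp: D_def simp del: of_nat_mult)
      qed (simp add: fD)
      then have "(2 * \<beta>) * (\<Sum>e\<in>D i \<inter> D j. J (fst e - snd e)) \<le> (2 * \<beta>) * tail_moment ?q" using beta by (intro mult_left_mono) auto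
      then show ?thesis by (simp add: s_def Jb_def sum_distrib_left mult.assoc)
    qed
    show ?thesis
    proof (cases "i \<le> j")
      case False
      then have "i \<noteq> j" "j \<le> i" by auto
      then show ?thesis using *[of j i] by (simp add: Int_commute)
    qed (rule *)
  qed
  have "corr J \<beta> V 0 n \<le> ?B (\<lambda>\<omega>. of_bool ((0, n) \<in> (adj \<omega>)\<^sup>*))"
    by (rule corr_le_bern) (use V in auto)
  \<comment> \<open>This is the square of 1 - X, expanded so that linearity of \<open>bern\<close>
    applies term by term; it equals 1 on the connection event.\<close>
  also have "\<dots> \<le> ?B (\<lambda>\<omega>. 1 + ((-2) * X \<omega> + X \<omega> * X \<omega>))"
  proof (rule bern_mono)
    fix \<omega> assume w: "\<omega> \<subseteq> ?E"
    show "of_bool ((0, n) \<in> (adj \<omega>)\<^sup>*) \<le> 1 + ((-2) * X \<omega> + X \<omega> * X \<omega>)"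
    proof (cases "(0, n) \<in> (adj \<omega>)\<^sup>*")
      case True
      have "\<omega> \<inter> D j \<noteq> {}" if "j < m" for j
      proof
        assume "\<omega> \<inter> D j = {}"
        then have "n \<le> int (j * L)" using cut_separates[OF w _ _ True, of "int (j * L)"] by (auto simp: D_def)
        moreover have "j * L < m * L" using that n by simp
        ultimately show False using n by linarith
      qed
      then have "X \<omega> = 0" by (simp add: X_def)
      then show ?thesis by simp
    next
      case False
      have "0 \<le> (1 - X \<omega>)\<^sup>2" by simp
      then show ?thesis using False by (simp add: power2_eq_square algebra_simps)
    qed
  qed (use open_prob_bounds in auto)
  also have "\<dots> = 1 + ((-2) * ?B X + ?B (\<lambda>\<omega>. X \<omega> * X \<omega>))"
    unfolding bern_add bern_scale using bern_one[of ?E open_prob] V by simp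
  also have "\<dots> = (1 / m^2) * (\<Sum>i<m. \<Sum>j<m. exp (s (D i \<inter> D j))) - 1"
    unfolding BX BX2 by simp
  also have "\<dots> \<le> (1 / m^2) * (\<Sum>i<m. \<Sum>j<m. (if i = j then exp (2 * \<beta> * tail_moment 0) else 0) + exp (2 * \<beta> * tail_moment L)) - 1"
  proof -
    have "exp (s (D i \<inter> D j)) \<le> (if i = j then exp (2 * \<beta> * tail_moment 0) else 0) + exp (2 * \<beta> * tail_moment L)" for i j
    proof -
      have "exp (s (D i \<inter> D j)) \<le> exp (2 * \<beta> * tail_moment (if i = j then 0 else L))" using sb by simp
      then show ?thesis by (cases "i = j") (auto intro: add_increasing2)
    qed
    then show ?thesis by (intro diff_right_mono mult_left_mono sum_mono) auto
  qed
  also have "\<dots> = exp (2 * \<beta> * tail_moment 0) / m + exp (2 * \<beta> * tail_moment L) - 1"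
  proof -
    let ?A = "exp (2 * \<beta> * tail_moment 0)" and ?L = "exp (2 * \<beta> * tail_moment L)"
    have "(\<Sum>i<m. \<Sum>j<m. (if i = j then ?A else 0) + ?L) = real m * ?A + real m * (real m * ?L)"
      by (simp add: sum.distrib distrib_left)
    then show ?thesis using n(1) by (simp add: power2_eq_square add_divide_distrib distrib_left)
  qed
  finally show ?thesis .
qed

text \<open>First the spacing L is chosen so that distinct cuts are almost uncorrelated, then the
  number m of cuts so that the diagonal terms are negligible; \<open>m * L\<close> does not depend
  on the volume.\<close>

lemma corr_decay:
  assumes "0 < \<epsilon>"
  shows "\<exists>n0. \<forall>V x y. finite V \<longrightarrow> x \<in> V \<longrightarrow> y \<in> V \<longrightarrow> n0 \<le> \<bar>x - y\<bar> \<longrightarrow> corr J \<beta> V x y \<le> \<epsilon>"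
proof -
  have "(\<lambda>L. exp (2 * \<beta> * tail_moment L) - 1) \<longlonglongrightarrow> exp (2 * \<beta> * 0) - 1"
    by (intro tendsto_intros tail_moment_tendsto)
  then have "eventually (\<lambda>L. exp (2 * \<beta> * tail_moment L) - 1 < \<epsilon> / 2) sequentially"
    using assms by (intro order_tendstoD) auto
  then obtain L0 where L0: "\<And>L. L0 \<le> L \<Longrightarrow> exp (2 * \<beta> * tail_moment L) - 1 < \<epsilon> / 2"
    by (auto simp: eventually_sequentially)
  define L where "L = Suc L0"
  have L: "exp (2 * \<beta> * tail_moment L) - 1 < \<epsilon> / 2" "0 < L" using L0 by (auto simp: L_def)
  obtain m :: nat where m: "2 * exp (2 * \<beta> * tail_moment 0) / \<epsilon> < m" using reals_Archimedean2 by blast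
  have "0 \<le> 2 * exp (2 * \<beta> * tail_moment 0) / \<epsilon>" using assms by simp
  then have m0: "0 < m" using m by (metis of_nat_0_less_iff order_le_less_trans)
  have m': "exp (2 * \<beta> * tail_moment 0) / m < \<epsilon> / 2" using m m0 assms by (simp add: field_simps)
  have saturation_bounds: "corr J \<beta> V x y \<le> \<epsilon>" if V: "finite V" "x \<in> V" "y \<in> V" and n: "int (m * L) \<le> y - x" for V x y
  proof -
    have "corr J \<beta> V x y = corr J \<beta> ((+) (- x) ` V) (- x + x) (- x + y)" by (rule corr_translate[symmetric])
    also have "\<dots> = corr J \<beta> ((+) (- x) ` V) 0 (y - x)" by simp
    also have "\<dots> \<le> exp (2 * \<beta> * tail_moment 0) / m + exp (2 * \<beta> * tail_moment L) - 1"
    proof (rule corr_le_second_moment)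
      show "0 \<in> (+) (- x) ` V" using V by (auto intro!: image_eqI[of _ _ x])
    qed (use V n m0 L in auto)
    also have "\<dots> \<le> \<epsilon>" using L(1) m' by linarith
    finally show ?thesis .
  qed
  show ?thesis
  proof (intro exI[of _ "int (m * L)"] allI impI)
    fix V x y assume *: "finite V" "x \<in> V" "y \<in> V" "int (m * L) \<le> \<bar>x - y\<bar>"
    show "corr J \<beta> V x y \<le> \<epsilon>"
    proof (cases "x \<le> y")
      case True then show ?thesis using * by (intro saturation_bounds) auto
    next
      case False then show ?thesis using * corr_sym[of V x y] by (auto intro!: saturation_bounds)
    qed
  qed
qed

end
end

section \<open>Infinite-volume correlations\<close>

lemma finite_int_box [simp]: "finite (int_box N)"
  by (simp add: int_box_def)

lemma int_box_mono: "N \<le> M \<Longrightarrow> int_box N \<subseteq> int_box M"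
  by (auto simp: int_box_def)

lemma mem_int_box: "x \<in> int_box N \<longleftrightarrow> \<bar>x\<bar> \<le> int N"
  by (auto simp: int_box_def)

lemma finite_subset_int_box:
  assumes "finite V" obtains N where "V \<subseteq> int_box N"
proof
  show "V \<subseteq> int_box (\<Sum>x\<in>V. nat \<bar>x\<bar>)"
  proof
    fix x assume "x \<in> V"
    then have "nat \<bar>x\<bar> \<le> (\<Sum>x\<in>V. nat \<bar>x\<bar>)" by (rule member_le_sum) (use assms in auto)
    then show "x \<in> int_box (\<Sum>x\<in>V. nat \<bar>x\<bar>)" unfolding mem_int_box by linarith
  qed
qed

lemma has_sum_finite_sum:
  fixes f :: "'a \<Rightarrow> 'b \<Rightarrow> real"
  assumes "finite U" "\<And>u. u \<in> U \<Longrightarrow> (f u has_sum s u) A"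
  shows "((\<lambda>j. \<Sum>u\<in>U. f u j) has_sum (\<Sum>u\<in>U. s u)) A"
  using assms by (induction U rule: finite_induct) (auto intro: has_sum_add)

definition corr_inf :: "(int \<Rightarrow> real) \<Rightarrow> real \<Rightarrow> int \<Rightarrow> real" where
  "corr_inf J \<beta> x = (SUP N. corr J \<beta> (int_box N) 0 x)"

definition bdry :: "(int \<Rightarrow> real) \<Rightarrow> real \<Rightarrow> nat \<Rightarrow> int \<Rightarrow> real" where
  "bdry J \<beta> N i = \<beta> * (\<Sum>\<^sub>\<infinity>j\<in>- int_box N. J (i - j))"

context ising begin

lemma J_swap: "J (x - y) = J (y - x)"
  using J_even[of "x - y"] by simp

lemma corr_box_le_corr_inf: "corr J \<beta> (int_box N) 0 x \<le> corr_inf J \<beta> x"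
proof -
  have "bdd_above (range (\<lambda>N. corr J \<beta> (int_box N) 0 x))"
    by (rule bdd_aboveI2[where M = 1]) (simp add: corr_le_1)
  then show ?thesis unfolding corr_inf_def by (rule cSUP_upper2[where x = N]) auto
qed

lemma corr_le_corr_inf:
  assumes "finite V" "x \<in> V" "y \<in> V" shows "corr J \<beta> V x y \<le> corr_inf J \<beta> (y - x)"
proof -
  obtain N where N: "(+) (- x) ` V \<subseteq> int_box N" using finite_subset_int_box[OF finite_imageI[OF assms(1)]] .
  have "corr J \<beta> V x y = corr J \<beta> ((+) (- x) ` V) (- x + x) (- x + y)" by (rule corr_translate[symmetric])
  also have "\<dots> \<le> corr J \<beta> (int_box N) (- x + x) (- x + y)"
    using N assms by (intro corr_mono_vol) auto
  also have "\<dots> \<le> corr_inf J \<beta> (- x + y)"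
    using corr_box_le_corr_inf[of N "- x + y"] by simp
  finally show ?thesis by simp
qed

lemma corr_inf_leI: "(\<And>N. corr J \<beta> (int_box N) 0 x \<le> b) \<Longrightarrow> corr_inf J \<beta> x \<le> b"
  unfolding corr_inf_def by (intro cSUP_least) auto

lemma corr_inf_le_1: "corr_inf J \<beta> x \<le> 1"
  by (intro corr_inf_leI corr_le_1) simp

lemma corr_inf_nonneg: "0 \<le> corr_inf J \<beta> x"
  using corr_nonneg[of "int_box 0" 0 x] corr_box_le_corr_inf[of 0 x] by simp

lemma corr_tendsto_corr_inf: "(\<lambda>N. corr J \<beta> (int_box N) 0 x) \<longlonglongrightarrow> corr_inf J \<beta> x"
proof (rule LIMSEQ_I)
  fix r :: real assume "0 < r"
  then have "\<not> (\<forall>N. corr J \<beta> (int_box N) 0 x \<le> corr_inf J \<beta> x - r)"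
    using corr_inf_leI[of x "corr_inf J \<beta> x - r"] by auto
  then obtain N where N: "corr_inf J \<beta> x - r < corr J \<beta> (int_box N) 0 x" by (auto simp: not_le)
  show "\<exists>no. \<forall>n\<ge>no. norm (corr J \<beta> (int_box n) 0 x - corr_inf J \<beta> x) < r"
  proof (intro exI allI impI)
    fix n assume n: "max N (nat \<bar>x\<bar>) \<le> n"
    have "corr_inf J \<beta> x - r < corr J \<beta> (int_box n) 0 x"
    proof (cases "x \<in> int_box N")
      case True
      then have "corr J \<beta> (int_box N) 0 x \<le> corr J \<beta> (int_box n) 0 x"
        using n by (intro corr_mono_vol int_box_mono) (auto simp: mem_int_box)
      then show ?thesis using N by simp
    next
      case False
      \<comment> \<open>For x outside the box its spin is frozen at 1, so the global flip reverses
        only the spin at 0 and the correlation is 0. Small boxes therefore do not disturb the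
        supremum.\<close>
      then have x0: "\<And>\<sigma>. \<sigma> \<in> spins (int_box N) \<Longrightarrow> \<sigma> x = 1" by (auto simp: spins_def)
      have f: "flip (int_box N) \<in> spins (int_box N)" by (intro flip_in_spins) simp
      have fl: "free_w J \<beta> (int_box N) (smul \<sigma> (flip (int_box N))) = free_w J \<beta> (int_box N) \<sigma>" for \<sigma>
        unfolding free_w_def pair_w_def by (intro prod.cong refl) (auto simp: edges_def smul_def flip_def)
      have "(\<Sum>\<sigma>\<in>spins (int_box N). \<sigma> 0 * \<sigma> x * free_w J \<beta> (int_box N) \<sigma>) = 0"
      proof (rule sum_spins_flip[OF f])
        fix \<sigma> assume s: "\<sigma> \<in> spins (int_box N)"
        have "smul \<sigma> (flip (int_box N)) 0 = - \<sigma> 0" by (simp add: smul_def flip_def mem_int_box)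
        then show "smul \<sigma> (flip (int_box N)) 0 * smul \<sigma> (flip (int_box N)) x * free_w J \<beta> (int_box N) (smul \<sigma> (flip (int_box N))) =
          - (\<sigma> 0 * \<sigma> x * free_w J \<beta> (int_box N) \<sigma>)"
          using x0[OF s] x0[OF smul_in_spins[OF s f]] fl by simp
      qed
      then have "corr J \<beta> (int_box N) 0 x = 0" by (simp add: corr_def gibbs_def)
      then show ?thesis using N corr_nonneg[of "int_box n" 0 x] by simp
    qed
    then show "norm (corr J \<beta> (int_box n) 0 x - corr_inf J \<beta> x) < r"
      using corr_box_le_corr_inf[of n x] by simp
  qed
qed

lemma corr_inf_even: "corr_inf J \<beta> (- x) = corr_inf J \<beta> x"
proof -
  have "corr_inf J \<beta> (- x) \<le> corr_inf J \<beta> x" for x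
  proof (rule LIMSEQ_le_const2[OF corr_tendsto_corr_inf])
    show "\<exists>N. \<forall>n\<ge>N. corr J \<beta> (int_box n) 0 (- x) \<le> corr_inf J \<beta> x"
    proof (intro exI allI impI)
      fix n assume "nat \<bar>x\<bar> \<le> n"
      then have "corr J \<beta> (int_box n) (- x) 0 \<le> corr_inf J \<beta> (0 - (- x))"
        by (intro corr_le_corr_inf) (auto simp: mem_int_box)
      then show "corr J \<beta> (int_box n) 0 (- x) \<le> corr_inf J \<beta> x" by (simp add: corr_sym)
    qed
  qed
  from this[of x] this[of "- x"] show ?thesis by simp
qed

lemma corr_inf_super: "corr_inf J \<beta> x * corr_inf J \<beta> y \<le> corr_inf J \<beta> (x + y)"
proof (rule LIMSEQ_le_const2[OF tendsto_mult[OF corr_tendsto_corr_inf corr_tendsto_corr_inf]])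
  show "\<exists>N. \<forall>n\<ge>N. corr J \<beta> (int_box n) 0 x * corr J \<beta> (int_box n) 0 y \<le> corr_inf J \<beta> (x + y)"
  proof (intro exI allI impI)
    fix n assume n: "max (nat \<bar>x\<bar>) (nat \<bar>y\<bar>) \<le> n"
    \<comment> \<open>The second factor is moved so that it starts at x; the union of the box and
      its translate contains both copies.\<close>
    let ?B = "int_box n" and ?V = "int_box n \<union> (+) x ` int_box n"
    have mem: "0 \<in> ?B" "x \<in> ?B" "y \<in> ?B" "x \<in> (+) x ` ?B" "x + y \<in> (+) x ` ?B"
      using n by (auto simp: mem_int_box image_iff)
    have "corr J \<beta> ?B 0 y = corr J \<beta> ((+) x ` ?B) x (x + y)" using corr_translate[of x ?B 0 y] by simp
    also have "\<dots> \<le> corr J \<beta> ?V x (x + y)" using mem by (intro corr_mono_vol) auto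
    finally have 1: "corr J \<beta> ?B 0 y \<le> corr J \<beta> ?V x (x + y)" .
    have 2: "corr J \<beta> ?B 0 x \<le> corr J \<beta> ?V 0 x" using mem by (intro corr_mono_vol) auto
    have "corr J \<beta> ?B 0 x * corr J \<beta> ?B 0 y \<le> corr J \<beta> ?V 0 x * corr J \<beta> ?V x (x + y)"
      by (intro mult_mono 1 2 corr_nonneg) auto
    also have "\<dots> \<le> corr J \<beta> ?V 0 (x + y)" by (intro corr_triangle) auto
    also have "\<dots> \<le> corr_inf J \<beta> (x + y - 0)" using mem by (intro corr_le_corr_inf) auto
    finally show "corr J \<beta> ?B 0 x * corr J \<beta> ?B 0 y \<le> corr_inf J \<beta> (x + y)" by simp
  qed
qed

lemma corr_inf_tanh: "x \<noteq> 0 \<Longrightarrow> tanh (\<beta> * J x) \<le> corr_inf J \<beta> x"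
  using corr_tanh[of "{0, x}" 0 x] corr_le_corr_inf[of "{0, x}" 0 x] J_even[of x] by auto

lemma corr_inf_0: "corr_inf J \<beta> 0 = 1"
  using corr_le_corr_inf[of "{0}" 0 0] corr_diag[of "{0}" 0] corr_inf_le_1[of 0] by auto

lemma bdry_nonneg: "0 \<le> bdry J \<beta> N i"
  unfolding bdry_def using beta J_nonneg by (intro mult_nonneg_nonneg infsum_nonneg) auto

definition plus :: "nat \<Rightarrow> ((int \<Rightarrow> real) \<Rightarrow> real) \<Rightarrow> real" where
  "plus N f = gibbs (int_box N) (plus_w (bdry J \<beta> N) (int_box N)) f"

section \<open>Boundary fields and the infinite-volume limit of the plus state\<close>

context
  assumes sumJ: "summable (\<lambda>r. real r * J (int r))"
begin

lemma finite_tail_le: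
  assumes "u \<in> int_box N" "finite F" "F \<subseteq> - int_box N"
  shows "(\<Sum>j\<in>F. J (u - j)) \<le> tail_moment (nat (int N - u)) + tail_moment (nat (int N + u))"
proof -
  have F: "F = {j\<in>F. j > int N} \<union> {j\<in>F. j < - int N}" using assms by (auto simp: mem_int_box)
  have u: "- int N \<le> u" "u \<le> int N" using assms(1) by (auto simp: mem_int_box)
  have "(\<Sum>j\<in>F. J (u - j)) = (\<Sum>j\<in>{j\<in>F. j > int N}. J (u - j)) + (\<Sum>j\<in>{j\<in>F. j < - int N}. J (u - j))"
    using assms(2) by (subst F, subst sum.union_disjoint) auto
  also have "(\<Sum>j\<in>{j\<in>F. j > int N}. J (u - j)) = (\<Sum>e\<in>Pair u ` {j\<in>F. j > int N}. J (fst e - snd e))"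
    by (subst sum.reindex) (auto simp: inj_on_def)
  also have "\<dots> \<le> tail_moment (nat (int N - u))"
    by (rule sum_cross_le[OF sumJ, where k = u]) (use assms(2) u in auto)
  also have "(\<Sum>j\<in>{j\<in>F. j < - int N}. J (u - j)) = (\<Sum>e\<in>(\<lambda>j. (j, u)) ` {j\<in>F. j < - int N}. J (fst e - snd e))"
    by (subst sum.reindex) (auto simp: inj_on_def J_swap[of u _])
  also have "\<dots> \<le> tail_moment (nat (int N + u))"
    \<comment> \<open>Edges to the left start strictly below -N. The cut therefore sits at -N - 1,
      and the condition on the right end becomes u - 1 < u.\<close>
    by (rule sum_cross_le[OF sumJ, where k = "- int N - 1"]) (use assms(2) u in auto)
  finally show ?thesis by simp
qed

lemma summable_tail:
  assumes "u \<in> int_box N" shows "(\<lambda>j. J (u - j)) summable_on (- int_box N)"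
  by (rule nonneg_bdd_above_summable_on)
     (auto intro!: bdd_aboveI2[where M = "tail_moment (nat (int N - u)) + tail_moment (nat (int N + u))"] finite_tail_le assms J_nonneg)

lemma bdry_le:
  assumes "u \<in> int_box N" shows "bdry J \<beta> N u \<le> \<beta> * (tail_moment (nat (int N - u)) + tail_moment (nat (int N + u)))"
  unfolding bdry_def using beta assms
  by (intro mult_left_mono infsum_le_finite_sums summable_tail finite_tail_le) auto

text \<open>Every edge from the box to its complement crosses one of the two cuts at its ends, so
  the total field stays bounded although the box grows.\<close>

lemma sum_bdry_le: "(\<Sum>u\<in>int_box N. bdry J \<beta> N u) \<le> 2 * \<beta> * tail_moment 0"
proof -
  have "((\<lambda>j. \<Sum>u\<in>int_box N. J (u - j)) has_sum (\<Sum>u\<in>int_box N. \<Sum>\<^sub>\<infinity>j\<in>- int_box N. J (u - j))) (- int_box N)"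
    by (intro has_sum_finite_sum has_sum_infsum summable_tail) auto
  then have "(\<Sum>u\<in>int_box N. \<Sum>\<^sub>\<infinity>j\<in>- int_box N. J (u - j)) \<le> 2 * tail_moment 0"
  proof (rule has_sum_le_finite_sums)
    fix F assume F: "finite F" "F \<subseteq> - int_box N"
    have e: "F = {j\<in>F. j > int N} \<union> {j\<in>F. j < - int N}" using F by (auto simp: mem_int_box)
    have "(\<Sum>j\<in>F. \<Sum>u\<in>int_box N. J (u - j)) = (\<Sum>j\<in>{j\<in>F. j > int N}. \<Sum>u\<in>int_box N. J (u - j)) + (\<Sum>j\<in>{j\<in>F. j < - int N}. \<Sum>u\<in>int_box N. J (u - j))"
      using F(1) by (subst e, subst sum.union_disjoint) auto
    also have "(\<Sum>j\<in>{j\<in>F. j > int N}. \<Sum>u\<in>int_box N. J (u - j)) = (\<Sum>e\<in>int_box N \<times> {j\<in>F. j > int N}. J (fst e - snd e))"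
      by (subst sum.swap) (simp add: sum.cartesian_product split_def)
    also have "\<dots> \<le> tail_moment 0"
      by (rule sum_cross_le[OF sumJ, where k = "int N"]) (use F in \<open>auto simp: mem_int_box\<close>)
    also have "(\<Sum>j\<in>{j\<in>F. j < - int N}. \<Sum>u\<in>int_box N. J (u - j)) = (\<Sum>e\<in>{j\<in>F. j < - int N} \<times> int_box N. J (fst e - snd e))"
      by (simp add: sum.cartesian_product split_def J_swap)
    also have "\<dots> \<le> tail_moment 0"
      by (rule sum_cross_le[OF sumJ, where k = "- int N - 1"]) (use F in \<open>auto simp: mem_int_box\<close>)
    finally show "(\<Sum>j\<in>F. \<Sum>u\<in>int_box N. J (u - j)) \<le> 2 * tail_moment 0" by simp
  qed
  then have "\<beta> * (\<Sum>u\<in>int_box N. \<Sum>\<^sub>\<infinity>j\<in>- int_box N. J (u - j)) \<le> \<beta> * (2 * tail_moment 0)"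
    using beta by (rule mult_left_mono)
  then show ?thesis by (simp add: bdry_def sum_distrib_left mult_ac)
qed

lemma bdry_tendsto: "(\<lambda>N. bdry J \<beta> N u) \<longlonglongrightarrow> 0"
proof (rule tendsto_sandwich[of "\<lambda>_. 0" _ _ "\<lambda>N. \<beta> * (tail_moment (N - nat \<bar>u\<bar>) + tail_moment (N - nat \<bar>u\<bar>))"])
  have "filterlim (\<lambda>N. N - nat \<bar>u\<bar>) at_top sequentially" by (rule filterlim_minus_const_nat_at_top)
  from filterlim_compose[OF tail_moment_tendsto[OF sumJ] this]
  show "(\<lambda>N. \<beta> * (tail_moment (N - nat \<bar>u\<bar>) + tail_moment (N - nat \<bar>u\<bar>))) \<longlonglongrightarrow> 0"
    by (auto intro!: tendsto_eq_intros)
  show "eventually (\<lambda>N. bdry J \<beta> N u \<le> \<beta> * (tail_moment (N - nat \<bar>u\<bar>) + tail_moment (N - nat \<bar>u\<bar>))) sequentially"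
    using eventually_ge_at_top[of "nat \<bar>u\<bar>"]
  proof eventually_elim
    case (elim N)
    have "bdry J \<beta> N u \<le> \<beta> * (tail_moment (nat (int N - u)) + tail_moment (nat (int N + u)))"
      using elim by (intro bdry_le) (auto simp: mem_int_box)
    also have "\<dots> \<le> \<beta> * (tail_moment (N - nat \<bar>u\<bar>) + tail_moment (N - nat \<bar>u\<bar>))"
      using beta by (intro mult_left_mono add_mono tail_moment_antimono sumJ) auto
    finally show ?case .
  qed
qed (use bdry_nonneg in auto)

lemma plus_spin_tendsto: "(\<lambda>N. plus N (\<lambda>\<sigma>. \<sigma> a)) \<longlonglongrightarrow> 0"
proof (rule tendsto_0_le[where K = 1 and f = "\<lambda>N. plus N (\<lambda>\<sigma>. \<sigma> a)"], rule LIMSEQ_I)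
  fix r :: real assume r: "0 < r"
  \<comment> \<open>A bound on the total boundary field; adding 1 keeps it positive even for \<beta>
    = 0.\<close>
  define K where "K = 2 * \<beta> * tail_moment 0 + 1"
  have K: "0 < K" using tail_moment_nonneg[OF sumJ, of 0] beta by (simp add: K_def add_nonneg_pos)
  obtain n0 where n0: "\<And>V x y. finite V \<Longrightarrow> x \<in> V \<Longrightarrow> y \<in> V \<Longrightarrow> n0 \<le> \<bar>x - y\<bar> \<Longrightarrow> corr J \<beta> V x y \<le> r / (2 * K)"
    using corr_decay[OF sumJ, of "r / (2 * K)"] r K by auto
  \<comment> \<open>Near a the finitely many fields vanish in the limit; away from a the free
    correlation is small and the total field is bounded by K.\<close>
  let ?I = "{a - n0..a + n0}"
  have "(\<lambda>N. \<Sum>u\<in>?I. bdry J \<beta> N u) \<longlonglongrightarrow> (\<Sum>u\<in>?I. 0)" by (intro tendsto_sum bdry_tendsto)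
  then have "eventually (\<lambda>N. (\<Sum>u\<in>?I. bdry J \<beta> N u) < r / 2) sequentially" using r by (intro order_tendstoD) auto
  then obtain N0 where N0: "\<And>N. N0 \<le> N \<Longrightarrow> (\<Sum>u\<in>?I. bdry J \<beta> N u) < r / 2" by (auto simp: eventually_sequentially)
  show "\<exists>no. \<forall>n\<ge>no. norm (plus n (\<lambda>\<sigma>. \<sigma> a) - 0) < r"
  proof (intro exI allI impI)
    fix N assume N: "max N0 (nat \<bar>a\<bar>) \<le> N"
    let ?B = "int_box N"
    have a: "a \<in> ?B" using N by (auto simp: mem_int_box)
    have "plus N (\<lambda>\<sigma>. \<sigma> a) \<le> (\<Sum>u\<in>?B. bdry J \<beta> N u * corr J \<beta> ?B a u)"
      unfolding plus_def by (rule plus_w_lieb(1)[where x = a]) (auto simp: bdry_nonneg a)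
    also have "\<dots> \<le> (\<Sum>u\<in>?B. (if u \<in> ?I then bdry J \<beta> N u else 0) + bdry J \<beta> N u * (r / (2 * K)))"
    proof (rule sum_mono)
      fix u assume u: "u \<in> ?B"
      show "bdry J \<beta> N u * corr J \<beta> ?B a u \<le> (if u \<in> ?I then bdry J \<beta> N u else 0) + bdry J \<beta> N u * (r / (2 * K))"
      proof (cases "u \<in> ?I")
        case True
        have "bdry J \<beta> N u * corr J \<beta> ?B a u \<le> bdry J \<beta> N u * 1" by (intro mult_left_mono corr_le_1 bdry_nonneg) auto
        moreover have "0 \<le> bdry J \<beta> N u * (r / (2 * K))" using r K bdry_nonneg by auto
        ultimately show ?thesis using True by simp
      next
        case False
        then have "corr J \<beta> ?B a u \<le> r / (2 * K)" using a u by (intro n0) auto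
        then have "bdry J \<beta> N u * corr J \<beta> ?B a u \<le> bdry J \<beta> N u * (r / (2 * K))"
          by (intro mult_left_mono bdry_nonneg)
        then show ?thesis using False by (simp only: if_False add_0)
      qed
    qed
    also have "\<dots> = (\<Sum>u\<in>?B \<inter> ?I. bdry J \<beta> N u) + (\<Sum>u\<in>?B. bdry J \<beta> N u) * (r / (2 * K))"
      by (simp add: sum.distrib sum.inter_restrict sum_distrib_right sum_divide_distrib)
    also have "(\<Sum>u\<in>?B \<inter> ?I. bdry J \<beta> N u) \<le> (\<Sum>u\<in>?I. bdry J \<beta> N u)"
      by (intro sum_mono2) (auto simp: bdry_nonneg)
    also have "\<dots> < r / 2" using N by (intro N0) auto
    also have "(\<Sum>u\<in>?B. bdry J \<beta> N u) * (r / (2 * K)) \<le> K * (r / (2 * K))"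
      using sum_bdry_le[of N] r K by (intro mult_right_mono) (auto simp: K_def)
    also have "K * (r / (2 * K)) = r / 2" using K by simp
    finally have "plus N (\<lambda>\<sigma>. \<sigma> a) < r" by simp
    moreover have "0 \<le> plus N (\<lambda>\<sigma>. \<sigma> a)"
      unfolding plus_def by (intro gks1 ferro_plus_w bdry_nonneg gcone_spin) auto
    ultimately show "norm (plus N (\<lambda>\<sigma>. \<sigma> a) - 0) < r" by simp
  qed
qed auto

text \<open>A squeeze: above the free correlation there is only the bounded total field times the
  magnetization at x, which vanishes.\<close>

lemma plus_pair_tendsto: "(\<lambda>N. plus N (\<lambda>\<sigma>. \<sigma> 0 * \<sigma> x)) \<longlonglongrightarrow> corr_inf J \<beta> x"
proof (rule tendsto_sandwich[OF _ _ corr_tendsto_corr_inf])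
  show "eventually (\<lambda>N. corr J \<beta> (int_box N) 0 x \<le> plus N (\<lambda>\<sigma>. \<sigma> 0 * \<sigma> x)) sequentially"
    unfolding plus_def by (intro always_eventually allI plus_w_ge_corr bdry_nonneg) auto
  show "(\<lambda>N. corr J \<beta> (int_box N) 0 x + (2 * \<beta> * tail_moment 0) * plus N (\<lambda>\<sigma>. \<sigma> x)) \<longlonglongrightarrow> corr_inf J \<beta> x"
    by (rule tendsto_eq_intros corr_tendsto_corr_inf plus_spin_tendsto refl)+ simp
  show "eventually (\<lambda>N. plus N (\<lambda>\<sigma>. \<sigma> 0 * \<sigma> x) \<le> corr J \<beta> (int_box N) 0 x + (2 * \<beta> * tail_moment 0) * plus N (\<lambda>\<sigma>. \<sigma> x)) sequentially"
    using eventually_ge_at_top[of "nat \<bar>x\<bar>"]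
  proof eventually_elim
    case (elim N)
    let ?B = "int_box N"
    have "(\<Sum>u\<in>?B. bdry J \<beta> N u * corr J \<beta> ?B 0 u) \<le> (\<Sum>u\<in>?B. bdry J \<beta> N u * 1)"
      by (intro sum_mono mult_left_mono corr_le_1 bdry_nonneg) auto
    also have "\<dots> \<le> 2 * \<beta> * tail_moment 0" using sum_bdry_le[of N] by simp
    finally have 1: "(\<Sum>u\<in>?B. bdry J \<beta> N u * corr J \<beta> ?B 0 u) \<le> 2 * \<beta> * tail_moment 0" .
    have p: "0 \<le> plus N (\<lambda>\<sigma>. \<sigma> x)"
      unfolding plus_def by (intro gks1 ferro_plus_w bdry_nonneg gcone_spin) auto
    have "plus N (\<lambda>\<sigma>. \<sigma> 0 * \<sigma> x) \<le> corr J \<beta> ?B 0 x + (\<Sum>u\<in>?B. bdry J \<beta> N u * corr J \<beta> ?B 0 u) * plus N (\<lambda>\<sigma>. \<sigma> x)"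
      unfolding plus_def using elim by (intro plus_w_lieb) (auto simp: bdry_nonneg mem_int_box)
    then show ?case using mult_right_mono[OF 1 p] by simp
  qed
qed

text \<open>For spins frozen at 1 between the boxes, the crossing edges act as a field on the small
  box. Together with the field from outside the large box it is exactly the field of the small box;
  all other factors are constant.\<close>

lemma plus_w_restrict:
  assumes "N \<le> M"
  shows "\<exists>c>0. \<forall>\<sigma>\<in>spins (int_box N). plus_w (bdry J \<beta> M) (int_box M) \<sigma> = c * plus_w (bdry J \<beta> N) (int_box N) \<sigma>"
proof -
  let ?S = "int_box N" and ?V = "int_box M"
  have SV: "?S \<subseteq> ?V" using assms by (rule int_box_mono)
  let ?K = "edges ?V - edges ?S - edges (?V - ?S)"
  define c where "c = (\<Prod>e\<in>edges (?V - ?S). exp (Jb J \<beta> e)) * (\<Prod>i\<in>?V - ?S. exp (bdry J \<beta> M i))"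
  have c: "c > 0" unfolding c_def by (intro mult_pos_pos prod_pos) auto
  have h: "(\<Sum>v\<in>?V - ?S. \<beta> * J (u - v)) + bdry J \<beta> M u = bdry J \<beta> N u" if u: "u \<in> ?S" for u
  proof -
    have "- ?S = (?V - ?S) \<union> - ?V" using SV by auto
    then have "(\<Sum>\<^sub>\<infinity>j\<in>- ?S. J (u - j)) = (\<Sum>\<^sub>\<infinity>j\<in>?V - ?S. J (u - j)) + (\<Sum>\<^sub>\<infinity>j\<in>- ?V. J (u - j))"
      using u SV by (simp only:) (rule infsum_Un_disjoint, auto intro: summable_tail)
    then show ?thesis unfolding bdry_def by (simp add: distrib_left sum_distrib_left)
  qed
  have "plus_w (bdry J \<beta> M) ?V \<sigma> = c * plus_w (bdry J \<beta> N) ?S \<sigma>" if s: "\<sigma> \<in> spins ?S" for \<sigma>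
  proof -
    let ?f = "\<lambda>e. exp (Jb J \<beta> e * (\<sigma> (fst e) * \<sigma> (snd e)))"
    have out: "\<sigma> i = 1" if "i \<notin> ?S" for i using s that by (auto simp: spins_def)
    have "edges ?V = edges ?S \<union> (edges (?V - ?S) \<union> ?K)" using SV by (auto simp: edges_def)
    moreover have "edges ?S \<inter> (edges (?V - ?S) \<union> ?K) = {}" "edges (?V - ?S) \<inter> ?K = {}" by (auto simp: edges_def)
    ultimately have "free_w J \<beta> ?V \<sigma> = free_w J \<beta> ?S \<sigma> * ((\<Prod>e\<in>edges (?V - ?S). ?f e) * (\<Prod>e\<in>?K. ?f e))"
      unfolding free_w_def pair_w_def by (metis (no_types, lifting) finite_Diff finite_Un finite_edges finite_int_box prod.union_disjoint)
    also have "(\<Prod>e\<in>edges (?V - ?S). ?f e) = (\<Prod>e\<in>edges (?V - ?S). exp (Jb J \<beta> e))"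
      by (intro prod.cong refl) (auto simp: edges_def out)
    also have "(\<Prod>e\<in>?K. ?f e) = (\<Prod>p\<in>?S \<times> (?V - ?S). ?f (case p of (u, v) \<Rightarrow> (min u v, max u v)))"
      by (rule prod.reindex_bij_betw[OF bij_betw_cross_edges[OF SV], symmetric])
    also have "\<dots> = (\<Prod>(u, v)\<in>?S \<times> (?V - ?S). exp (\<beta> * J (u - v) * \<sigma> u))"
      by (intro prod.cong refl) (auto simp: Jb_def out min_def max_def J_swap)
    also have "\<dots> = (\<Prod>u\<in>?S. exp ((\<Sum>v\<in>?V - ?S. \<beta> * J (u - v)) * \<sigma> u))"
      by (simp add: prod.cartesian_product[symmetric] sum_distrib_right exp_sum)
    finally have 1: "free_w J \<beta> ?V \<sigma> = free_w J \<beta> ?S \<sigma> * ((\<Prod>e\<in>edges (?V - ?S). exp (Jb J \<beta> e)) * (\<Prod>u\<in>?S. exp ((\<Sum>v\<in>?V - ?S. \<beta> * J (u - v)) * \<sigma> u)))" .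
    have 2: "(\<Prod>i\<in>?V. exp (bdry J \<beta> M i * \<sigma> i)) = (\<Prod>i\<in>?V - ?S. exp (bdry J \<beta> M i)) * (\<Prod>i\<in>?S. exp (bdry J \<beta> M i * \<sigma> i))"
      using prod.subset_diff[OF SV, of "\<lambda>i. exp (bdry J \<beta> M i * \<sigma> i)"] out by simp
    have 3: "(\<Prod>u\<in>?S. exp ((\<Sum>v\<in>?V - ?S. \<beta> * J (u - v)) * \<sigma> u)) * (\<Prod>i\<in>?S. exp (bdry J \<beta> M i * \<sigma> i)) = (\<Prod>i\<in>?S. exp (bdry J \<beta> N i * \<sigma> i))"
      unfolding prod.distrib[symmetric] by (intro prod.cong refl) (simp add: h[symmetric] distrib_right exp_add)
    show ?thesis unfolding plus_w_def mon_simps mult_1_right 1 2 3[symmetric] c_def by (simp only: mult_ac)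
  qed
  then show ?thesis using c by auto
qed

text \<open>The plus state in the smaller box is the plus state in the larger one, conditioned on the spins
  in between being \<open>1\<close>.\<close>

lemma plus_antimono:
  assumes "N \<le> M" "\<And>V. gcone V f" shows "plus M f \<le> plus N f"
proof -
  let ?S = "int_box N" and ?V = "int_box M"
  let ?w = "plus_w (bdry J \<beta> M) ?V"
  have SV: "?S \<subseteq> ?V" using assms(1) by (rule int_box_mono)
  \<comment> \<open>On \<open>spins ?V\<close> this is the indicator that all spins between the
    boxes are 1, written so that it lies in the cone.\<close>
  define g where "g \<sigma> = (\<Prod>i\<in>?V - ?S. (1/2) * (1 + mon [i] \<sigma>))" for \<sigma> :: "int \<Rightarrow> real"
  have g: "gcone ?V g" unfolding g_def[abs_def]
    by (intro gcone_prod gcone.scale gcone.add gcone_const gcone.mon) auto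
  have fer: "ferro ?V ?w" by (intro ferro_plus_w bdry_nonneg)
  have gv: "g \<sigma> = of_bool (\<sigma> \<in> spins ?S)" if "\<sigma> \<in> spins ?V" for \<sigma>
  proof -
    have "(1/2) * (1 + mon [i] \<sigma>) = of_bool (\<sigma> i = 1)" for i using spins_cases[OF that, of i] by auto
    then have "g \<sigma> = (\<Prod>i\<in>?V - ?S. of_bool (\<sigma> i = 1))" by (simp add: g_def)
    also have "\<dots> = of_bool (\<forall>i\<in>?V - ?S. \<sigma> i = 1)"
      by (induction "?V - ?S" rule: infinite_finite_induct) auto
    also have "(\<forall>i\<in>?V - ?S. \<sigma> i = 1) \<longleftrightarrow> \<sigma> \<in> spins ?S" using that SV by (auto simp: spins_def)
    finally show ?thesis .
  qed
  obtain c where c: "c > 0" "\<And>\<sigma>. \<sigma> \<in> spins ?S \<Longrightarrow> ?w \<sigma> = c * plus_w (bdry J \<beta> N) ?S \<sigma>"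
    using plus_w_restrict[OF assms(1)] by auto
  have sum: "(\<Sum>\<sigma>\<in>spins ?V. F \<sigma> * g \<sigma> * ?w \<sigma>) = c * (\<Sum>\<sigma>\<in>spins ?S. F \<sigma> * plus_w (bdry J \<beta> N) ?S \<sigma>)" for F
  proof -
    have "(\<Sum>\<sigma>\<in>spins ?V. F \<sigma> * g \<sigma> * ?w \<sigma>) = (\<Sum>\<sigma>\<in>spins ?V. if \<sigma> \<in> spins ?S then F \<sigma> * ?w \<sigma> else 0)"
      by (intro sum.cong refl) (simp add: gv)
    also have "\<dots> = (\<Sum>\<sigma>\<in>spins ?S. F \<sigma> * ?w \<sigma>)"
      using spins_mono[OF SV] by (simp add: sum.inter_restrict[symmetric] Int_absorb1)
    also have "\<dots> = c * (\<Sum>\<sigma>\<in>spins ?S. F \<sigma> * plus_w (bdry J \<beta> N) ?S \<sigma>)"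
      by (simp add: c sum_distrib_left mult_ac)
    finally show ?thesis .
  qed
  let ?Zs = "\<Sum>\<sigma>\<in>spins ?S. plus_w (bdry J \<beta> N) ?S \<sigma>" and ?Zv = "\<Sum>\<sigma>\<in>spins ?V. ?w \<sigma>"
  have Z: "?Zs > 0" "?Zv > 0" by (auto intro!: ferro_Z_pos ferro_plus_w bdry_nonneg)
  \<comment> \<open>Dividing by the expectation of g conditions on this event, which by
    \<open>gks2\<close> can only raise the expectation of f.\<close>
  have "plus M f * gibbs ?V ?w g \<le> gibbs ?V ?w (\<lambda>\<sigma>. f \<sigma> * g \<sigma>)"
    unfolding plus_def by (intro gks2 fer assms g) auto
  also have "\<dots> = c * (\<Sum>\<sigma>\<in>spins ?S. f \<sigma> * plus_w (bdry J \<beta> N) ?S \<sigma>) / ?Zv"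
    by (simp add: gibbs_def sum)
  also have "gibbs ?V ?w g = c * ?Zs / ?Zv"
    using sum[of "\<lambda>_. 1"] by (simp add: gibbs_def)
  finally show ?thesis using Z c(1) by (simp add: plus_def gibbs_def field_simps)
qed

lemma plus_mon_convergent: "convergent (\<lambda>N. plus N (mon xs))"
proof (rule Bseq_monoseq_convergent)
  have "\<bar>plus N (mon xs)\<bar> \<le> 1" for N
    unfolding plus_def by (intro gibbs_abs_le ferro_plus_w bdry_nonneg) (auto simp: abs_mon)
  then show "Bseq (\<lambda>N. plus N (mon xs))" by (intro BseqI'[of _ 1]) auto
  show "monoseq (\<lambda>N. plus N (mon xs))"
    unfolding monoseq_def by (intro disjI2 allI impI plus_antimono gcone.mon)
qed

end
end

lemma corr_inf_mono_beta:
  assumes "ising J \<beta>" "\<beta> \<le> \<beta>'" shows "corr_inf J \<beta> x \<le> corr_inf J \<beta>' x"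
proof -
  interpret A: ising J \<beta> by fact
  interpret B: ising J \<beta>' using assms A.beta by (auto simp: ising_def)
  show ?thesis
    by (rule A.corr_inf_leI) (rule order_trans[OF corr_mono_beta[OF assms] B.corr_box_le_corr_inf], simp)
qed

text \<open>The limit in \<beta> is taken in each box, where the correlation is continuous, and only
  then the supremum over boxes.\<close>

lemma corr_inf_left_limit:
  assumes "\<And>\<beta>'. 0 \<le> \<beta>' \<Longrightarrow> \<beta>' < \<beta> \<Longrightarrow> corr_inf J \<beta>' x \<le> b" "0 < \<beta>" "ising J \<beta>"
  shows "corr_inf J \<beta> x \<le> b"
proof (rule ising.corr_inf_leI[OF assms(3)])
  fix N
  have "((\<lambda>\<beta>. corr J \<beta> (int_box N) 0 x) \<longlongrightarrow> corr J \<beta> (int_box N) 0 x) (at_left \<beta>)"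
    using continuous_corr[of "int_box N" J 0 x] by (auto simp: continuous_on intro: tendsto_within_subset)
  moreover have "eventually (\<lambda>\<beta>'. corr J \<beta>' (int_box N) 0 x \<le> b) (at_left \<beta>)"
    using eventually_at_left_real[OF assms(2)]
  proof eventually_elim
    case (elim \<beta>')
    then interpret ising J \<beta>' using assms(3) by (auto simp: ising_def)
    show ?case using corr_box_le_corr_inf[of N x] assms(1)[of \<beta>'] elim by auto
  qed
  ultimately show "corr J \<beta> (int_box N) 0 x \<le> b" by (rule tendsto_upperbound) simp
qed

section \<open>Weak limits of two-valued random fields\<close>

lemma integral_weighted_measure:
  fixes f :: "'a::topological_space \<Rightarrow> real"
  assumes "finite S" "\<And>s. s \<in> S \<Longrightarrow> 0 \<le> w s" "f \<in> borel_measurable borel"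
  shows "(\<integral>s. f s \<partial>weighted_measure S w) = (\<Sum>s\<in>S. w s / (\<Sum>t\<in>S. w t) * f s)"
proof -
  have "(\<integral>s. f s \<partial>weighted_measure S w) = (\<integral>s. f s \<partial>point_measure S (\<lambda>s. ennreal (w s / (\<Sum>t\<in>S. w t))))"
    unfolding weighted_measure_def by (rule integral_distr) (auto simp: measurable_point_measure_eq1 assms)
  also have "\<dots> = (\<Sum>s\<in>S. w s / (\<Sum>t\<in>S. w t) * f s)"
    using assms by (subst lebesgue_integral_point_measure_finite) (auto intro!: divide_nonneg_nonneg sum_nonneg)
  finally show ?thesis .
qed

text \<open>The indicator of a proper open set is the limit of truncated multiples of the distance
  to its complement, and open sets form a generator stable under intersection.\<close>

lemma measure_eqI_continuous:
  fixes \<mu> \<nu> :: "'a::metric_space measure"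
  assumes "prob_space \<mu>" "prob_space \<nu>" "sets \<mu> = sets borel" "sets \<nu> = sets borel"
    and eq: "\<And>f :: 'a \<Rightarrow> real. continuous_on UNIV f \<Longrightarrow> bounded (range f) \<Longrightarrow> (\<integral>x. f x \<partial>\<mu>) = (\<integral>x. f x \<partial>\<nu>)"
  shows "\<mu> = \<nu>"
proof (rule measure_eqI_generator_eq[where E = "{S. open S}" and \<Omega> = UNIV and A = "\<lambda>_. UNIV"])
  interpret \<mu>: prob_space \<mu> by fact
  interpret \<nu>: prob_space \<nu> by fact
  show "Int_stable {S::'a set. open S}" by (auto simp: Int_stable_def)
  show "sets \<mu> = sigma_sets UNIV {S. open S}" "sets \<nu> = sigma_sets UNIV {S. open S}"
    using assms(3,4) by (simp_all add: borel_def)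
  show "emeasure \<mu> UNIV \<noteq> \<infinity>" by simp
  have lim: "(\<lambda>k. \<integral>x. min 1 (real k * infdist x (- U)) \<partial>M) \<longlonglongrightarrow> measure M U"
    if M: "prob_space M" "sets M = sets borel" and U: "open U" "U \<noteq> UNIV" for M :: "'a measure" and U
  proof -
    interpret M: prob_space M by fact
    have ne: "- U \<noteq> {}" "closed (- U)" using U by auto
    have m: "borel_measurable M = (borel_measurable borel :: ('a \<Rightarrow> real) set)" using M(2) by (rule measurable_cong_sets) simp
    have "(\<lambda>k. \<integral>x. min 1 (real k * infdist x (- U)) \<partial>M) \<longlonglongrightarrow> (\<integral>x. indicator U x \<partial>M)"
    proof (rule integral_dominated_convergence[where w = "\<lambda>_. 1"])
      show "(indicator U :: 'a \<Rightarrow> real) \<in> borel_measurable M" unfolding m using U by simp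
      show "(\<lambda>x. min 1 (real k * infdist x (- U))) \<in> borel_measurable M" for k
        unfolding m by (intro borel_measurable_continuous_onI continuous_intros)
      show "AE x in M. (\<lambda>k. min 1 (real k * infdist x (- U))) \<longlonglongrightarrow> indicator U x"
      proof (rule AE_I2)
        fix x
        show "(\<lambda>k. min 1 (real k * infdist x (- U))) \<longlonglongrightarrow> indicator U x"
        proof (cases "x \<in> U")
          case True
          then have pos: "0 < infdist x (- U)" using ne in_closed_iff_infdist_zero[of "- U" x] infdist_nonneg[of x "- U"] by force
          obtain k0 :: nat where k0: "1 / infdist x (- U) < k0" using reals_Archimedean2 by blast
          have "min 1 (real k * infdist x (- U)) = 1" if "k0 \<le> k" for k
          proof -
            have "1 < real k0 * infdist x (- U)" using k0 pos by (simp add: field_simps)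
            also have "\<dots> \<le> real k * infdist x (- U)" using that pos by (intro mult_right_mono) auto
            finally show ?thesis by simp
          qed
          then have "eventually (\<lambda>k. min 1 (real k * infdist x (- U)) = 1) sequentially"
            by (auto simp: eventually_sequentially)
          then show ?thesis using True by (auto intro: tendsto_eventually)
        next
          case False
          then show ?thesis by simp
        qed
      qed
      show "AE x in M. norm (min 1 (real k * infdist x (- U))) \<le> 1" for k
        by (rule AE_I2) (auto simp: infdist_nonneg min_def)
    qed simp
    also have "(\<integral>x. indicator U x \<partial>M) = measure M U" using U M(2) by simp
    finally show ?thesis .
  qed
  fix U assume "U \<in> {S::'a set. open S}"
  then have U: "open U" by simp
  show "emeasure \<mu> U = emeasure \<nu> U"
  proof (cases "U = UNIV")
    \<comment> \<open>\<open>infdist\<close> to the empty complement is 0 by convention, so the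
      approximation above would fail for the whole space.\<close>
    case True
    have "space \<mu> = UNIV" "space \<nu> = UNIV" using assms(3,4)[THEN sets_eq_imp_space_eq] by simp_all
    then show ?thesis using True \<mu>.emeasure_space_1 \<nu>.emeasure_space_1 by simp
  next
    case False
    have "(\<integral>x. min 1 (real k * infdist x (- U)) \<partial>\<mu>) = (\<integral>x. min 1 (real k * infdist x (- U)) \<partial>\<nu>)" for k
    proof (rule eq)
      show "bounded (range (\<lambda>x. min 1 (real k * infdist x (- U))))"
        by (rule boundedI[of _ 1]) (auto simp: infdist_nonneg min_def)
    qed (intro continuous_intros)
    then have "measure \<mu> U = measure \<nu> U"
      using lim[OF assms(1,3) U False] lim[OF assms(2,4) U False] by (simp add: LIMSEQ_unique)
    then show ?thesis by (simp add: \<mu>.emeasure_eq_measure \<nu>.emeasure_eq_measure)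
  qed
qed auto

lemma weak_limit_eqI:
  fixes \<mu> :: "'a::metric_space measure"
  assumes "prob_space \<mu>" "sets \<mu> = sets borel" "converges_weakly M \<mu>"
  shows "weak_limit M = \<mu>"
  unfolding weak_limit_def
proof (rule the_equality)
  fix \<nu> assume n: "prob_space \<nu> \<and> sets \<nu> = sets borel \<and> converges_weakly M \<nu>"
  show "\<nu> = \<mu>"
  proof (rule measure_eqI_continuous)
    fix f :: "'a \<Rightarrow> real" assume f: "continuous_on UNIV f" "bounded (range f)"
    have "(\<lambda>N. \<integral>s. f s \<partial>M N) \<longlonglongrightarrow> (\<integral>s. f s \<partial>\<nu>)" "(\<lambda>N. \<integral>s. f s \<partial>M N) \<longlonglongrightarrow> (\<integral>s. f s \<partial>\<mu>)"
      using f n assms(3) by (auto simp: converges_weakly_def)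
    then show "(\<integral>x. f x \<partial>\<nu>) = (\<integral>x. f x \<partial>\<mu>)" by (rule LIMSEQ_unique)
  qed (use n assms in auto)
qed (use assms in auto)

text \<open>Common frame for the spins (values -1 and 1) and the edges (values 0 and 1). A function
  of finitely many two-valued coordinates is a combination of products of coordinates, so
  convergence of these products is enough to construct the weak limit.\<close>

locale two_valued_limit =
  fixes S :: "nat \<Rightarrow> ('i::countable \<Rightarrow> real) set" and p :: "nat \<Rightarrow> ('i \<Rightarrow> real) \<Rightarrow> real" and a b :: real
  assumes fin: "\<And>N. finite (S N)" and sub: "\<And>N s i. s \<in> S N \<Longrightarrow> s i = a \<or> s i = b"
    and p0: "\<And>N s. s \<in> S N \<Longrightarrow> 0 \<le> p N s" and p1: "\<And>N. (\<Sum>s\<in>S N. p N s) = 1" and ab: "a \<noteq> b"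
    and conv: "\<And>A. finite A \<Longrightarrow> convergent (\<lambda>N. \<Sum>s\<in>S N. p N s * (\<Prod>i\<in>A. s i))"
begin

definition avg :: "nat \<Rightarrow> (('i \<Rightarrow> real) \<Rightarrow> real) \<Rightarrow> real" where
  "avg N F = (\<Sum>s\<in>S N. p N s * F s)"

abbreviation "pat J \<equiv> PiE J (\<lambda>_. {a, b})"

definition L :: "'i set \<Rightarrow> ('i \<Rightarrow> real) \<Rightarrow> real" where
  "L J y = lim (\<lambda>N. avg N (\<lambda>x. of_bool (\<forall>i\<in>J. x i = y i)))"

lemma finite_pat: "finite J \<Longrightarrow> finite (pat J)"
  by (intro finite_PiE) auto

text \<open>With z the other of the two values, the indicator that coordinate i has value y is
  affine in that coordinate. The indicator of a pattern is then a polynomial whose monomials are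
  covered by \<open>conv\<close>.\<close>

lemma avg_pat_tendsto:
  assumes J: "finite J" and y: "\<And>i. i \<in> J \<Longrightarrow> y i = a \<or> y i = b"
  shows "(\<lambda>N. avg N (\<lambda>x. of_bool (\<forall>i\<in>J. x i = y i))) \<longlonglongrightarrow> L J y"
proof -
  define z where "z i = (if y i = a then b else a)" for i
  define c where "c i = 1 / (y i - z i)" for i
  define d where "d i = - z i / (y i - z i)" for i
  have "of_bool (\<forall>i\<in>J. s i = y i) = (\<Sum>B\<in>Pow J. (\<Prod>i\<in>B. c i) * (\<Prod>i\<in>J - B. d i) * (\<Prod>i\<in>B. s i))" if s: "s \<in> S N" for N s
  proof -
    have "of_bool (\<forall>i\<in>J. s i = y i) = (\<Prod>i\<in>J. of_bool (s i = y i) :: real)"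
      using J by (induction J rule: finite_induct) auto
    also have "\<dots> = (\<Prod>i\<in>J. c i * s i + d i)"
    proof (rule prod.cong[OF refl])
      fix i assume "i \<in> J"
      show "of_bool (s i = y i) = c i * s i + d i"
        using sub[OF s, of i] y[OF \<open>i \<in> J\<close>] ab by (auto simp: c_def d_def z_def diff_divide_distrib[symmetric])
    qed
    also have "\<dots> = (\<Sum>B\<in>Pow J. (\<Prod>i\<in>B. c i * s i) * (\<Prod>i\<in>J - B. d i))" by (rule prod_add[OF J])
    finally show ?thesis by (simp add: prod.distrib mult_ac)
  qed
  then have "avg N (\<lambda>x. of_bool (\<forall>i\<in>J. x i = y i)) =
     (\<Sum>s\<in>S N. \<Sum>B\<in>Pow J. (\<Prod>i\<in>B. c i) * (\<Prod>i\<in>J - B. d i) * (p N s * (\<Prod>i\<in>B. s i)))" for N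
    unfolding avg_def by (intro sum.cong refl) (simp add: sum_distrib_left mult_ac)
  also have "\<dots> N = (\<Sum>B\<in>Pow J. (\<Prod>i\<in>B. c i) * (\<Prod>i\<in>J - B. d i) * (\<Sum>s\<in>S N. p N s * (\<Prod>i\<in>B. s i)))" for N
    by (subst sum.swap) (simp add: sum_distrib_left)
  finally have eq: "avg N (\<lambda>x. of_bool (\<forall>i\<in>J. x i = y i)) =
    (\<Sum>B\<in>Pow J. (\<Prod>i\<in>B. c i) * (\<Prod>i\<in>J - B. d i) * (\<Sum>s\<in>S N. p N s * (\<Prod>i\<in>B. s i)))" for N .
  have "convergent (\<lambda>N. avg N (\<lambda>x. of_bool (\<forall>i\<in>J. x i = y i)))"
    unfolding eq
    by (intro convergent_sum convergent_mult convergent_const conv) (use J finite_subset in auto)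
  then show ?thesis unfolding L_def by (simp add: convergent_LIMSEQ_iff)
qed

lemma avg_local_tendsto:
  assumes J: "finite J" and F: "\<And>x y. (\<And>i. i \<in> J \<Longrightarrow> x i = y i) \<Longrightarrow> F x = F y"
  shows "(\<lambda>N. avg N F) \<longlonglongrightarrow> (\<Sum>y\<in>pat J. F y * L J y)"
proof -
  have F1: "F s = (\<Sum>y\<in>pat J. F y * of_bool (\<forall>i\<in>J. s i = y i))" if s: "\<And>i. s i = a \<or> s i = b" for s
  proof -
    have r: "restrict s J \<in> pat J" using s by auto
    have "(\<Sum>y\<in>pat J. F y * of_bool (\<forall>i\<in>J. s i = y i)) = (\<Sum>y\<in>pat J. if y = restrict s J then F y else 0)"
    proof (rule sum.cong[OF refl])
      fix y assume "y \<in> pat J"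
      then have "(\<forall>i\<in>J. s i = y i) \<longleftrightarrow> y = restrict s J"
        by (auto simp: PiE_def extensional_def fun_eq_iff)
      then show "F y * of_bool (\<forall>i\<in>J. s i = y i) = (if y = restrict s J then F y else 0)" by simp
    qed
    also have "\<dots> = F (restrict s J)" using r finite_pat[OF J] by (simp only: sum.delta if_True)
    also have "\<dots> = F s" by (rule F) simp
    finally show ?thesis by simp
  qed
  have "avg N F = (\<Sum>y\<in>pat J. F y * avg N (\<lambda>x. of_bool (\<forall>i\<in>J. x i = y i)))" for N
  proof -
    have "avg N F = (\<Sum>s\<in>S N. p N s * (\<Sum>y\<in>pat J. F y * of_bool (\<forall>i\<in>J. s i = y i)))"
      unfolding avg_def by (intro sum.cong refl arg_cong2[where f = "(*)"] F1 sub)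
    also have "\<dots> = (\<Sum>s\<in>S N. \<Sum>y\<in>pat J. F y * (p N s * of_bool (\<forall>i\<in>J. s i = y i)))"
      by (simp add: sum_distrib_left mult_ac)
    also have "\<dots> = (\<Sum>y\<in>pat J. F y * avg N (\<lambda>x. of_bool (\<forall>i\<in>J. x i = y i)))"
      unfolding avg_def by (subst sum.swap) (simp add: sum_distrib_left)
    finally show ?thesis .
  qed
  then show ?thesis
    by (simp only:) (intro tendsto_sum tendsto_mult tendsto_const avg_pat_tendsto J, auto simp: PiE_def Pi_def)
qed

lemma L_nonneg: "finite J \<Longrightarrow> y \<in> pat J \<Longrightarrow> 0 \<le> L J y"
  by (rule LIMSEQ_le_const[OF avg_pat_tendsto])
     (auto simp: avg_def PiE_def Pi_def intro!: exI[of _ 0] sum_nonneg mult_nonneg_nonneg p0)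

text \<open>Candidate marginals for Kolmogorov's extension theorem, pushed forward to the Borel
  product sigma-algebra that the theorem expects.\<close>

definition P :: "'i set \<Rightarrow> ('i \<Rightarrow> real) measure" where
  "P J = distr (point_measure (pat J) (\<lambda>y. ennreal (L J y))) (PiM J (\<lambda>_. borel)) (\<lambda>x. x)"

lemma sets_P [simp]: "sets (P J) = sets (PiM J (\<lambda>_. borel))" and space_P [simp]: "space (P J) = space (PiM J (\<lambda>_. borel))"
  by (auto simp: P_def)

lemma emeasure_P:
  assumes J: "finite J" and A: "A \<in> sets (PiM J (\<lambda>_. borel))"
  shows "emeasure (P J) A = ennreal (\<Sum>y\<in>pat J. of_bool (y \<in> A) * L J y)"
proof -
  have m: "(\<lambda>x. x) \<in> measurable (point_measure (pat J) (\<lambda>y. ennreal (L J y))) (PiM J (\<lambda>_. borel))"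
    unfolding measurable_point_measure_eq1 by (auto simp: space_PiM PiE_def)
  have "emeasure (P J) A = emeasure (point_measure (pat J) (\<lambda>y. ennreal (L J y))) (pat J \<inter> A)"
    unfolding P_def by (subst emeasure_distr[OF m A]) (simp add: space_point_measure Int_commute)
  also have "\<dots> = (\<Sum>y\<in>pat J \<inter> A. ennreal (L J y))"
    using finite_pat[OF J] by (intro emeasure_point_measure_finite) auto
  also have "\<dots> = ennreal (\<Sum>y\<in>pat J \<inter> A. L J y)" using L_nonneg[OF J] by (intro sum_ennreal) auto
  also have "(\<Sum>y\<in>pat J \<inter> A. L J y) = (\<Sum>y\<in>pat J. of_bool (y \<in> A) * L J y)"
    using finite_pat[OF J] by (simp add: sum.inter_restrict of_bool_def if_distrib[of "\<lambda>x. x * _"] cong: if_cong)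
  finally show ?thesis .
qed

lemma P_tendsto:
  assumes J: "finite J"
  shows "(\<lambda>N. avg N (\<lambda>x. of_bool (restrict x J \<in> A))) \<longlonglongrightarrow> (\<Sum>y\<in>pat J. of_bool (y \<in> A) * L J y)"
proof -
  have "(\<Sum>y\<in>pat J. of_bool (y \<in> A) * L J y) = (\<Sum>y\<in>pat J. of_bool (restrict y J \<in> A) * L J y)"
    by (intro sum.cong refl) (simp add: PiE_restrict)
  moreover have "restrict x J = restrict y J" if "\<And>i. i \<in> J \<Longrightarrow> x i = y i" for x y :: "'i \<Rightarrow> real"
    using that by (auto simp: restrict_def)
  ultimately show ?thesis using avg_local_tendsto[OF J, of "\<lambda>x. of_bool (restrict x J \<in> A)"] by metis
qed

lemma avg_const: "avg N (\<lambda>_. c) = c"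
  using p1[of N] by (simp add: avg_def sum_distrib_right[symmetric])

lemma prob_space_P: "finite J \<Longrightarrow> prob_space (P J)"
proof (rule prob_spaceI)
  assume J: "finite J"
  let ?A = "space (PiM J (\<lambda>_. borel)) :: ('i \<Rightarrow> real) set"
  have "(\<lambda>N. avg N (\<lambda>x. of_bool (restrict x J \<in> ?A))) = (\<lambda>_. 1)"
    using avg_const[of _ 1] by (simp add: space_PiM)
  then have "(\<lambda>N. avg N (\<lambda>x. of_bool (restrict x J \<in> ?A))) \<longlonglongrightarrow> 1" by (simp only: tendsto_const)
  then have "(\<Sum>y\<in>pat J. of_bool (y \<in> ?A) * L J y) = 1"
    by (rule LIMSEQ_unique[OF P_tendsto[OF J]])
  then show "emeasure (P J) (space (P J)) = 1" by (simp add: emeasure_P[OF J])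
qed

text \<open>Both sides are limits of the same finite-volume averages, so no summation over patterns
  is required.\<close>

lemma P_consistent:
  assumes "J \<subseteq> H" "finite H"
  shows "P J = distr (P H) (PiM J (\<lambda>_. borel)) (\<lambda>f. restrict f J)"
proof (rule measure_eqI)
  have J: "finite J" using assms finite_subset by auto
  have m: "(\<lambda>f. restrict f J) \<in> measurable (P H) (PiM J (\<lambda>_. borel))"
    using measurable_restrict_subset[OF assms(1)] by (simp cong: measurable_cong_sets)
  fix A assume "A \<in> sets (P J)"
  then have A: "A \<in> sets (PiM J (\<lambda>_. borel))" by simp
  let ?B = "(\<lambda>f. restrict f J) -` A \<inter> space (P H)"
  have B: "?B \<in> sets (PiM H (\<lambda>_. borel))" using measurable_sets[OF m A] by simp
  have r: "restrict (restrict x H) J = restrict x J" for x :: "'i \<Rightarrow> real"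
    using assms(1) by (auto simp: restrict_def fun_eq_iff)
  have e: "(\<lambda>N. avg N (\<lambda>x. of_bool (restrict x H \<in> ?B))) = (\<lambda>N. avg N (\<lambda>x. of_bool (restrict x J \<in> A)))"
    by (simp add: space_PiM r del: restrict_restrict)
  have t: "(\<lambda>N. avg N (\<lambda>x. of_bool (restrict x H \<in> ?B))) \<longlonglongrightarrow> (\<Sum>y\<in>pat J. of_bool (y \<in> A) * L J y)"
    unfolding e by (rule P_tendsto[OF J])
  have s: "(\<Sum>y\<in>pat H. of_bool (y \<in> ?B) * L H y) = (\<Sum>y\<in>pat J. of_bool (y \<in> A) * L J y)"
    by (rule LIMSEQ_unique[OF P_tendsto[OF assms(2), of ?B] t])
  have d: "emeasure (distr (P H) (PiM J (\<lambda>_. borel)) (\<lambda>f. restrict f J)) A = emeasure (P H) ?B"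
    by (rule emeasure_distr[OF m A])
  show "emeasure (P J) A = emeasure (distr (P H) (PiM J (\<lambda>_. borel)) (\<lambda>f. restrict f J)) A"
    by (rule trans[OF emeasure_P[OF J A] trans[OF arg_cong[where f = ennreal, OF s[symmetric]]
        trans[OF emeasure_P[OF assms(2) B, symmetric] d[symmetric]]]])
qed simp

text \<open>Kolmogorov extension. Because the index type is countable, the product sigma-algebra of
  the extension is the Borel one in which \<open>weak_limit\<close> is formulated.\<close>

sublocale PP: polish_projective UNIV P
  by (intro polish_projective.intro projective_family.intro) (rule P_consistent prob_space_P; assumption)+

lemma sets_PP [simp]: "sets PP.lim = sets borel"
  by (simp add: sets_PiM_equal_borel)

lemma space_PP [simp]: "space PP.lim = UNIV"
  using sets_eq_imp_space_eq[OF sets_PP] by simp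

declare PP.sets_lim [simp del] PP.space_lim [simp del]

lemma measurable_PP: "f \<in> borel_measurable borel \<Longrightarrow> f \<in> borel_measurable PP.lim"
  by (simp only: measurable_cong_sets[OF sets_PP refl])

lemma emeasure_cylinder:
  assumes "finite J" "A \<in> sets (PiM J (\<lambda>_. borel))"
  shows "emeasure PP.lim {x. restrict x J \<in> A} = ennreal (\<Sum>y\<in>pat J. of_bool (y \<in> A) * L J y)"
proof -
  have "prod_emb UNIV (\<lambda>_. borel) J A = {x. restrict x J \<in> A}" by (auto simp: prod_emb_def)
  then show ?thesis
    using PP.emeasure_lim_emb[of J A] assms emeasure_P by simp
qed

lemma AE_two_valued: "AE x in PP.lim. \<forall>i. x i = a \<or> x i = b"
proof -
  have "AE x in PP.lim. x i = a \<or> x i = b" for i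
  proof -
    let ?A = "pat {i}"
    have A: "?A \<in> sets (PiM {i} (\<lambda>_. borel))" by (intro sets_PiM_I_finite) auto
    have e: "{x. restrict x {i} \<in> ?A} = {x. x i = a \<or> x i = b}" by auto
    have "avg N (\<lambda>x. of_bool (restrict x {i} \<in> ?A)) = 1" for N
    proof -
      have "avg N (\<lambda>x. of_bool (restrict x {i} \<in> ?A)) = avg N (\<lambda>_. 1)"
        unfolding avg_def using sub by (intro sum.cong refl) auto
      then show ?thesis by (simp add: avg_const)
    qed
    then have "(\<lambda>N. avg N (\<lambda>x. of_bool (restrict x {i} \<in> ?A))) \<longlonglongrightarrow> 1" by (simp only: tendsto_const)
    then have "(\<Sum>y\<in>?A. of_bool (y \<in> ?A) * L {i} y) = 1"
      by (rule LIMSEQ_unique[OF P_tendsto[OF finite.insertI[OF finite.emptyI]]])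
    then have 1: "emeasure PP.lim {x. x i = a \<or> x i = b} = 1"
      using emeasure_cylinder[OF _ A] unfolding e by simp
    then have "PP.P.prob {x. x i = a \<or> x i = b} = 1" by (simp add: measure_def)
    then show ?thesis by (rule PP.P.AE_prob_1[THEN AE_mp]) auto
  qed
  then show ?thesis by (simp add: AE_all_countable)
qed

lemma integral_local:
  assumes J: "finite J" and F: "\<And>x y. (\<And>i. i \<in> J \<Longrightarrow> x i = y i) \<Longrightarrow> F x = F y"
    and m: "F \<in> borel_measurable borel"
  shows "(\<integral>x. F x \<partial>PP.lim) = (\<Sum>y\<in>pat J. F y * L J y)"
proof -
  let ?C = "\<lambda>y. {x. restrict x J \<in> {y}}"
  have y: "{y} \<in> sets (PiM J (\<lambda>_. borel))" if "y \<in> pat J" for y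
  proof -
    have "PiE J (\<lambda>i. {y i}) = {y}" using that by (auto simp: PiE_def extensional_def Pi_def fun_eq_iff) metis
    then show ?thesis using sets_PiM_I_finite[OF J, of "\<lambda>i. {y i}" "\<lambda>_. borel"] by simp
  qed
  have e: "emeasure PP.lim (?C y) = ennreal (L J y)" if "y \<in> pat J" for y
  proof -
    have "(\<Sum>z\<in>pat J. of_bool (z \<in> {y}) * L J z) = L J y"
      using that finite_pat[OF J] by (simp add: of_bool_def if_distrib[of "\<lambda>x. x * _"] cong: if_cong)
    then show ?thesis using emeasure_cylinder[OF J y[OF that]] by simp
  qed
  have C: "?C y \<in> sets borel" if "y \<in> pat J" for y
  proof -
    have "(\<lambda>x. restrict x J) -` {y} \<inter> space (PiM UNIV (\<lambda>_. borel)) \<in> sets (PiM UNIV (\<lambda>_. borel))"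
      by (rule measurable_sets[OF measurable_restrict_subset y[OF that]]) simp
    moreover have "(\<lambda>x. restrict x J) -` {y} \<inter> space (PiM UNIV (\<lambda>_. borel)) = ?C y"
      by (auto simp: space_PiM)
    ultimately show ?thesis by (simp only: sets_PiM_equal_borel)
  qed
  have "(\<integral>x. F x \<partial>PP.lim) = (\<integral>x. (\<Sum>y\<in>pat J. F y * indicator (?C y) x) \<partial>PP.lim)"
  proof (rule integral_cong_AE)
    show "F \<in> borel_measurable PP.lim" using m by (rule measurable_PP)
    have "(\<lambda>x. \<Sum>y\<in>pat J. F y * indicator (?C y) x) \<in> borel_measurable borel"
      by (intro borel_measurable_sum borel_measurable_times borel_measurable_const borel_measurable_indicator C)
    then show "(\<lambda>x. \<Sum>y\<in>pat J. F y * indicator (?C y) x) \<in> borel_measurable PP.lim" by (rule measurable_PP)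
    show "AE x in PP.lim. F x = (\<Sum>y\<in>pat J. F y * indicator (?C y) x)"
      using AE_two_valued
    proof eventually_elim
      case (elim x)
      then have r: "restrict x J \<in> pat J" by auto
      have "(\<Sum>y\<in>pat J. F y * indicator (?C y) x) = (\<Sum>y\<in>pat J. if y = restrict x J then F y else 0)"
        by (intro sum.cong refl) (auto simp: indicator_def)
      also have "\<dots> = F (restrict x J)" using r finite_pat[OF J] by (simp only: sum.delta if_True)
      also have "\<dots> = F x" by (rule F) simp
      finally show ?case by simp
    qed
  qed
  also have "\<dots> = (\<Sum>y\<in>pat J. F y * PP.P.prob (?C y))"
    using C by (subst Bochner_Integration.integral_sum) (auto intro!: integrable_mult_right integrable_real_indicator simp: PP.P.emeasure_eq_measure)
  also have "\<dots> = (\<Sum>y\<in>pat J. F y * L J y)"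
    using e L_nonneg[OF J] by (intro sum.cong refl) (simp add: measure_def)
  finally show ?thesis .
qed

lemma avg_local_integral:
  assumes J: "finite J" and F: "\<And>x y. (\<And>i. i \<in> J \<Longrightarrow> x i = y i) \<Longrightarrow> F x = F y"
    and m: "F \<in> borel_measurable borel"
  shows "(\<lambda>N. avg N F) \<longlonglongrightarrow> (\<integral>x. F x \<partial>PP.lim)"
proof -
  have i: "(\<integral>x. F x \<partial>PP.lim) = (\<Sum>y\<in>pat J. F y * L J y)"
    by (rule integral_local[OF J _ m]) (rule F, blast)
  show ?thesis unfolding i by (rule avg_local_tendsto[OF J]) (rule F, blast)
qed

definition tr :: "nat \<Rightarrow> ('i \<Rightarrow> real) \<Rightarrow> 'i \<Rightarrow> real" where
  "tr n x = (\<lambda>i. if i \<in> from_nat ` {..n} then x i else a)"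

text \<open>A continuous function is uniformly continuous on the compact space of two-valued
  configurations, hence uniformly close to a function of finitely many coordinates.\<close>

lemma truncation:
  assumes f: "continuous_on UNIV (f :: ('i \<Rightarrow> real) \<Rightarrow> real)" and e: "0 < \<epsilon>"
  shows "\<exists>n. \<forall>x. (\<forall>i. x i = a \<or> x i = b) \<longrightarrow> \<bar>f x - f (tr n x)\<bar> < \<epsilon>"
proof -
  let ?K = "PiE UNIV (\<lambda>_::'i. {a, b})"
  have "compactin (product_topology (\<lambda>_::'i. euclidean) UNIV) ?K"
    by (subst compactin_PiE) auto
  then have K: "compact ?K" by (simp add: euclidean_product_topology)
  have "uniformly_continuous_on ?K f"
    using f K by (intro compact_uniformly_continuous) (auto intro: continuous_on_subset)
  then obtain d where d: "0 < d" "\<And>x x'. x \<in> ?K \<Longrightarrow> x' \<in> ?K \<Longrightarrow> dist x' x < d \<Longrightarrow> dist (f x') (f x) < \<epsilon>"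
    using e unfolding uniformly_continuous_on_def by metis
  obtain n where n: "(1 / 2) ^ n < d" using d(1) real_arch_pow_inv[of d "1/2"] by auto
  show ?thesis
  proof (intro exI allI impI)
    fix x :: "'i \<Rightarrow> real" assume x: "\<forall>i. x i = a \<or> x i = b"
    \<comment> \<open>The metric weighs coordinates by their enumeration. The first n + 1 of them
      agree, so only the geometric tail remains.\<close>
    have "{dist (x (from_nat k)) (tr n x (from_nat k)) |k. k \<le> n} = {0}"
      by (auto simp: tr_def)
    then have "dist x (tr n x) \<le> (1 / 2) ^ n"
      using dist_fun_le_dist_first_terms[of x "tr n x" n] by simp
    then have "dist x (tr n x) < d" using n by simp
    moreover have "tr n x \<in> ?K" "x \<in> ?K" using x by (simp_all add: tr_def PiE_def Pi_def)
    ultimately have "dist (f x) (f (tr n x)) < \<epsilon>" by (intro d(2))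
    then show "\<bar>f x - f (tr n x)\<bar> < \<epsilon>" by (simp only: dist_real_def)
  qed
qed

lemma continuous_tr: "continuous_on UNIV (tr n)"
  unfolding tr_def
proof (rule continuous_on_coordinatewise_then_product)
  fix i :: 'i
  show "continuous_on UNIV (\<lambda>x. if i \<in> from_nat ` {..n} then x i else a)"
    by (cases "i \<in> from_nat ` {..n}") (auto intro: continuous_intros continuous_on_product_coordinates)
qed

lemma avg_abs_le:
  assumes "\<And>s. s \<in> S N \<Longrightarrow> \<bar>F s\<bar> \<le> c" shows "\<bar>avg N F\<bar> \<le> c"
proof -
  have "\<bar>avg N F\<bar> \<le> (\<Sum>s\<in>S N. \<bar>p N s * F s\<bar>)" unfolding avg_def by (rule sum_abs)
  also have "\<dots> \<le> (\<Sum>s\<in>S N. p N s * c)"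
    using assms p0 by (intro sum_mono) (auto simp: abs_mult intro!: mult_left_mono)
  also have "\<dots> = c" using avg_const[of N c] by (simp add: avg_def)
  finally show ?thesis .
qed

lemma avg_continuous_tendsto:
  assumes f: "continuous_on UNIV (f :: ('i \<Rightarrow> real) \<Rightarrow> real)" and bd: "bounded (range f)"
  shows "(\<lambda>N. avg N f) \<longlonglongrightarrow> (\<integral>x. f x \<partial>PP.lim)"
proof (rule LIMSEQ_I)
  fix r :: real assume r: "0 < r"
  obtain n where n: "\<And>x. (\<forall>i. x i = a \<or> x i = b) \<Longrightarrow> \<bar>f x - f (tr n x)\<bar> < r / 3"
    using truncation[OF f, of "r / 3"] r by auto
  obtain B where B: "\<And>x. \<bar>f x\<bar> \<le> B" using bd by (auto simp: bounded_iff)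
  let ?g = "\<lambda>x. f (tr n x)"
  have gc: "continuous_on UNIV ?g"
    using continuous_on_compose2[OF f continuous_tr] by simp
  have fm: "f \<in> borel_measurable borel" "?g \<in> borel_measurable borel"
    using f gc by (auto intro: borel_measurable_continuous_onI)
  then have fm': "f \<in> borel_measurable PP.lim" "?g \<in> borel_measurable PP.lim" by (auto intro: measurable_PP)
  have int: "integrable PP.lim f" "integrable PP.lim ?g"
    using fm' B by (auto intro!: PP.P.integrable_const_bound[where B = B])
  have "(\<lambda>N. avg N ?g) \<longlonglongrightarrow> (\<integral>x. ?g x \<partial>PP.lim)"
  proof (rule avg_local_integral[where J = "from_nat ` {..n}"])
    fix x y :: "'i \<Rightarrow> real" assume "\<And>i. i \<in> from_nat ` {..n} \<Longrightarrow> x i = y i"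
    then have "tr n x = tr n y" by (auto simp: tr_def)
    then show "?g x = ?g y" by simp
  qed (use fm in auto)
  then obtain N0 where N0: "\<And>N. N0 \<le> N \<Longrightarrow> \<bar>avg N ?g - (\<integral>x. ?g x \<partial>PP.lim)\<bar> < r / 3"
    using r LIMSEQ_D[of _ _ "r / 3"] by (metis divide_pos_pos real_norm_def zero_less_numeral)
  have i: "\<bar>(\<integral>x. f x \<partial>PP.lim) - (\<integral>x. ?g x \<partial>PP.lim)\<bar> \<le> r / 3"
  proof -
    have "\<bar>(\<integral>x. f x - ?g x \<partial>PP.lim)\<bar> \<le> (\<integral>x. \<bar>f x - ?g x\<bar> \<partial>PP.lim)" by (rule integral_abs_bound)
    also have "\<dots> \<le> (\<integral>x. r / 3 \<partial>PP.lim)"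
    proof (rule integral_mono_AE)
      show "AE x in PP.lim. \<bar>f x - ?g x\<bar> \<le> r / 3"
        using AE_two_valued by eventually_elim (rule less_imp_le, rule n)
    qed (use int in auto)
    also have "\<dots> = r / 3" using PP.P.prob_space by simp
    finally show ?thesis using int by simp
  qed
  show "\<exists>no. \<forall>N\<ge>no. norm (avg N f - (\<integral>x. f x \<partial>PP.lim)) < r"
  proof (intro exI allI impI)
    fix N assume "N0 \<le> N"
    have "\<bar>avg N (\<lambda>x. f x - ?g x)\<bar> \<le> r / 3" by (rule avg_abs_le) (use n sub in \<open>auto intro!: less_imp_le\<close>)
    then have "\<bar>avg N f - avg N ?g\<bar> \<le> r / 3" by (simp add: avg_def right_diff_distrib sum_subtractf)
    then show "norm (avg N f - (\<integral>x. f x \<partial>PP.lim)) < r" using i N0[OF \<open>N0 \<le> N\<close>] unfolding real_norm_def by linarith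
  qed
qed

theorem weak_limit_eq:
  assumes "\<And>N f. f \<in> borel_measurable borel \<Longrightarrow> (\<integral>x. f x \<partial>M N) = avg N f"
  shows "weak_limit M = PP.lim"
proof (rule weak_limit_eqI)
  show "prob_space PP.lim" by (rule PP.P.prob_space_axioms)
  show "converges_weakly M PP.lim"
    unfolding converges_weakly_def
    using assms avg_continuous_tendsto by (auto simp: borel_measurable_continuous_onI)
qed simp

end

section \<open>The Ising plus state and the FK measure\<close>

lemma spin_configs_eq: "spin_configs N = spins (int_box N)"
  by (simp add: spin_configs_def spins_def)

lemma distinct_list_prod: "finite A \<Longrightarrow> \<exists>xs. \<forall>\<sigma>. (\<Prod>i\<in>A. \<sigma> i) = mon xs \<sigma>"
  using finite_distinct_list[of A] by (metis mon_def prod.distinct_set_conv_list)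

context ising begin

lemma ising_weight_eq: "ising_weight J \<beta> N \<sigma> = plus_w (bdry J \<beta> N) (int_box N) \<sigma>"
proof -
  have "ising_weight J \<beta> N \<sigma> = exp (\<Sum>(i, j)\<in>edges (int_box N). \<beta> * (J (i - j) * \<sigma> i * \<sigma> j)) *
      exp (\<Sum>i\<in>int_box N. \<beta> * (\<Sum>\<^sub>\<infinity>j\<in>- int_box N. J (i - j) * \<sigma> i))"
    by (simp add: ising_weight_def exp_add sum_distrib_left split_def)
  also have "\<dots> = plus_w (bdry J \<beta> N) (int_box N) \<sigma>"
    unfolding plus_w_def free_w_def pair_w_def
    by (simp add: exp_sum Jb_def bdry_def split_def infsum_cmult_left' mult.assoc)
  finally show ?thesis .
qed

context
  assumes sumJ: "summable (\<lambda>r. real r * J (int r))"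
begin

interpretation I: two_valued_limit "\<lambda>N. spins (int_box N)"
  "\<lambda>N \<sigma>. plus_w (bdry J \<beta> N) (int_box N) \<sigma> / (\<Sum>\<sigma>\<in>spins (int_box N). plus_w (bdry J \<beta> N) (int_box N) \<sigma>)" "-1" 1
proof
  fix N
  have f: "ferro (int_box N) (plus_w (bdry J \<beta> N) (int_box N))" by (intro ferro_plus_w bdry_nonneg)
  then have Z: "0 < (\<Sum>\<sigma>\<in>spins (int_box N). plus_w (bdry J \<beta> N) (int_box N) \<sigma>)" by (intro ferro_Z_pos) auto
  then show "0 \<le> plus_w (bdry J \<beta> N) (int_box N) s / (\<Sum>\<sigma>\<in>spins (int_box N). plus_w (bdry J \<beta> N) (int_box N) \<sigma>)" if "s \<in> spins (int_box N)" for s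
    using f that by (auto simp: ferro_def less_imp_le)
  show "(\<Sum>s\<in>spins (int_box N). plus_w (bdry J \<beta> N) (int_box N) s / (\<Sum>\<sigma>\<in>spins (int_box N). plus_w (bdry J \<beta> N) (int_box N) \<sigma>)) = 1"
    using Z by (simp add: sum_divide_distrib[symmetric])
  show "s i = - 1 \<or> s i = 1" if "s \<in> spins (int_box N)" for s i using spins_cases[OF that, of i] by auto
next
  fix A :: "int set" assume "finite A"
  then obtain xs where xs: "\<And>\<sigma>. (\<Prod>i\<in>A. \<sigma> i :: real) = mon xs \<sigma>" using distinct_list_prod by metis
  have "(\<Sum>s\<in>spins (int_box N). plus_w (bdry J \<beta> N) (int_box N) s / (\<Sum>\<sigma>\<in>spins (int_box N). plus_w (bdry J \<beta> N) (int_box N) \<sigma>) * (\<Prod>i\<in>A. s i)) = plus N (mon xs)" for N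
    unfolding plus_def gibbs_def xs sum_divide_distrib by (intro sum.cong refl) simp
  then show "convergent (\<lambda>N. \<Sum>s\<in>spins (int_box N). plus_w (bdry J \<beta> N) (int_box N) s / (\<Sum>\<sigma>\<in>spins (int_box N). plus_w (bdry J \<beta> N) (int_box N) \<sigma>) * (\<Prod>i\<in>A. s i))"
    using plus_mon_convergent[OF sumJ] by simp
qed auto

lemma avg_eq_plus: "I.avg N F = plus N F"
  unfolding I.avg_def plus_def gibbs_def sum_divide_distrib by (intro sum.cong refl) simp

lemma ising_plus_eq: "ising_plus J \<beta> = I.PP.lim"
  unfolding ising_plus_def
proof (rule I.weak_limit_eq)
  fix N and f :: "(int \<Rightarrow> real) \<Rightarrow> real" assume f: "f \<in> borel_measurable borel"
  have w: "ising_weight J \<beta> N = plus_w (bdry J \<beta> N) (int_box N)" by (rule ext) (rule ising_weight_eq)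
  have "ferro (int_box N) (plus_w (bdry J \<beta> N) (int_box N))" by (intro ferro_plus_w bdry_nonneg)
  then show "(\<integral>x. f x \<partial>ising_finite J \<beta> N) = I.avg N f"
    unfolding ising_finite_def spin_configs_eq w I.avg_def
    by (intro integral_weighted_measure f) (auto simp: ferro_def less_imp_le)
qed

lemma plus_tendsto_integral:
  assumes "finite A" "\<And>\<sigma> \<tau>. (\<And>i. i \<in> A \<Longrightarrow> \<sigma> i = \<tau> i) \<Longrightarrow> F \<sigma> = F \<tau>" "F \<in> borel_measurable borel"
  shows "(\<lambda>N. plus N F) \<longlonglongrightarrow> (\<integral>\<sigma>. F \<sigma> \<partial>ising_plus J \<beta>)"
  using I.avg_local_integral[OF assms(1) _ assms(3)] assms(2) unfolding avg_eq_plus ising_plus_eq by blast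

lemma measurable_spin: "(\<lambda>\<sigma>::int \<Rightarrow> real. \<sigma> x) \<in> borel_measurable borel"
  by (intro borel_measurable_continuous_onI continuous_on_product_coordinates)

theorem spin_cov_eq: "spin_cov J \<beta> 0 x = corr_inf J \<beta> x"
proof -
  have "(\<lambda>N. plus N (\<lambda>\<sigma>. \<sigma> y)) \<longlonglongrightarrow> (\<integral>\<sigma>. \<sigma> y \<partial>ising_plus J \<beta>)" for y
    by (rule plus_tendsto_integral[of "{y}"]) (auto intro: measurable_spin)
  then have m: "(\<integral>\<sigma>. \<sigma> y \<partial>ising_plus J \<beta>) = 0" for y
    using plus_spin_tendsto[OF sumJ] LIMSEQ_unique by blast
  have "(\<lambda>N. plus N (\<lambda>\<sigma>. \<sigma> 0 * \<sigma> x)) \<longlonglongrightarrow> (\<integral>\<sigma>. \<sigma> 0 * \<sigma> x \<partial>ising_plus J \<beta>)"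
    by (rule plus_tendsto_integral[of "{0, x}"]) (auto intro: measurable_spin)
  then have "(\<integral>\<sigma>. \<sigma> 0 * \<sigma> x \<partial>ising_plus J \<beta>) = corr_inf J \<beta> x"
    using plus_pair_tendsto[OF sumJ] LIMSEQ_unique by blast
  then show ?thesis by (simp add: spin_cov_def m)
qed

end

end

section \<open>The FK measure: edge sets, cluster weights and convergence\<close>

definition ind :: "'e set \<Rightarrow> 'e \<Rightarrow> real" where
  "ind A e = (if e \<in> A then 1 else 0)"

lemma edge_configs_eq: "edge_configs N = ind ` Pow (edges (int_box N))"
proof
  show "edge_configs N \<subseteq> ind ` Pow (edges (int_box N))"
  proof
    fix \<omega> assume "\<omega> \<in> edge_configs N"
    then have "\<omega> = ind {e \<in> edges (int_box N). \<omega> e = 1}" by (auto simp: edge_configs_def ind_def fun_eq_iff)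
    then show "\<omega> \<in> ind ` Pow (edges (int_box N))" by blast
  qed
  show "ind ` Pow (edges (int_box N)) \<subseteq> edge_configs N" by (auto simp: edge_configs_def ind_def)
qed

lemma inj_ind: "inj_on ind X"
  by (auto simp: inj_on_def ind_def fun_eq_iff split: if_splits)

lemma open_rel_ind:
  assumes "A \<subseteq> edges V" shows "open_rel (ind A) = adj A"
  using assms by (auto simp: open_rel_def ind_def adj_def edges_def min_def max_def split: if_splits)

lemma adj_subset: "A \<subseteq> edges V \<Longrightarrow> adj A \<subseteq> V \<times> V"
  by (auto simp: adj_def edges_def)

text \<open>An agreeing spin configuration is determined by the set of clusters on which it is -1,
  and every set of clusters occurs.\<close>

lemma nagree_eq_power:
  assumes V: "finite V" and A: "A \<subseteq> V \<times> V"
  shows "nagree V A = 2 ^ card (V // (adj A)\<^sup>*)"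
proof -
  let ?R = "(adj A)\<^sup>*"
  have "sym (adj A)" by (auto simp: adj_def sym_def)
  \<comment> \<open>The reflexive closure relates every element of the type to itself, so this is an
    equivalence on the whole type; V is a union of classes.\<close>
  then have eq: "equiv UNIV ?R"
    by (intro equivI refl_rtrancl sym_rtrancl trans_rtrancl) auto
  have cl: "C \<subseteq> V" "C \<noteq> {}" if "C \<in> V // ?R" for C
    using that cluster_subset[OF A] by (auto simp: quotient_def)
  have const: "\<sigma> i = \<sigma> j" if "agree A \<sigma>" "C \<in> V // ?R" "i \<in> C" "j \<in> C" for \<sigma> :: "'a \<Rightarrow> real" and C i j
    using that agree_path[OF that(1)] by (auto simp: quotient_def) metis
  have "bij_betw (\<lambda>Q. flip (\<Union>Q)) (Pow (V // ?R)) {\<sigma> \<in> spins V. agree A \<sigma>}"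
  proof (rule bij_betw_byWitness[where f' = "\<lambda>\<sigma>. {C \<in> V // ?R. \<forall>i\<in>C. \<sigma> i = -1}"])
    show "\<forall>Q\<in>Pow (V // ?R). {C \<in> V // ?R. \<forall>i\<in>C. flip (\<Union>Q) i = -1} = Q"
    proof (intro ballI set_eqI)
      fix Q C assume Q: "Q \<in> Pow (V // ?R)"
      show "C \<in> {C \<in> V // ?R. \<forall>i\<in>C. flip (\<Union>Q) i = -1} \<longleftrightarrow> C \<in> Q"
      proof
        assume C: "C \<in> {C \<in> V // ?R. \<forall>i\<in>C. flip (\<Union>Q) i = -1}"
        then obtain i where "i \<in> C" using cl by blast
        then obtain D where D: "D \<in> Q" "i \<in> D" using C by (auto simp: flip_def split: if_splits)
        have "V // ?R \<subseteq> UNIV // ?R" by (auto simp: quotient_def)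
        then have "C = D" using quotient_disj[OF eq, of C D] C D Q \<open>i \<in> C\<close> by blast
        then show "C \<in> Q" using D by simp
      qed (use Q in \<open>auto simp: flip_def\<close>)
    qed
    show "\<forall>\<sigma>\<in>{\<sigma> \<in> spins V. agree A \<sigma>}. flip (\<Union>{C \<in> V // ?R. \<forall>i\<in>C. \<sigma> i = -1}) = \<sigma>"
    proof (intro ballI ext)
      fix \<sigma> i assume s: "\<sigma> \<in> {\<sigma> \<in> spins V. agree A \<sigma>}"
      show "flip (\<Union>{C \<in> V // ?R. \<forall>i\<in>C. \<sigma> i = -1}) i = \<sigma> i"
      proof (cases "i \<in> V")
        case True
        then have C: "?R `` {i} \<in> V // ?R" "i \<in> ?R `` {i}" by (auto simp: quotient_def)
        show ?thesis
        proof (cases "\<sigma> i = -1")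
          case True
          then have "\<forall>j\<in>?R `` {i}. \<sigma> j = -1" using const[of \<sigma> "?R `` {i}" _ i] C s by auto
          then have "i \<in> \<Union>{C \<in> V // ?R. \<forall>i\<in>C. \<sigma> i = -1}" using C by blast
          then show ?thesis using True by (simp only: flip_def if_True)
        next
          case False
          then have "i \<notin> \<Union>{C \<in> V // ?R. \<forall>i\<in>C. \<sigma> i = -1}" by auto
          moreover have "\<sigma> i = 1" using False s spins_cases[of \<sigma> V i] by auto
          ultimately show ?thesis by (simp only: flip_def if_False)
        qed
      next
        case False
        then have "i \<notin> \<Union>{C \<in> V // ?R. \<forall>i\<in>C. \<sigma> i = -1}" using cl by blast
        moreover have "\<sigma> i = 1" using False s by (auto simp: spins_def)
        ultimately show ?thesis by (simp only: flip_def if_False)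
      qed
    qed
    show "(\<lambda>Q. flip (\<Union>Q)) ` Pow (V // ?R) \<subseteq> {\<sigma> \<in> spins V. agree A \<sigma>}"
    proof (rule image_subsetI)
      fix Q assume Q: "Q \<in> Pow (V // ?R)"
      have "fst e \<in> C \<longleftrightarrow> snd e \<in> C" if "e \<in> A" "C \<in> Q" for e C
      proof -
        have "(fst e, snd e) \<in> adj A" "(snd e, fst e) \<in> adj A" using that by (auto simp: adj_def)
        moreover have "C \<in> V // ?R" using that Q by auto
        then obtain x where "C = ?R `` {x}" by (auto simp: quotient_def)
        ultimately show ?thesis by (auto intro: rtrancl_into_rtrancl)
      qed
      then have "agree A (flip (\<Union>Q))" by (auto simp: agree_def flip_def)
      moreover have "flip (\<Union>Q) \<in> spins V" using Q cl by (intro flip_in_spins) blast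
      ultimately show "flip (\<Union>Q) \<in> {\<sigma> \<in> spins V. agree A \<sigma>}" by simp
    qed
    show "(\<lambda>\<sigma>. {C \<in> V // ?R. \<forall>i\<in>C. \<sigma> i = -1}) ` {\<sigma> \<in> spins V. agree A \<sigma>} \<subseteq> Pow (V // ?R)" by auto
  qed
  then have "card {\<sigma> \<in> spins V. agree A \<sigma>} = card (Pow (V // ?R))" by (rule bij_betw_same_card[symmetric])
  moreover have "finite (V // ?R)" using V by (simp add: quotient_def)
  moreover have "nagree V A = card {\<sigma> \<in> spins V. agree A \<sigma>}"
    using V by (simp add: nagree_def Int_def)
  ultimately show ?thesis by (simp add: card_Pow)
qed

context ising begin

text \<open>In the Edwards-Sokal coupling, given the spins, an edge is open independently with
  probability \<open>open_prob\<close> if its ends agree. The probability that \<open>D\<close> is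
  open thus becomes an Ising expectation of a function in the cone, to which Griffiths' inequalities
  apply.\<close>

lemma edges_open_bern:
  assumes V: "finite V" and D: "D \<subseteq> edges V"
  shows "gibbs V (free_w J \<beta> V) (\<lambda>\<sigma>. (\<Prod>e\<in>D. open_prob e) * of_bool (agree D \<sigma>)) =
    bern (edges V) open_prob (\<lambda>\<omega>. of_bool (D \<subseteq> \<omega>) * nagree V \<omega>) / bern (edges V) open_prob (nagree V)"
proof -
  let ?E = "edges V"
  let ?C = "\<Prod>e\<in>?E. exp (Jb J \<beta> e)" and ?B = "bern ?E open_prob"
  have fE: "finite ?E" using V by simp
  have fD: "finite D" using D fE by (rule finite_subset)
  have 1: "(\<Prod>e\<in>D. open_prob e) * of_bool (agree D \<sigma>) * free_w J \<beta> V \<sigma> = ?C * ?B (\<lambda>\<omega>. of_bool (D \<subseteq> \<omega>) * of_bool (agree \<omega> \<sigma>))"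
    if s: "\<sigma> \<in> spins V" for \<sigma>
  proof -
    let ?a = "\<lambda>e. of_bool (\<sigma> (fst e) = \<sigma> (snd e)) :: real"
    have "(\<Prod>e\<in>D. open_prob e) * of_bool (agree D \<sigma>) = (\<Prod>e\<in>D. ?a e * open_prob e)"
      using prod_of_bool_agree[OF fD, of \<sigma> open_prob] by simp
    also have "\<dots> = (\<Prod>e\<in>?E. if e \<in> D then ?a e * open_prob e else 1)"
      using D fE by (simp add: prod.inter_restrict[symmetric] Int_absorb1)
    finally have "(\<Prod>e\<in>D. open_prob e) * of_bool (agree D \<sigma>) * free_w J \<beta> V \<sigma> =
      (\<Prod>e\<in>?E. (if e \<in> D then ?a e * open_prob e else 1) * exp (Jb J \<beta> e * (\<sigma> (fst e) * \<sigma> (snd e))))"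
      by (simp add: free_w_def pair_w_def prod.distrib)
    also have "\<dots> = (\<Prod>e\<in>?E. exp (Jb J \<beta> e) * (?a e * open_prob e + of_bool (e \<notin> D) * (1 - open_prob e)))"
    proof (rule prod.cong[OF refl])
      fix e
      show "(if e \<in> D then ?a e * open_prob e else 1) * exp (Jb J \<beta> e * (\<sigma> (fst e) * \<sigma> (snd e))) = exp (Jb J \<beta> e) * (?a e * open_prob e + of_bool (e \<notin> D) * (1 - open_prob e))"
        using spins_cases[OF s, of "fst e"] spins_cases[OF s, of "snd e"]
        by (auto simp: open_prob_def simp flip: exp_add)
    qed
    also have "\<dots> = ?C * (\<Prod>e\<in>?E. ?a e * open_prob e + of_bool (e \<notin> D) * (1 - open_prob e))" by (simp add: prod.distrib)
    also have "(\<Prod>e\<in>?E. ?a e * open_prob e + of_bool (e \<notin> D) * (1 - open_prob e)) =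
      (\<Sum>\<omega>\<in>Pow ?E. (\<Prod>e\<in>\<omega>. ?a e * open_prob e) * (\<Prod>e\<in>?E - \<omega>. of_bool (e \<notin> D) * (1 - open_prob e)))"
      by (rule prod_add) fact
    also have "\<dots> = ?B (\<lambda>\<omega>. of_bool (D \<subseteq> \<omega>) * of_bool (agree \<omega> \<sigma>))"
      unfolding bern_def
    proof (rule sum.cong[OF refl])
      fix \<omega> assume w: "\<omega> \<in> Pow ?E"
      then have "finite \<omega>" using fE by (auto intro: finite_subset)
      from prod_of_bool_agree[OF this, of \<sigma> open_prob]
      have a: "(\<Prod>e\<in>\<omega>. ?a e * open_prob e) = of_bool (agree \<omega> \<sigma>) * (\<Prod>e\<in>\<omega>. open_prob e)" .
      have "(\<Prod>e\<in>?E - \<omega>. of_bool (e \<notin> D) :: real) = of_bool (\<forall>e\<in>?E - \<omega>. e \<notin> D)"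
        using fE by (induction "?E - \<omega>" rule: infinite_finite_induct) auto
      also have "(\<forall>e\<in>?E - \<omega>. e \<notin> D) \<longleftrightarrow> D \<subseteq> \<omega>" using D by auto
      finally have b: "(\<Prod>e\<in>?E - \<omega>. of_bool (e \<notin> D) * (1 - open_prob e)) = of_bool (D \<subseteq> \<omega>) * (\<Prod>e\<in>?E - \<omega>. 1 - open_prob e)"
        by (simp only: prod.distrib)
      show "(\<Prod>e\<in>\<omega>. ?a e * open_prob e) * (\<Prod>e\<in>?E - \<omega>. of_bool (e \<notin> D) * (1 - open_prob e)) =
        (\<Prod>e\<in>\<omega>. open_prob e) * (\<Prod>e\<in>?E - \<omega>. 1 - open_prob e) * (of_bool (D \<subseteq> \<omega>) * of_bool (agree \<omega> \<sigma>))"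
        unfolding a b by (simp only: mult_ac)
    qed
    finally show ?thesis .
  qed
  have "(\<Sum>\<sigma>\<in>spins V. (\<Prod>e\<in>D. open_prob e) * of_bool (agree D \<sigma>) * free_w J \<beta> V \<sigma>) =
    ?C * (\<Sum>\<sigma>\<in>spins V. 1 * ?B (\<lambda>\<omega>. of_bool (D \<subseteq> \<omega>) * of_bool (agree \<omega> \<sigma>)))"
    unfolding sum_distrib_left by (intro sum.cong refl) (simp only: 1 mult_1)
  also have "\<dots> = ?C * ?B (\<lambda>\<omega>. of_bool (D \<subseteq> \<omega>) * nagree V \<omega>)"
    unfolding sum_bern by (simp only: nagree_def sum_distrib_left mult_1)
  finally have "(\<Sum>\<sigma>\<in>spins V. (\<Prod>e\<in>D. open_prob e) * of_bool (agree D \<sigma>) * free_w J \<beta> V \<sigma>) = ?C * ?B (\<lambda>\<omega>. of_bool (D \<subseteq> \<omega>) * nagree V \<omega>)" .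
  moreover have "?C \<noteq> 0" using fE by simp
  ultimately show ?thesis unfolding gibbs_def Z_bern(1)[OF V] by simp
qed

lemma fk_weight_ind:
  assumes A: "A \<subseteq> edges (int_box N)"
  shows "fk_weight J \<beta> N (ind A) = (\<Prod>e\<in>edges (int_box N). exp (2 * Jb J \<beta> e)) *
    ((\<Prod>e\<in>A. open_prob e) * (\<Prod>e\<in>edges (int_box N) - A. 1 - open_prob e) * nagree (int_box N) A)"
proof -
  let ?E = "edges (int_box N)"
  have "open_rel (ind A) \<inter> int_box N \<times> int_box N = adj A"
    using open_rel_ind[OF A] adj_subset[OF A] by auto
  then have n: "2 ^ num_components N (ind A) = nagree (int_box N) A"
    unfolding num_components_def by (subst nagree_eq_power) (use A in \<open>auto simp: edges_def\<close>)
  have "{e \<in> ?E. ind A e = 1} = A" using A by (auto simp: ind_def)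
  then have "fk_weight J \<beta> N (ind A) = nagree (int_box N) A * (\<Prod>e\<in>A. exp (2 * Jb J \<beta> e) - 1)"
    unfolding fk_weight_def n by (simp add: Jb_def split_def mult.assoc)
  also have "(\<Prod>e\<in>A. exp (2 * Jb J \<beta> e) - 1) = (\<Prod>e\<in>A. exp (2 * Jb J \<beta> e) * open_prob e)"
    by (intro prod.cong refl) (simp add: open_prob_def algebra_simps flip: exp_add)
  \<comment> \<open>The factors inserted for the closed edges equal 1; they make the prefactor a
    product over all edges, independent of A.\<close>
  also have "\<dots> = (\<Prod>e\<in>A. exp (2 * Jb J \<beta> e) * open_prob e) * (\<Prod>e\<in>?E - A. exp (2 * Jb J \<beta> e) * (1 - open_prob e))"
    by (simp add: open_prob_def flip: exp_add)
  also have "\<dots> = (\<Prod>e\<in>?E. exp (2 * Jb J \<beta> e)) * ((\<Prod>e\<in>A. open_prob e) * (\<Prod>e\<in>?E - A. 1 - open_prob e))"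
    unfolding prod.distrib using prod.subset_diff[OF A, of "\<lambda>e. exp (2 * Jb J \<beta> e)"] by simp
  finally show ?thesis by simp
qed

lemma sum_edge_configs:
  "(\<Sum>\<omega>\<in>edge_configs N. fk_weight J \<beta> N \<omega> * F \<omega>) =
   (\<Prod>e\<in>edges (int_box N). exp (2 * Jb J \<beta> e)) * bern (edges (int_box N)) open_prob (\<lambda>A. F (ind A) * nagree (int_box N) A)"
proof -
  have "(\<Sum>\<omega>\<in>edge_configs N. fk_weight J \<beta> N \<omega> * F \<omega>) = (\<Sum>A\<in>Pow (edges (int_box N)). fk_weight J \<beta> N (ind A) * F (ind A))"
    unfolding edge_configs_eq by (subst sum.reindex[OF inj_ind]) simp
  also have "\<dots> = (\<Sum>A\<in>Pow (edges (int_box N)). (\<Prod>e\<in>edges (int_box N). exp (2 * Jb J \<beta> e)) *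
    ((\<Prod>e\<in>A. open_prob e) * (\<Prod>e\<in>edges (int_box N) - A. 1 - open_prob e) * (F (ind A) * nagree (int_box N) A)))"
    by (intro sum.cong refl) (simp add: fk_weight_ind)
  finally show ?thesis by (simp add: bern_def sum_distrib_left)
qed

definition fk_avg :: "nat \<Rightarrow> ((int \<times> int \<Rightarrow> real) \<Rightarrow> real) \<Rightarrow> real" where
  "fk_avg N F = (\<Sum>\<omega>\<in>edge_configs N. fk_weight J \<beta> N \<omega> / (\<Sum>\<omega>\<in>edge_configs N. fk_weight J \<beta> N \<omega>) * F \<omega>)"

lemma fk_Z: "(\<Sum>\<omega>\<in>edge_configs N. fk_weight J \<beta> N \<omega>) = (\<Prod>e\<in>edges (int_box N). exp (2 * Jb J \<beta> e)) * bern (edges (int_box N)) open_prob (nagree (int_box N))"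
  using sum_edge_configs[of N "\<lambda>_. 1"] by simp

lemma fk_Z_pos: "0 < (\<Sum>\<omega>\<in>edge_configs N. fk_weight J \<beta> N \<omega>)"
  unfolding fk_Z by (intro mult_pos_pos prod_pos Z_bern(2)) auto

lemma fk_avg_eq_bern:
  "fk_avg N F = bern (edges (int_box N)) open_prob (\<lambda>A. F (ind A) * nagree (int_box N) A) / bern (edges (int_box N)) open_prob (nagree (int_box N))"
proof -
  have "fk_avg N F = (\<Sum>\<omega>\<in>edge_configs N. fk_weight J \<beta> N \<omega> * F \<omega>) / (\<Sum>\<omega>\<in>edge_configs N. fk_weight J \<beta> N \<omega>)"
    by (simp add: fk_avg_def sum_divide_distrib)
  also have "\<dots> = bern (edges (int_box N)) open_prob (\<lambda>A. F (ind A) * nagree (int_box N) A) / bern (edges (int_box N)) open_prob (nagree (int_box N))"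
    unfolding sum_edge_configs fk_Z by (simp add: prod_zero_iff)
  finally show ?thesis .
qed

lemma fk_avg_connected:
  assumes "x \<in> int_box N"
  shows "fk_avg N (\<lambda>\<omega>. of_bool ((x, y) \<in> (open_rel \<omega>)\<^sup>*)) = corr J \<beta> (int_box N) x y"
proof -
  have "bern (edges (int_box N)) open_prob (\<lambda>A. of_bool ((x, y) \<in> (open_rel (ind A))\<^sup>*) * nagree (int_box N) A) =
    bern (edges (int_box N)) open_prob (\<lambda>A. of_bool ((x, y) \<in> (adj A)\<^sup>*) * nagree (int_box N) A)"
    unfolding bern_def by (intro sum.cong refl) (simp add: open_rel_ind)
  then show ?thesis unfolding fk_avg_eq_bern corr_eq_bern[OF finite_int_box assms] by simp
qed

lemma fk_avg_open:
  assumes "finite D" "D \<subseteq> edges (int_box N)"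
  shows "fk_avg N (\<lambda>\<omega>. \<Prod>e\<in>D. \<omega> e) = gibbs (int_box N) (free_w J \<beta> (int_box N)) (\<lambda>\<sigma>. (\<Prod>e\<in>D. open_prob e) * of_bool (agree D \<sigma>))"
proof -
  have "(\<Prod>e\<in>D. ind A e) = of_bool (D \<subseteq> A)" for A :: "(int \<times> int) set"
    using assms(1) by (induction D rule: finite_induct) (auto simp: ind_def)
  then show ?thesis unfolding fk_avg_eq_bern edges_open_bern[OF finite_int_box assms(2)] by simp
qed

text \<open>By \<open>fk_avg_open\<close> the averages are expectations of one cone function in
  growing free volumes, hence eventually increasing, and bounded by 1.\<close>

lemma fk_avg_open_convergent:
  assumes D: "finite D" shows "convergent (\<lambda>N. fk_avg N (\<lambda>\<omega>. \<Prod>e\<in>D. \<omega> e))"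
proof (cases "D \<subseteq> edges UNIV")
  case True
  obtain N0 where "fst ` D \<union> snd ` D \<subseteq> int_box N0"
    using finite_subset_int_box[of "fst ` D \<union> snd ` D"] D by auto
  then have D0: "D \<subseteq> edges (int_box N0)" using True by (auto simp: edges_def image_subset_iff)
  have D0: "D \<subseteq> edges (int_box N)" if "N0 \<le> N" for N
    using D0 edges_mono[OF int_box_mono[OF that]] by auto
  let ?g = "\<lambda>\<sigma>. (\<Prod>e\<in>D. open_prob e) * of_bool (agree D \<sigma>)"
  let ?s = "\<lambda>N. gibbs (int_box (N + N0)) (free_w J \<beta> (int_box (N + N0))) ?g"
  have g: "gcone W ?g" for W
    using open_prob_bounds by (intro gcone.scale gcone_agree D prod_nonneg) auto
  have "convergent ?s"
  proof (rule Bseq_mono_convergent)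
    have p: "0 \<le> (\<Prod>e\<in>D. open_prob e)" "(\<Prod>e\<in>D. open_prob e) \<le> 1" using open_prob_bounds by (auto intro!: prod_nonneg prod_le_1)
    have "\<bar>?s N\<bar> \<le> 1" for N by (intro gibbs_abs_le ferro_free_w) (use p in auto)
    then show "Bseq ?s" by (intro BseqI'[of _ 1]) auto
    show "\<forall>m n. m \<le> n \<longrightarrow> ?s m \<le> ?s n"
    proof (intro allI impI gibbs_free_w_mono int_box_mono g)
      fix m and \<sigma> \<tau> :: "int \<Rightarrow> real" assume "\<And>i. i \<in> int_box (m + N0) \<Longrightarrow> \<sigma> i = \<tau> i"
      then have "agree D \<sigma> = agree D \<tau>" using D0[of "m + N0"] by (fastforce simp: agree_def edges_def)
      then show "?g \<sigma> = ?g \<tau>" by simp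
    qed auto
  qed
  moreover have "?s = (\<lambda>N. fk_avg (N + N0) (\<lambda>\<omega>. \<Prod>e\<in>D. \<omega> e))"
    using D D0 by (simp add: fk_avg_open)
  ultimately show ?thesis using convergent_ignore_initial_segment[of "\<lambda>N. fk_avg N (\<lambda>\<omega>. \<Prod>e\<in>D. \<omega> e)" N0] by simp
next
  case False
  \<comment> \<open>The index type contains all ordered pairs; one that is not increasing is never
    an edge and its coordinate is always 0.\<close>
  then obtain e where e: "e \<in> D" "e \<notin> edges UNIV" by auto
  then have ne: "e \<notin> edges (int_box N)" for N using edges_mono[of "int_box N" UNIV] by auto
  have "(\<Prod>e\<in>D. \<omega> e) = 0" if "\<omega> \<in> edge_configs N" for \<omega> N
  proof -
    have "\<omega> e = 0" using that ne unfolding edge_configs_def by blast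
    then show ?thesis using e(1) by (intro prod_zero D) auto
  qed
  then have "fk_avg N (\<lambda>\<omega>. \<Prod>e\<in>D. \<omega> e) = 0" for N
    unfolding fk_avg_def by (intro sum.neutral ballI) simp
  then show ?thesis by (simp add: convergent_const)
qed

lemma finite_edge_configs [simp]: "finite (edge_configs N)"
  unfolding edge_configs_eq by simp

lemma fk_weight_nonneg: "\<omega> \<in> edge_configs N \<Longrightarrow> 0 \<le> fk_weight J \<beta> N \<omega>"
  unfolding fk_weight_def using J_nonneg beta by (intro mult_nonneg_nonneg prod_nonneg) auto

interpretation F: two_valued_limit edge_configs
  "\<lambda>N \<omega>. fk_weight J \<beta> N \<omega> / (\<Sum>\<omega>\<in>edge_configs N. fk_weight J \<beta> N \<omega>)" 0 1
proof
  show "s i = 0 \<or> s i = 1" if "s \<in> edge_configs N" for s i N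
    using that unfolding edge_configs_def by blast
  show "(\<Sum>s\<in>edge_configs N. fk_weight J \<beta> N s / (\<Sum>\<omega>\<in>edge_configs N. fk_weight J \<beta> N \<omega>)) = 1" for N
    using fk_Z_pos[of N] by (simp add: sum_divide_distrib[symmetric])
  show "convergent (\<lambda>N. \<Sum>s\<in>edge_configs N. fk_weight J \<beta> N s / (\<Sum>\<omega>\<in>edge_configs N. fk_weight J \<beta> N \<omega>) * (\<Prod>i\<in>A. s i))"
    if "finite A" for A
    using fk_avg_open_convergent[OF that] by (simp only: fk_avg_def)
qed (use fk_Z_pos fk_weight_nonneg in \<open>auto intro!: divide_nonneg_pos\<close>)

lemma F_avg: "F.avg = fk_avg"
  by (simp add: F.avg_def fk_avg_def fun_eq_iff)

lemma fk_eq: "fk J \<beta> = F.PP.lim"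
  unfolding fk_def
proof (rule F.weak_limit_eq)
  fix N and f :: "(int \<times> int \<Rightarrow> real) \<Rightarrow> real" assume f: "f \<in> borel_measurable borel"
  show "(\<integral>x. f x \<partial>fk_finite J \<beta> N) = F.avg N f"
    unfolding fk_finite_def F.avg_def by (intro integral_weighted_measure f fk_weight_nonneg) auto
qed

text \<open>Connections inside a fixed box depend on finitely many edges, so the weak limit does
  give their probabilities; they exhaust \<open>connected_event\<close> as the box grows.\<close>

definition conn_box :: "nat \<Rightarrow> int \<Rightarrow> (int \<times> int \<Rightarrow> real) set" where
  "conn_box k x = {\<omega>. (0, x) \<in> (open_rel \<omega> \<inter> int_box k \<times> int_box k)\<^sup>*}"

lemma conn_box_local:
  assumes "\<And>e. e \<in> edges (int_box k) \<Longrightarrow> \<omega> e = \<omega>' e"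
  shows "\<omega> \<in> conn_box k x \<longleftrightarrow> \<omega>' \<in> conn_box k x"
proof -
  have "open_rel \<omega> \<inter> int_box k \<times> int_box k = open_rel \<omega>' \<inter> int_box k \<times> int_box k"
  proof -
    have "\<omega> (min i j, max i j) = \<omega>' (min i j, max i j)" if "i \<noteq> j" "i \<in> int_box k" "j \<in> int_box k" for i j
      using that by (intro assms) (auto simp: edges_def min_def max_def)
    then show ?thesis by (auto simp: open_rel_def)
  qed
  then show ?thesis by (simp add: conn_box_def)
qed

lemma conn_box_measurable: "conn_box k x \<in> sets borel"
proof -
  let ?E = "edges (int_box k)"
  let ?P = "\<lambda>A. {\<omega> :: int \<times> int \<Rightarrow> real. \<forall>e\<in>?E. \<omega> e = 1 \<longleftrightarrow> e \<in> A}"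
  have eq: "conn_box k x = (\<Union>A\<in>{A \<in> Pow ?E. ind A \<in> conn_box k x}. ?P A)"
  proof (intro equalityI subsetI)
    fix \<omega> assume w: "\<omega> \<in> conn_box k x"
    let ?A = "{e \<in> ?E. \<omega> e = 1}"
    have "open_rel (ind ?A) \<inter> int_box k \<times> int_box k = open_rel \<omega> \<inter> int_box k \<times> int_box k"
      by (auto simp: open_rel_def ind_def edges_def min_def max_def split: if_splits)
    then have "ind ?A \<in> conn_box k x" using w by (simp add: conn_box_def)
    then show "\<omega> \<in> (\<Union>A\<in>{A \<in> Pow ?E. ind A \<in> conn_box k x}. ?P A)" by (intro UN_I[of ?A]) auto
  next
    fix \<omega> assume "\<omega> \<in> (\<Union>A\<in>{A \<in> Pow ?E. ind A \<in> conn_box k x}. ?P A)"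
    then obtain A where A: "A \<subseteq> ?E" "ind A \<in> conn_box k x" "\<omega> \<in> ?P A" by auto
    have "open_rel (ind A) \<inter> int_box k \<times> int_box k = open_rel \<omega> \<inter> int_box k \<times> int_box k"
    proof -
      have "ind A (min i j, max i j) = 1 \<longleftrightarrow> \<omega> (min i j, max i j) = 1" if "i \<noteq> j" "i \<in> int_box k" "j \<in> int_box k" for i j
      proof -
        have "(min i j, max i j) \<in> ?E" using that by (auto simp: edges_def min_def max_def)
        then show ?thesis using A(3) by (auto simp: ind_def)
      qed
      then show ?thesis by (auto simp: open_rel_def)
    qed
    then show "\<omega> \<in> conn_box k x" using A(2) by (simp add: conn_box_def)
  qed
  have c: "(\<lambda>\<omega> :: int \<times> int \<Rightarrow> real. \<omega> e) \<in> borel_measurable borel" for e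
    by (intro borel_measurable_continuous_onI continuous_on_product_coordinates)
  have "?P A \<in> sets borel" for A
  proof -
    have "{\<omega> \<in> space borel. \<omega> e = (1::real) \<longleftrightarrow> e \<in> A} \<in> sets borel" for e :: "int \<times> int"
    proof -
      have "{\<omega> \<in> space borel. \<omega> e = (1::real) \<longleftrightarrow> e \<in> A} = (\<lambda>\<omega>. \<omega> e) -` (if e \<in> A then {1} else - {1}) \<inter> space borel"
        by auto
      also have "\<dots> \<in> sets borel" by (rule measurable_sets[OF c]) (auto intro: borel_comp)
      finally show ?thesis .
    qed
    then have "{\<omega> \<in> space borel. \<forall>e\<in>?E. \<omega> e = (1::real) \<longleftrightarrow> e \<in> A} \<in> sets borel"
      by (intro sets.sets_Collect_finite_All) auto
    then show ?thesis by simp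
  qed
  then show ?thesis by (subst eq) (intro sets.finite_UN; simp)
qed

lemma connected_event_eq: "connected_event 0 x = (\<Union>k. conn_box k x)"
proof (intro equalityI subsetI)
  fix \<omega> assume "\<omega> \<in> connected_event 0 x"
  then have "(0, x) \<in> (open_rel \<omega>)\<^sup>*" by (simp add: connected_event_def)
  then have "\<exists>k. (0, x) \<in> (open_rel \<omega> \<inter> int_box k \<times> int_box k)\<^sup>*"
  proof (induction rule: rtrancl_induct)
    case (step y z)
    then obtain k where k: "(0, y) \<in> (open_rel \<omega> \<inter> int_box k \<times> int_box k)\<^sup>*" by auto
    let ?m = "max k (max (nat \<bar>y\<bar>) (nat \<bar>z\<bar>))"
    have "(0, y) \<in> (open_rel \<omega> \<inter> int_box ?m \<times> int_box ?m)\<^sup>*"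
      using k by (rule rtrancl_mono[THEN subsetD, rotated]) (auto simp: mem_int_box)
    moreover have "(y, z) \<in> open_rel \<omega> \<inter> int_box ?m \<times> int_box ?m" using step by (auto simp: mem_int_box)
    ultimately show ?case by (meson rtrancl.rtrancl_into_rtrancl)
  qed auto
  then show "\<omega> \<in> (\<Union>k. conn_box k x)" by (auto simp: conn_box_def)
next
  fix \<omega> assume "\<omega> \<in> (\<Union>k. conn_box k x)"
  then obtain k where "(0, x) \<in> (open_rel \<omega> \<inter> int_box k \<times> int_box k)\<^sup>*" by (auto simp: conn_box_def)
  then show "\<omega> \<in> connected_event 0 x"
    unfolding connected_event_def mem_Collect_eq by (rule rtrancl_mono[THEN subsetD, rotated]) auto
qed

lemma conn_box_incseq: "incseq (\<lambda>k. conn_box k x)"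
proof (rule incseq_SucI, rule subsetI)
  fix k \<omega> assume "\<omega> \<in> conn_box k x"
  then show "\<omega> \<in> conn_box (Suc k) x"
    unfolding conn_box_def mem_Collect_eq by (rule rtrancl_mono[THEN subsetD, rotated]) (auto simp: mem_int_box)
qed

lemma measure_conn_box:
  "(\<lambda>N. fk_avg N (\<lambda>\<omega>. of_bool (\<omega> \<in> conn_box k x))) \<longlonglongrightarrow> measure (fk J \<beta>) (conn_box k x)"
proof -
  have i: "(\<lambda>\<omega>. of_bool (\<omega> \<in> conn_box k x)) = indicat_real (conn_box k x)" by (auto simp: fun_eq_iff)
  have "(\<lambda>N. F.avg N (\<lambda>\<omega>. of_bool (\<omega> \<in> conn_box k x))) \<longlonglongrightarrow> (\<integral>\<omega>. of_bool (\<omega> \<in> conn_box k x) \<partial>F.PP.lim)"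
  proof (rule F.avg_local_integral)
    show "of_bool (\<omega> \<in> conn_box k x) = (of_bool (\<omega>' \<in> conn_box k x) :: real)"
      if "\<And>e. e \<in> edges (int_box k) \<Longrightarrow> \<omega> e = \<omega>' e" for \<omega> \<omega>' :: "int \<times> int \<Rightarrow> real"
      using conn_box_local[OF that] by simp
    show "(\<lambda>\<omega>. of_bool (\<omega> \<in> conn_box k x) :: real) \<in> borel_measurable borel"
      unfolding i by (intro borel_measurable_indicator conn_box_measurable)
  qed simp
  also have "(\<integral>\<omega>. of_bool (\<omega> \<in> conn_box k x) \<partial>F.PP.lim) = measure F.PP.lim (conn_box k x)"
    unfolding i using conn_box_measurable by simp
  finally show ?thesis by (simp only: F_avg fk_eq)
qed

lemma fk_avg_mono:
  assumes "\<And>\<omega>. \<omega> \<in> edge_configs N \<Longrightarrow> f \<omega> \<le> g \<omega>" shows "fk_avg N f \<le> fk_avg N g"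
  unfolding fk_avg_def using fk_Z_pos[of N] assms fk_weight_nonneg
  by (intro sum_mono mult_left_mono divide_nonneg_pos) auto

lemma fk_avg_add: "fk_avg N (\<lambda>\<omega>. f \<omega> + g \<omega>) = fk_avg N f + fk_avg N g"
  by (simp add: fk_avg_def distrib_left sum.distrib)

lemma fk_avg_sum: "fk_avg N (\<lambda>\<omega>. \<Sum>k\<in>K. f k \<omega>) = (\<Sum>k\<in>K. fk_avg N (f k))"
  unfolding fk_avg_def sum_distrib_left by (rule sum.swap)

lemma leave_box:
  assumes "(0, z) \<in> R\<^sup>*"
  shows "(0, z) \<in> (R \<inter> int_box k \<times> int_box k)\<^sup>* \<or> (\<exists>y. y \<notin> int_box k \<and> (0, y) \<in> R\<^sup>*)"
  using assms
proof (induction rule: rtrancl_induct)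
  case (step y z)
  show ?case
  proof (cases "y \<in> int_box k \<and> z \<in> int_box k")
    case True
    then show ?thesis using step by (auto intro: rtrancl_into_rtrancl)
  next
    case False
    then show ?thesis using step.hyps by (meson rtrancl.rtrancl_into_rtrancl)
  qed
qed auto

text \<open>A connection that cannot be made inside box k joins 0 to some y outside it; a union
  bound over y leaves a tail of the two-point function, whatever the size of the outer
  volume.\<close>

lemma fk_avg_conn_box_ge:
  "corr J \<beta> (int_box N) 0 x - (\<Sum>y\<in>int_box N - int_box k. corr_inf J \<beta> y) \<le> fk_avg N (\<lambda>\<omega>. of_bool (\<omega> \<in> conn_box k x))"
proof -
  let ?c = "\<lambda>y \<omega>. of_bool ((0, y) \<in> (open_rel \<omega>)\<^sup>*) :: real"
  have z: "0 \<in> int_box N" by (simp add: mem_int_box)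
  have "corr J \<beta> (int_box N) 0 x = fk_avg N (?c x)" by (rule fk_avg_connected[OF z, symmetric])
  also have "\<dots> \<le> fk_avg N (\<lambda>\<omega>. of_bool (\<omega> \<in> conn_box k x) + (\<Sum>y\<in>int_box N - int_box k. ?c y \<omega>))"
  proof (rule fk_avg_mono)
    fix \<omega> assume "\<omega> \<in> edge_configs N"
    then obtain A where A: "A \<subseteq> edges (int_box N)" "\<omega> = ind A" by (auto simp: edge_configs_eq)
    show "?c x \<omega> \<le> of_bool (\<omega> \<in> conn_box k x) + (\<Sum>y\<in>int_box N - int_box k. ?c y \<omega>)"
    proof (cases "(0, x) \<in> (open_rel \<omega>)\<^sup>* \<and> \<omega> \<notin> conn_box k x")
      case True
      then obtain y where y: "y \<notin> int_box k" "(0, y) \<in> (open_rel \<omega>)\<^sup>*"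
        using leave_box[of x "open_rel \<omega>" k] by (auto simp: conn_box_def)
      have "y \<in> int_box N"
        using cluster_subset[of A "int_box N" 0] y(2) A(1) z unfolding A(2) open_rel_ind[OF A(1)]
        by (auto simp: edges_def)
      then have "?c y \<omega> \<le> (\<Sum>y\<in>int_box N - int_box k. ?c y \<omega>)" using y(1) by (intro member_le_sum) auto
      then show ?thesis using y True by simp
    next
      case False
      then show ?thesis by (auto intro!: add_increasing2 sum_nonneg)
    qed
  qed
  also have "\<dots> = fk_avg N (\<lambda>\<omega>. of_bool (\<omega> \<in> conn_box k x)) + (\<Sum>y\<in>int_box N - int_box k. corr J \<beta> (int_box N) 0 y)"
    unfolding fk_avg_add fk_avg_sum fk_avg_connected[OF z] ..
  also have "\<dots> \<le> fk_avg N (\<lambda>\<omega>. of_bool (\<omega> \<in> conn_box k x)) + (\<Sum>y\<in>int_box N - int_box k. corr_inf J \<beta> y)"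
    by (intro add_left_mono sum_mono corr_box_le_corr_inf)
  finally show ?thesis by simp
qed

text \<open>The limit of the volumes and the limit of the boxes \<open>int_box k\<close> have to be
  exchanged. The error is at most the tail \<open>l - a k\<close> of a convergent series, uniformly
  in the volume.\<close>

theorem measure_connected:
  assumes bd: "\<And>k. (\<Sum>y\<in>int_box k. corr_inf J \<beta> y) \<le> B"
  shows "measure (fk J \<beta>) (connected_event 0 x) = corr_inf J \<beta> x"
proof -
  interpret fk: prob_space "fk J \<beta>" unfolding fk_eq by (rule F.PP.P.prob_space_axioms)
  have sets: "sets (fk J \<beta>) = sets borel" unfolding fk_eq by simp
  define a where "a k = (\<Sum>y\<in>int_box k. corr_inf J \<beta> y)" for k
  have inc: "incseq a"
    unfolding a_def incseq_def by (intro allI impI sum_mono2 int_box_mono) (auto simp: corr_inf_nonneg)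
  obtain l where l: "a \<longlonglongrightarrow> l" "\<And>k. a k \<le> l"
    using incseq_convergent[OF inc, of B] bd by (auto simp: a_def)
  have up: "measure (fk J \<beta>) (conn_box k x) \<le> corr_inf J \<beta> x" for k
  proof (rule LIMSEQ_le_const2[OF measure_conn_box], intro exI allI impI)
    fix N
    have "fk_avg N (\<lambda>\<omega>. of_bool (\<omega> \<in> conn_box k x)) \<le> fk_avg N (\<lambda>\<omega>. of_bool ((0, x) \<in> (open_rel \<omega>)\<^sup>*))"
    proof (rule fk_avg_mono)
      fix \<omega>
      have "\<omega> \<in> conn_box k x \<Longrightarrow> (0, x) \<in> (open_rel \<omega>)\<^sup>*"
        unfolding conn_box_def mem_Collect_eq by (rule rtrancl_mono[THEN subsetD, rotated]) auto
      then show "of_bool (\<omega> \<in> conn_box k x) \<le> (of_bool ((0, x) \<in> (open_rel \<omega>)\<^sup>*) :: real)" by auto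
    qed
    also have "\<dots> = corr J \<beta> (int_box N) 0 x" by (rule fk_avg_connected) (simp add: mem_int_box)
    also have "\<dots> \<le> corr_inf J \<beta> x" by (rule corr_box_le_corr_inf)
    finally show "fk_avg N (\<lambda>\<omega>. of_bool (\<omega> \<in> conn_box k x)) \<le> corr_inf J \<beta> x" .
  qed
  have low: "corr_inf J \<beta> x - (l - a k) \<le> measure (fk J \<beta>) (conn_box k x)" for k
  proof (rule LIMSEQ_le[OF _ measure_conn_box])
    show "(\<lambda>N. corr J \<beta> (int_box N) 0 x - (l - a k)) \<longlonglongrightarrow> corr_inf J \<beta> x - (l - a k)"
      by (intro tendsto_intros corr_tendsto_corr_inf)
    show "\<exists>N. \<forall>n\<ge>N. corr J \<beta> (int_box n) 0 x - (l - a k) \<le> fk_avg n (\<lambda>\<omega>. of_bool (\<omega> \<in> conn_box k x))"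
    proof (intro exI allI impI)
      fix n assume "k \<le> n"
      then have "(\<Sum>y\<in>int_box n - int_box k. corr_inf J \<beta> y) = a n - a k"
        unfolding a_def by (intro sum_diff int_box_mono) auto
      then show "corr J \<beta> (int_box n) 0 x - (l - a k) \<le> fk_avg n (\<lambda>\<omega>. of_bool (\<omega> \<in> conn_box k x))"
        using fk_avg_conn_box_ge[of n x k] l(2)[of n] by linarith
    qed
  qed
  have lim: "(\<lambda>k. measure (fk J \<beta>) (conn_box k x)) \<longlonglongrightarrow> measure (fk J \<beta>) (connected_event 0 x)"
    unfolding connected_event_eq
    by (intro fk.finite_Lim_measure_incseq conn_box_incseq) (auto simp: sets conn_box_measurable)
  have "(\<lambda>k. corr_inf J \<beta> x - (l - a k)) \<longlonglongrightarrow> corr_inf J \<beta> x - (l - l)" by (intro tendsto_intros l)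
  then have "corr_inf J \<beta> x - (l - l) \<le> measure (fk J \<beta>) (connected_event 0 x)"
    by (rule LIMSEQ_le[OF _ lim]) (use low in auto)
  moreover have "measure (fk J \<beta>) (connected_event 0 x) \<le> corr_inf J \<beta> x"
    by (rule LIMSEQ_le_const2[OF lim]) (use up in auto)
  ultimately show ?thesis by simp
qed

end

section \<open>Saturation\<close>

lemma fekete:
  fixes u :: "nat \<Rightarrow> real"
  assumes nn: "\<And>n. 0 \<le> u n" and sub: "\<And>m n. u (m + n) \<le> u m + u n"
  shows "\<exists>l. (\<lambda>n. u n / n) \<longlonglongrightarrow> l \<and> (\<forall>n>0. l \<le> u n / n)"
proof -
  define l where "l = (INF n\<in>{0<..}. u n / real n)"
  have bdd: "bdd_below ((\<lambda>n. u n / real n) ` {0<..})" by (rule bdd_belowI2[where m = 0]) (simp add: nn)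
  have low: "l \<le> u n / n" if "0 < n" for n
    unfolding l_def using that by (intro cINF_lower bdd) auto
  have mult: "u (q * m) \<le> real q * u m" if "0 < q" for q m
    using that
  proof (induction q rule: nat_induct_non_zero)
    case (Suc q)
    have "u (Suc q * m) \<le> u m + u (q * m)" using sub[of m "q * m"] by simp
    then show ?case using Suc.IH by (simp add: algebra_simps)
  qed simp
  have "(\<lambda>n. u n / n) \<longlonglongrightarrow> l"
  proof (rule LIMSEQ_I)
    fix e :: real assume e: "0 < e"
    have "\<not> (\<forall>m\<in>{0<..}. l + e / 2 \<le> u m / real m)"
    proof
      assume "\<forall>m\<in>{0<..}. l + e / 2 \<le> u m / real m"
      then have "l + e / 2 \<le> l" unfolding l_def by (intro cINF_greatest) auto
      then show False using e by simp
    qed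
    then obtain m where m: "0 < m" "u m / real m < l + e / 2" by (auto simp: not_le)
    define B where "B = (\<Sum>r<m. u r)"
    have B: "u r \<le> B" if "r < m" for r
      unfolding B_def using that by (intro member_le_sum) (auto simp: nn)
    obtain N where N: "2 * B / e < real N" using reals_Archimedean2 by blast
    show "\<exists>no. \<forall>n\<ge>no. norm (u n / n - l) < e"
    proof (intro exI allI impI)
      fix n assume n: "N + m \<le> n"
      then have n0: "0 < n" "2 * B / e < real n" using m N by auto
      have q: "0 < n div m" using n m by (simp add: div_greater_zero_iff)
      have "u n = u (n div m * m + n mod m)" by simp
      also have "\<dots> \<le> u (n div m * m) + u (n mod m)" by (rule sub)
      also have "\<dots> \<le> real (n div m) * u m + B" using mult[OF q] B[of "n mod m"] m by (intro add_mono) auto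
      also have "real (n div m) * u m = real (n div m * m) * (u m / m)" using m by simp
      also have "\<dots> \<le> real n * (u m / m)"
        using nn by (intro mult_right_mono) (auto simp del: of_nat_mult simp: div_times_less_eq_dividend)
      finally have "u n / n \<le> u m / m + B / n" using n0 by (simp add: field_simps)
      moreover have "B / n < e / 2" using n0 e by (simp add: field_simps)
      ultimately have "u n / n < l + e" using m(2) by linarith
      then show "norm (u n / n - l) < e" using low[OF n0(1)] by simp
    qed
  qed
  then show ?thesis using low by blast
qed

text \<open>Linear near 0 and valid for all nonnegative t: in \<open>B_of_lieb_sum\<close> it keeps
  the factor \<open>J n\<close>, and in \<open>bdd_B\<close> its approach to 1 bounds
  \<beta>.\<close>

lemma tanh_ge: 
  assumes "0 \<le> t" shows "t / (1 + t) \<le> tanh (t::real)"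
proof -
  have e: "1 + 2 * t \<le> exp (2 * t)" by (rule exp_ge_add_one_self)
  have "tanh t = (exp (2 * t) - 1) / (exp (2 * t) + 1)"
  proof -
    have "tanh t = (1 - exp (- 2 * t)) / (1 + exp (- 2 * t))" by (rule tanh_real_altdef)
    also have "\<dots> = (exp (2 * t) * (1 - exp (- 2 * t))) / (exp (2 * t) * (1 + exp (- 2 * t)))" by simp
    also have "\<dots> = (exp (2 * t) - 1) / (exp (2 * t) + 1)" by (simp add: right_diff_distrib distrib_left flip: exp_add)
    finally show ?thesis .
  qed
  moreover have "t / (1 + t) \<le> (E - 1) / (E + 1)" if "1 + 2 * t \<le> E" for E :: real
  proof -
    have "t * (E + 1) \<le> (E - 1) * (1 + t)" using that by (simp add: algebra_simps)
    moreover have "0 < 1 + t" "0 < E + 1" using assms that by auto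
    ultimately show ?thesis by (simp add: divide_le_eq le_divide_eq)
  qed
  note this[OF e]
  ultimately show ?thesis by simp
qed

text \<open>What is used of both forms of \<psi>: the first moment bounds fields, cuts and tilted
  sums, and \<open>psi_subexp\<close> ensures that a single direct coupling already decays with rate
  c.\<close>

locale saturation =
  fixes \<rho> :: "real \<Rightarrow> real" and \<psi> :: "int \<Rightarrow> real" and c :: real
  assumes rho: "\<And>x. \<rho> (of_int x) = c * \<bar>real_of_int x\<bar>" and c: "0 < c"
    and psi_pos: "\<And>x. x \<noteq> 0 \<Longrightarrow> 0 < \<psi> x" and psi_even: "\<And>x. \<psi> (- x) = \<psi> x"
    and psi_sum: "summable (\<lambda>r. real r * \<psi> (int r))"
    and psi_subexp: "(\<lambda>n. ln (\<psi> (int n)) / real n) \<longlonglongrightarrow> 0"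
begin

abbreviation "J \<equiv> coupling \<psi> \<rho>"

lemma J_eq: "x \<noteq> 0 \<Longrightarrow> J x = \<psi> x * exp (- c * \<bar>real_of_int x\<bar>)"
  by (simp add: coupling_def rho)

lemma J_0 [simp]: "J 0 = 0" by (simp add: coupling_def)

lemma J_pos: "x \<noteq> 0 \<Longrightarrow> 0 < J x"
  by (simp add: J_eq psi_pos)

lemma ising_J:
  assumes "0 \<le> \<beta>" shows "ising J \<beta>"
proof
  show "0 \<le> J x" for x using J_pos[of x] by (cases "x = 0") auto
  show "J (- x) = J x" for x by (cases "x = 0") (auto simp: J_eq psi_even)
qed (fact assms)

lemma J_le_psi: "x \<noteq> 0 \<Longrightarrow> J x \<le> \<psi> x"
  using c psi_pos[of x] by (simp add: J_eq mult_le_cancel_left1)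

lemma sumJ: "summable (\<lambda>r. real r * J (int r))"
proof (rule summable_comparison_test'[OF psi_sum, of 1])
  fix r :: nat assume "1 \<le> r"
  then show "norm (real r * J (int r)) \<le> real r * \<psi> (int r)"
    using J_le_psi[of "int r"] J_pos[of "int r"] by (simp add: mult_left_mono)
qed

section \<open>Tails of the prefactor and the tilted Lieb sum\<close>

definition H :: real where "H = (\<Sum>r. real r * \<psi> (int r))"

lemma psi_r_nonneg: "0 \<le> real r * \<psi> (int r)"
  using psi_pos[of "int r"] by (cases "r = 0") auto

lemma H_nonneg: "0 \<le> H"
  unfolding H_def by (intro suminf_nonneg psi_sum psi_r_nonneg)

lemma summable_psi: "summable (\<lambda>r. \<psi> (int (r + Suc m)))"
proof (rule summable_comparison_test'[OF summable_ignore_initial_segment[OF psi_sum, of "Suc m"], of 0])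
  fix r
  have "1 * \<psi> (int (r + Suc m)) \<le> real (r + Suc m) * \<psi> (int (r + Suc m))"
    using psi_pos[of "int (r + Suc m)"] by (intro mult_right_mono) auto
  moreover have "0 < \<psi> (int (r + Suc m))" by (rule psi_pos) auto
  ultimately show "norm (\<psi> (int (r + Suc m))) \<le> real (r + Suc m) * \<psi> (int (r + Suc m))" by simp
qed

definition Psi :: "nat \<Rightarrow> real" where "Psi m = (\<Sum>r. \<psi> (int (r + Suc m)))"

lemma Psi_nonneg: "0 \<le> Psi m"
  unfolding Psi_def by (intro suminf_nonneg summable_psi less_imp_le psi_pos) auto

lemma sum_psi_le_Psi:
  assumes "finite R" "\<And>r. r \<in> R \<Longrightarrow> m < r" shows "(\<Sum>r\<in>R. \<psi> (int r)) \<le> Psi m"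
proof -
  have "(\<Sum>r\<in>R. \<psi> (int r)) = (\<Sum>r\<in>(\<lambda>r. r - Suc m) ` R. \<psi> (int (r + Suc m)))"
  proof -
    have s: "r - Suc m + Suc m = r" if "r \<in> R" for r using assms(2)[OF that] by simp
    then have "inj_on (\<lambda>r. r - Suc m) R" by (intro inj_on_inverseI[where g = "\<lambda>r. r + Suc m"])
    then show ?thesis by (simp only: sum.reindex o_def s cong: sum.cong)
  qed
  also have "\<dots> \<le> Psi m"
    unfolding Psi_def using assms(1) by (intro sum_le_suminf summable_psi) (auto intro!: less_imp_le psi_pos)
  finally show ?thesis .
qed

text \<open>\<psi>(s) occurs in the tail beyond m exactly for m < s, that is s times in all, so the
  tails add up to the first moment.\<close>

lemma sum_Psi_le: "(\<Sum>m<M. Psi m) \<le> H"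
proof (rule LIMSEQ_le_const2)
  show "(\<lambda>R. \<Sum>m<M. \<Sum>r<R. \<psi> (int (r + Suc m))) \<longlonglongrightarrow> (\<Sum>m<M. Psi m)"
    unfolding Psi_def by (intro tendsto_sum summable_LIMSEQ summable_psi)
  show "\<exists>N. \<forall>R\<ge>N. (\<Sum>m<M. \<Sum>r<R. \<psi> (int (r + Suc m))) \<le> H"
  proof (intro exI allI impI)
    fix R :: nat
    let ?Q = "(\<lambda>(m, r). (r + Suc m, m)) ` ({..<M} \<times> {..<R})"
    have "(\<Sum>m<M. \<Sum>r<R. \<psi> (int (r + Suc m))) = (\<Sum>(m, r)\<in>{..<M} \<times> {..<R}. \<psi> (int (r + Suc m)))"
      by (rule sum.cartesian_product)
    note e = this
    have "inj_on (\<lambda>(m, r). (r + Suc m, m)) ({..<M} \<times> {..<R})" by (auto simp: inj_on_def)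
    then have i: "(\<Sum>(m, r)\<in>{..<M} \<times> {..<R}. \<psi> (int (r + Suc m))) = (\<Sum>p\<in>?Q. \<psi> (int (fst p)))"
      by (simp add: sum.reindex split_def)
    have "(\<Sum>p\<in>?Q. \<psi> (int (fst p))) \<le> (\<Sum>p\<in>(SIGMA s:{..<M + R}. {..<s}). \<psi> (int (fst p)))"
    proof (rule sum_mono2)
      show "?Q \<subseteq> (SIGMA s:{..<M + R}. {..<s})" by auto
      show "0 \<le> \<psi> (int (fst p))" if "p \<in> (SIGMA s:{..<M + R}. {..<s}) - ?Q" for p
        using that psi_pos[of "int (fst p)"] by (cases "fst p = 0") auto
    qed auto
    also have "\<dots> = (\<Sum>s<M + R. \<Sum>m<s. \<psi> (int s))" by (subst sum.Sigma) (auto simp: split_def)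
    also have "\<dots> = (\<Sum>s<M + R. real s * \<psi> (int s))" by simp
    also have "\<dots> \<le> H" unfolding H_def by (intro sum_le_suminf psi_sum) (auto simp: psi_r_nonneg)
    finally have "(\<Sum>p\<in>?Q. \<psi> (int (fst p))) \<le> H" .
    then show "(\<Sum>m<M. \<Sum>r<R. \<psi> (int (r + Suc m))) \<le> H" by (simp only: e i)
  qed
qed

lemma summable_Psi: "summable Psi"
  by (rule summableI_nonneg_bounded[OF Psi_nonneg sum_Psi_le])

text \<open>An upper bound for \<open>\<Sum>v. J (u - v) * exp (c * (v - u))\<close> over \<open>v\<close> outside the box.\<close>

definition W :: "nat \<Rightarrow> int \<Rightarrow> real" where
  "W k u = Psi (nat (int k - u)) + exp (- 2 * c * (real k + of_int u)) * Psi (nat (int k + u))"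

lemma W_nonneg: "0 \<le> W k u"
  by (auto simp: W_def Psi_nonneg)

text \<open>To the right of the box the tilt cancels the decay of the coupling and leaves \<psi>. To
  the left it doubles the decay, and the distance to be covered exceeds k + u.\<close>

lemma sum_outside_le_W:
  assumes u: "u \<in> int_box k" and F: "finite F" "F \<inter> int_box k = {}"
  shows "(\<Sum>v\<in>F. J (u - v) * exp (c * of_int (v - u))) \<le> W k u"
proof -
  have u': "\<bar>u\<bar> \<le> int k" using u by (simp add: mem_int_box)
  let ?R = "{v\<in>F. int k < v}" and ?L = "{v\<in>F. v < - int k}"
  let ?f = "\<lambda>v. J (u - v) * exp (c * of_int (v - u))"
  have "F = ?R \<union> ?L"
  proof -
    have "int k < v \<or> v < - int k" if "v \<in> F" for v
    proof -
      have "v \<notin> int_box k" using F(2) that by auto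
      then show ?thesis unfolding mem_int_box by linarith
    qed
    then show ?thesis by auto
  qed
  then have "(\<Sum>v\<in>F. ?f v) = (\<Sum>v\<in>?R \<union> ?L. ?f v)" by simp
  also have "\<dots> = (\<Sum>v\<in>?R. ?f v) + (\<Sum>v\<in>?L. ?f v)"
    using F(1) by (intro sum.union_disjoint) auto
  also have "(\<Sum>v\<in>?R. ?f v) = (\<Sum>v\<in>?R. \<psi> (int (nat (v - u))))"
  proof (rule sum.cong[OF refl])
    fix v assume "v \<in> ?R"
    then have vu: "u < v" using u' by auto
    then have "J (u - v) = \<psi> (v - u) * exp (- (c * of_int (v - u)))"
      using J_eq[of "u - v"] psi_even[of "v - u"] by simp
    then show "?f v = \<psi> (int (nat (v - u)))" using vu by (simp flip: exp_add)
  qed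
  also have "\<dots> = (\<Sum>r\<in>(\<lambda>v. nat (v - u)) ` ?R. \<psi> (int r))"
    using u' by (subst sum.reindex) (auto simp: inj_on_def)
  also have "\<dots> \<le> Psi (nat (int k - u))"
    using F(1) u' by (intro sum_psi_le_Psi) auto
  also have "(\<Sum>v\<in>?L. ?f v) \<le> (\<Sum>v\<in>?L. exp (- 2 * c * (real k + of_int u)) * \<psi> (int (nat (u - v))))"
  proof (rule sum_mono)
    fix v assume v: "v \<in> ?L"
    then have vu: "v < u" using u' by auto
    have "?f v = \<psi> (u - v) * exp (- 2 * c * of_int (u - v))"
      using vu by (simp add: J_eq algebra_simps flip: exp_add)
    also have "\<dots> \<le> \<psi> (u - v) * exp (- 2 * c * (real k + of_int u))"
      using psi_pos[of "u - v"] vu v c by (intro mult_left_mono) (auto simp: less_imp_le)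
    finally show "?f v \<le> exp (- 2 * c * (real k + of_int u)) * \<psi> (int (nat (u - v)))"
      using vu by (simp add: mult.commute)
  qed
  also have "\<dots> = exp (- 2 * c * (real k + of_int u)) * (\<Sum>r\<in>(\<lambda>v. nat (u - v)) ` ?L. \<psi> (int r))"
    using u' by (subst sum.reindex) (auto simp: inj_on_def sum_distrib_left)
  also have "\<dots> \<le> exp (- 2 * c * (real k + of_int u)) * Psi (nat (int k + u))"
    using F(1) u' by (intro mult_left_mono sum_psi_le_Psi) auto
  finally show ?thesis by (simp add: W_def)
qed

text \<open>The factor by which Lieb's inequality for the box bounds tilted correlations, with the
  sum over outer ends replaced by its bound \<open>W\<close>. Being a finite-volume quantity, it is
  continuous in \<beta>, so being less than 1 is an open condition.\<close>

definition lieb_sum :: "nat \<Rightarrow> real \<Rightarrow> real" where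
  "lieb_sum k \<beta> = \<beta> * (\<Sum>u\<in>int_box k. corr J \<beta> (int_box k) 0 u * exp (c * of_int u) * W k u)"

lemma continuous_lieb_sum: "continuous_on UNIV (lieb_sum k)"
  unfolding lieb_sum_def by (intro continuous_intros continuous_corr) auto

text \<open>Instead of iterating Lieb's inequality, take the largest tilted correlation A in V. If
  it is attained at distance more than k, one application gives
  \<open>A \<le> lieb_sum k \<beta> * A\<close>, which is impossible; at distance at most k the tilt
  is at most \<open>exp (c * k)\<close>.\<close>

lemma corr_le_of_lieb_sum:
  assumes b: "0 \<le> \<beta>" and lieb_sum: "lieb_sum k \<beta> < 1" and V: "finite V" "y \<in> V" "x \<in> V"
  shows "corr J \<beta> V y x \<le> exp (c * k) * exp (- c * of_int (x - y))"
proof -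
  interpret ising J \<beta> by (rule ising_J[OF b])
  define A where "A = Max ((\<lambda>(y, x). exp (c * of_int (x - y)) * corr J \<beta> V y x) ` (V \<times> V))"
  have A: "exp (c * of_int (x - y)) * corr J \<beta> V y x \<le> A" if "y \<in> V" "x \<in> V" for x y
    unfolding A_def using V that by (intro Max_ge) auto
  have A0: "0 < A" using A[OF V(2) V(2)] corr_diag[OF V(1), of y] by simp
  have "A \<in> (\<lambda>(y, x). exp (c * of_int (x - y)) * corr J \<beta> V y x) ` (V \<times> V)"
    unfolding A_def using V by (intro Max_in) auto
  then obtain y0 x0 where xy: "y0 \<in> V" "x0 \<in> V" "A = exp (c * of_int (x0 - y0)) * corr J \<beta> V y0 x0" by auto
  have "A \<le> exp (c * k)"
  proof (cases "x0 - y0 \<in> int_box k")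
    case True
    then have "real_of_int (x0 - y0) \<le> real k" unfolding mem_int_box by linarith
    then have "exp (c * of_int (x0 - y0)) * corr J \<beta> V y0 x0 \<le> exp (c * k) * 1"
      using c V by (intro mult_mono corr_le_1 corr_nonneg) auto
    then show ?thesis using xy by simp
  next
    case False
    \<comment> \<open>The box around y0 need not fit into V. Correlations in the intersection are
      bounded by those in the full box, so that \<open>lieb_sum\<close> appears after
      translation.\<close>
    define S where "S = (+) y0 ` int_box k \<inter> V"
    have S: "S \<subseteq> V" "y0 \<in> S" "x0 \<notin> S" "finite S" using False xy by (auto simp: S_def mem_int_box image_iff)
    let ?T = "(+) y0 ` int_box k"
    let ?g = "\<lambda>u. corr J \<beta> ?T y0 u * exp (c * of_int (u - y0)) * W k (u - y0)"
    have split: "exp (c * of_int (x0 - y0)) = exp (c * of_int (v - u)) * exp (c * of_int (u - y0)) * exp (c * of_int (x0 - v))" for u v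
      by (simp add: algebra_simps flip: exp_add)
    have "A \<le> exp (c * of_int (x0 - y0)) * (\<Sum>u\<in>S. \<Sum>v\<in>V - S. \<beta> * J (u - v) * corr J \<beta> S y0 u * corr J \<beta> V v x0)"
      unfolding xy(3) using S V by (intro mult_left_mono corr_lieb) auto
    also have "\<dots> = (\<Sum>u\<in>S. \<Sum>v\<in>V - S. \<beta> * (corr J \<beta> S y0 u * exp (c * of_int (u - y0))) * (J (u - v) * exp (c * of_int (v - u))) * (exp (c * of_int (x0 - v)) * corr J \<beta> V v x0))"
      unfolding sum_distrib_left
    proof (intro sum.cong refl)
      fix u v
      show "exp (c * of_int (x0 - y0)) * (\<beta> * J (u - v) * corr J \<beta> S y0 u * corr J \<beta> V v x0) =
        \<beta> * (corr J \<beta> S y0 u * exp (c * of_int (u - y0))) * (J (u - v) * exp (c * of_int (v - u))) * (exp (c * of_int (x0 - v)) * corr J \<beta> V v x0)"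
        unfolding split[of v u] by (simp only: mult_ac)
    qed
    also have "\<dots> \<le> (\<Sum>u\<in>S. \<Sum>v\<in>V - S. \<beta> * (corr J \<beta> ?T y0 u * exp (c * of_int (u - y0))) * (J (u - v) * exp (c * of_int (v - u))) * A)"
    proof (intro sum_mono mult_mono mult_left_mono mult_right_mono)
      fix u v assume uv: "u \<in> S" "v \<in> V - S"
      show "corr J \<beta> S y0 u \<le> corr J \<beta> ?T y0 u"
        using S uv by (intro corr_mono_vol) (auto simp: S_def)
      show "exp (c * of_int (x0 - v)) * corr J \<beta> V v x0 \<le> A" using uv xy(2) by (intro A) auto
    qed (use b A0 J_nonneg corr_nonneg V(1) S(4) in \<open>auto intro!: mult_nonneg_nonneg\<close>)
    also have "\<dots> = (\<Sum>u\<in>S. \<beta> * A * (corr J \<beta> ?T y0 u * exp (c * of_int (u - y0))) * (\<Sum>v\<in>V - S. J (u - v) * exp (c * of_int (v - u))))"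
      by (simp add: sum_distrib_left mult_ac)
    also have "\<dots> \<le> (\<Sum>u\<in>S. \<beta> * A * (corr J \<beta> ?T y0 u * exp (c * of_int (u - y0))) * W k (u - y0))"
    proof (intro sum_mono mult_left_mono)
      fix u assume "u \<in> S"
      then have u: "u - y0 \<in> int_box k" by (auto simp: S_def)
      have "(\<Sum>v\<in>V - S. J (u - v) * exp (c * of_int (v - u))) = (\<Sum>v\<in>(\<lambda>v. v - y0) ` (V - S). J ((u - y0) - v) * exp (c * of_int (v - (u - y0))))"
        by (subst sum.reindex) (auto simp: inj_on_def)
      also have "\<dots> \<le> W k (u - y0)"
      proof (rule sum_outside_le_W[OF u])
        have "v \<in> ?T" if "v - y0 \<in> int_box k" for v using that by (intro image_eqI[of _ _ "v - y0"]) auto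
        then show "(\<lambda>v. v - y0) ` (V - S) \<inter> int_box k = {}" by (auto simp: S_def)
      qed (use V in simp)
      finally show "(\<Sum>v\<in>V - S. J (u - v) * exp (c * of_int (v - u))) \<le> W k (u - y0)" .
    qed (use b A0 corr_nonneg in \<open>auto intro!: mult_nonneg_nonneg\<close>)
    also have "\<dots> = \<beta> * A * (\<Sum>u\<in>S. ?g u)" by (simp add: sum_distrib_left mult_ac)
    also have "\<dots> \<le> \<beta> * A * (\<Sum>u\<in>?T. ?g u)"
      using b A0 by (intro mult_left_mono sum_mono2) (auto simp: S_def intro!: mult_nonneg_nonneg corr_nonneg W_nonneg)
    also have "(\<Sum>u\<in>?T. ?g u) = (\<Sum>u\<in>int_box k. corr J \<beta> (int_box k) 0 u * exp (c * of_int u) * W k u)"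
      using corr_translate[of y0 "int_box k" 0] by (subst sum.reindex) auto
    also have "\<beta> * A * \<dots> = lieb_sum k \<beta> * A" by (simp add: lieb_sum_def)
    finally have "A \<le> lieb_sum k \<beta> * A" .
    then have False using lieb_sum A0 by (simp add: mult_le_cancel_right2)
    then show ?thesis ..
  qed
  then have "exp (c * of_int (x - y)) * corr J \<beta> V y x \<le> exp (c * k)" using A[OF V(2,3)] by simp
  then have "corr J \<beta> V y x \<le> exp (c * k) / exp (c * of_int (x - y))"
    by (subst pos_le_divide_eq) (simp_all add: mult.commute)
  then show ?thesis by (simp add: exp_minus divide_inverse)
qed

lemma corr_inf_le_of_lieb_sum:
  assumes "0 \<le> \<beta>" "lieb_sum k \<beta> < 1"
  shows "corr_inf J \<beta> x \<le> exp (c * k) * exp (- c * of_int x)"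
proof -
  interpret ising J \<beta> by (rule ising_J[OF assms(1)])
  show ?thesis
  proof (rule LIMSEQ_le_const2[OF corr_tendsto_corr_inf], intro exI allI impI)
    fix N assume "nat \<bar>x\<bar> \<le> N"
    then show "corr J \<beta> (int_box N) 0 x \<le> exp (c * k) * exp (- c * of_int x)"
      using corr_le_of_lieb_sum[OF assms, of "int_box N" 0 x] by (simp add: mem_int_box)
  qed
qed

lemma corr_inf_lower:
  assumes "0 < \<beta>" "x \<noteq> 0"
  shows "\<beta> * J x / (1 + \<beta> * J x) \<le> corr_inf J \<beta> x"
proof -
  interpret ising J \<beta> using assms by (intro ising_J) simp
  show ?thesis using tanh_ge[of "\<beta> * J x"] corr_inf_tanh[OF assms(2)] assms(1) J_nonneg[of x] by simp
qed

lemma corr_inf_pos: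
  assumes "0 < \<beta>" shows "0 < corr_inf J \<beta> x"
proof (cases "x = 0")
  case True
  interpret ising J \<beta> using assms by (intro ising_J) simp
  show ?thesis using corr_inf_0 True by simp
next
  case False
  have "0 < \<beta> * J x / (1 + \<beta> * J x)" using assms J_pos[OF False] by (intro divide_pos_pos add_pos_pos) auto
  then show ?thesis using corr_inf_lower[OF assms False] by linarith
qed

section \<open>The saturated temperatures and their supremum\<close>

lemma inv_corr_length_eq:
  "0 \<le> \<beta> \<Longrightarrow> inv_corr_length J \<beta> 1 = - lim (\<lambda>n. 1 / real n * ln (corr_inf J \<beta> (int n)))"
  unfolding inv_corr_length_def using ising.spin_cov_eq[OF ising_J sumJ] by simp

definition B :: "real set" where
  "B = {\<beta>. 0 \<le> \<beta> \<and> inv_corr_length J \<beta> 1 = \<rho> (of_int 1)}"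

text \<open>The rate is at least c by \<open>corr_inf_le_of_lieb_sum\<close>. It is at most c
  because the direct coupling alone contributes a multiple of \<psi>(n) exp(-cn), with \<psi>
  subexponential.\<close>

lemma B_of_lieb_sum:
  assumes b: "0 < \<beta>" and lieb_sum: "lieb_sum k \<beta> < 1" shows "\<beta> \<in> B"
proof -
  have "(\<lambda>n. 1 / real n * ln (corr_inf J \<beta> (int n))) \<longlonglongrightarrow> - c"
  proof (rule tendsto_sandwich[of "\<lambda>n. (ln \<beta> - ln (1 + \<beta> * H)) / real n + ln (\<psi> (int n)) / real n + (- c)" _ _ "\<lambda>n. (c * k - c * real n) / real n"])
    show "(\<lambda>n. (c * k - c * real n) / real n) \<longlonglongrightarrow> - c"
      using c by real_asymp
    show "(\<lambda>n. (ln \<beta> - ln (1 + \<beta> * H)) / real n + ln (\<psi> (int n)) / real n + (- c)) \<longlonglongrightarrow> - c"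
      by (rule tendsto_eq_intros psi_subexp lim_const_over_n refl)+ simp
    show "eventually (\<lambda>n. 1 / real n * ln (corr_inf J \<beta> (int n)) \<le> (c * k - c * real n) / real n) sequentially"
      using eventually_gt_at_top[of 0]
    proof eventually_elim
      case (elim n)
      have "corr_inf J \<beta> (int n) \<le> exp (c * k - c * real n)"
        using corr_inf_le_of_lieb_sum[OF less_imp_le[OF b] lieb_sum, of "int n"] by (simp add: exp_diff exp_minus field_simps)
      then have "ln (corr_inf J \<beta> (int n)) \<le> ln (exp (c * k - c * real n))"
        using corr_inf_pos[OF b, of "int n"] by (subst ln_le_cancel_iff) auto
      then show ?case by (simp add: divide_right_mono)
    qed
    show "eventually (\<lambda>n. (ln \<beta> - ln (1 + \<beta> * H)) / real n + ln (\<psi> (int n)) / real n + (- c) \<le> 1 / real n * ln (corr_inf J \<beta> (int n))) sequentially"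
      using eventually_gt_at_top[of 0]
    proof eventually_elim
      case (elim n)
      have Jn: "0 < J (int n)" "0 < \<psi> (int n)" using elim by (auto intro: J_pos psi_pos)
      \<comment> \<open>A crude bound whose only purpose is a denominator independent of n.\<close>
      have "J (int n) \<le> H"
      proof -
        have "J (int n) \<le> real n * \<psi> (int n)"
        proof -
          have "1 * \<psi> (int n) \<le> real n * \<psi> (int n)" using elim Jn(2) by (intro mult_right_mono) auto
          then show ?thesis using J_le_psi[of "int n"] elim by linarith
        qed
        also have "\<dots> = (\<Sum>r\<in>{n}. real r * \<psi> (int r))" by simp
        also have "\<dots> \<le> H" unfolding H_def by (intro sum_le_suminf psi_sum psi_r_nonneg) auto
        finally show ?thesis .
      qed
      then have le: "\<beta> * J (int n) / (1 + \<beta> * H) \<le> \<beta> * J (int n) / (1 + \<beta> * J (int n))"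
        using b Jn by (intro divide_left_mono mult_pos_pos add_pos_pos) (auto intro: add_pos_nonneg simp: H_nonneg)
      have H1: "0 < 1 + \<beta> * H" using b H_nonneg by (intro add_pos_nonneg) auto
      have "ln \<beta> + (ln (\<psi> (int n)) - c * n) - ln (1 + \<beta> * H) = ln (\<beta> * J (int n) / (1 + \<beta> * H))"
        using b Jn H1 elim by (simp add: ln_div ln_mult J_eq)
      also have "\<dots> \<le> ln (corr_inf J \<beta> (int n))"
        using le corr_inf_lower[OF b, of "int n"] b Jn H1 corr_inf_pos[OF b] elim by (subst ln_le_cancel_iff) auto
      finally have "(ln \<beta> + (ln (\<psi> (int n)) - c * n) - ln (1 + \<beta> * H)) / n \<le> ln (corr_inf J \<beta> (int n)) / n"
        using elim by (intro divide_right_mono) auto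
      then show ?case using elim by (simp add: add_divide_distrib diff_divide_distrib)
    qed
  qed
  then have "lim (\<lambda>n. 1 / real n * ln (corr_inf J \<beta> (int n))) = - c" by (rule limI)
  then show ?thesis using b by (simp add: B_def inv_corr_length_eq rho[of 1, simplified])
qed

text \<open>By Fekete's lemma the rate is an infimum as well as a limit, hence the exponential bound
  holds for every n with constant 1.\<close>

lemma corr_inf_le_of_B:
  assumes b: "0 < \<beta>" "\<beta> \<in> B" shows "corr_inf J \<beta> (int n) \<le> exp (- c * n)"
proof -
  interpret ising J \<beta> using b by (intro ising_J) simp
  define u where "u n = - ln (corr_inf J \<beta> (int n))" for n
  have "\<exists>l. (\<lambda>n. u n / n) \<longlonglongrightarrow> l \<and> (\<forall>n>0. l \<le> u n / n)"
  proof (rule fekete)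
    show "0 \<le> u n" for n using corr_inf_le_1 corr_inf_pos[OF b(1), of "int n"] by (simp add: u_def)
    show "u (m + n) \<le> u m + u n" for m n
    proof -
      have "ln (corr_inf J \<beta> (int m) * corr_inf J \<beta> (int n)) \<le> ln (corr_inf J \<beta> (int m + int n))"
        using corr_inf_pos[OF b(1)] by (subst ln_le_cancel_iff) (auto intro: corr_inf_super)
      moreover have "ln (corr_inf J \<beta> (int m) * corr_inf J \<beta> (int n)) = ln (corr_inf J \<beta> (int m)) + ln (corr_inf J \<beta> (int n))"
        by (intro ln_mult_pos corr_inf_pos b(1))
      ultimately show ?thesis by (simp add: u_def)
    qed
  qed
  then obtain l where l: "(\<lambda>n. u n / n) \<longlonglongrightarrow> l" "\<And>n. 0 < n \<Longrightarrow> l \<le> u n / n" by auto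
  have "(\<lambda>n. 1 / real n * ln (corr_inf J \<beta> (int n))) \<longlonglongrightarrow> - l"
    using tendsto_minus[OF l(1)] by (simp add: u_def)
  then have "lim (\<lambda>n. 1 / real n * ln (corr_inf J \<beta> (int n))) = - l" by (rule limI)
  then have "l = c" using b by (simp add: B_def inv_corr_length_eq rho[of 1, simplified])
  show ?thesis
  proof (cases "n = 0")
    case True
    then show ?thesis using corr_inf_le_1 by simp
  next
    case False
    then have "c * n \<le> u n" using l(2)[of n] \<open>l = c\<close> by (simp add: field_simps)
    then have "exp (ln (corr_inf J \<beta> (int n))) \<le> exp (- c * n)" by (simp add: u_def)
    then show ?thesis using corr_inf_pos[OF b(1), of "int n"] by simp
  qed
qed

text \<open>\<open>lieb_sum 0\<close> is continuous and vanishes at \<beta> = 0. This makes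
  \<open>beta_s\<close> positive, so that it can be approached from the left within the admissible
  \<beta>.\<close>

lemma B_small: "\<exists>\<beta>0>0. \<beta>0 \<in> B"
proof -
  have "(lieb_sum 0 \<longlongrightarrow> lieb_sum 0 0) (at_right 0)"
    using continuous_lieb_sum[of 0] by (auto simp: continuous_on intro: tendsto_within_subset)
  then have "eventually (\<lambda>\<beta>. lieb_sum 0 \<beta> < 1) (at_right 0)"
    by (rule order_tendstoD) (simp add: lieb_sum_def)
  moreover have "eventually (\<lambda>\<beta>::real. 0 < \<beta>) (at_right 0)" by (rule eventually_at_right_less)
  ultimately have "eventually (\<lambda>\<beta>. lieb_sum 0 \<beta> < 1 \<and> 0 < \<beta>) (at_right 0)" by (rule eventually_conj)
  then obtain \<beta> where "lieb_sum 0 \<beta> < 1 \<and> 0 < \<beta>" using eventually_happens[of _ "at_right (0::real)"] by force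
  then show ?thesis using B_of_lieb_sum by blast
qed

text \<open>Saturation forces the correlation at distance 1 below exp(-c), while the direct coupling
  pushes it to 1 as \<beta> grows; solving for \<beta> gives the bound. Only with it does
  \<open>Sup\<close> denote a true supremum.\<close>

lemma bdd_B: "bdd_above B"
proof (rule bdd_aboveI)
  fix \<beta> assume B: "\<beta> \<in> B"
  define q where "q = exp (- c)"
  have q: "0 < q" "q < 1" using c by (auto simp: q_def)
  have J1: "0 < J 1" by (rule J_pos) simp
  show "\<beta> \<le> q / ((1 - q) * J 1)"
  proof (cases "0 < \<beta>")
    case True
    have p: "0 < 1 + \<beta> * J 1" using True J1 by (intro add_pos_pos) auto
    have "corr_inf J \<beta> 1 \<le> q" using corr_inf_le_of_B[OF True B, of 1] by (simp add: q_def)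
    then have "\<beta> * J 1 / (1 + \<beta> * J 1) \<le> q"
      using corr_inf_lower[OF True, of 1] by linarith
    then have "\<beta> * J 1 \<le> q * (1 + \<beta> * J 1)" using p by (simp only: pos_divide_le_eq)
    then have "\<beta> * ((1 - q) * J 1) \<le> q" by (simp add: algebra_simps)
    then show ?thesis using q(2) J1 by (subst pos_le_divide_eq) auto
  next
    case False
    then have "\<beta> \<le> 0" by simp
    also have "0 \<le> q / ((1 - q) * J 1)" using q J1 by simp
    finally show ?thesis .
  qed
qed

definition beta_s :: real where "beta_s = Sup B"

lemma beta_sat_eq: "beta_sat \<psi> \<rho> 1 = beta_s"
  by (simp add: beta_sat_def beta_s_def B_def)

lemma beta_s_pos: "0 < beta_s"
  using B_small cSup_upper[OF _ bdd_B] unfolding beta_s_def by force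

sublocale ising J beta_s
  by (rule ising_J) (rule less_imp_le[OF beta_s_pos])

lemma G_upper: "corr_inf J beta_s x \<le> exp (- c * \<bar>of_int x\<bar>)"
proof -
  have n: "corr_inf J beta_s (int n) \<le> exp (- c * n)" for n
  proof (rule corr_inf_left_limit[OF _ beta_s_pos ising_axioms])
    fix \<beta>' assume b: "0 \<le> \<beta>'" "\<beta>' < beta_s"
    then obtain \<beta> where \<beta>: "\<beta> \<in> B" "\<beta>' < \<beta>"
      using less_cSup_iff[OF _ bdd_B, of \<beta>'] B_small unfolding beta_s_def by auto
    have "corr_inf J \<beta>' (int n) \<le> corr_inf J \<beta> (int n)" using b \<beta> by (intro corr_inf_mono_beta ising_J) auto
    also have "\<dots> \<le> exp (- c * n)" using b \<beta> by (intro corr_inf_le_of_B) auto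
    finally show "corr_inf J \<beta>' (int n) \<le> exp (- c * n)" .
  qed
  show ?thesis
  proof (cases "0 \<le> x")
    case True then show ?thesis using n[of "nat x"] by simp
  next
    case False then show ?thesis using n[of "nat (- x)"] corr_inf_even[of x] by simp
  qed
qed

lemma lieb_sum_ge_1: "1 \<le> lieb_sum k beta_s"
proof (rule ccontr)
  assume "\<not> 1 \<le> lieb_sum k beta_s"
  then have "lieb_sum k beta_s < 1" by simp
  moreover have "(lieb_sum k \<longlongrightarrow> lieb_sum k beta_s) (at_right beta_s)"
    using continuous_lieb_sum[of k] by (auto simp: continuous_on intro: tendsto_within_subset)
  ultimately have "eventually (\<lambda>\<beta>. lieb_sum k \<beta> < 1) (at_right beta_s)" by (auto dest: order_tendstoD)
  moreover have "eventually (\<lambda>\<beta>. beta_s < \<beta>) (at_right beta_s)" by (rule eventually_at_right_less)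
  ultimately have "eventually (\<lambda>\<beta>. lieb_sum k \<beta> < 1 \<and> beta_s < \<beta>) (at_right beta_s)" by (rule eventually_conj)
  then obtain \<beta> where \<beta>: "lieb_sum k \<beta> < 1" "beta_s < \<beta>" using eventually_happens[of _ "at_right beta_s"] by force
  then have "\<beta> \<in> B" using beta_s_pos by (intro B_of_lieb_sum) auto
  then have "\<beta> \<le> beta_s" unfolding beta_s_def by (rule cSup_upper[OF _ bdd_B])
  then show False using \<beta> by simp
qed

section \<open>The lower bound at saturation\<close>

definition a :: "int \<Rightarrow> real" where "a u = exp (c * of_int u) * corr_inf J beta_s u"

lemma a_le_1: "a u \<le> 1"
proof -
  have "a u \<le> exp (c * of_int u) * exp (- c * \<bar>of_int u\<bar>)"
    unfolding a_def by (intro mult_left_mono G_upper) auto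
  also have "\<dots> \<le> 1" using c by (auto simp: exp_add[symmetric] abs_if)
  finally show ?thesis .
qed

lemma a_pos: "0 < a u"
  using corr_inf_pos[OF beta_s_pos, of u] by (simp add: a_def)

lemma a_super: "a u * a v \<le> a (u + v)"
proof -
  have "a u * a v = exp (c * of_int (u + v)) * (corr_inf J beta_s u * corr_inf J beta_s v)"
    by (simp add: a_def distrib_left exp_add mult_ac)
  also have "\<dots> \<le> a (u + v)" unfolding a_def by (intro mult_left_mono corr_inf_super) auto
  finally show ?thesis .
qed

text \<open>\<open>lieb_sum_ge_1\<close> with sites numbered by their distance m to the right end of
  the box. The edges leaving on the left contribute only the exponentially small last term.\<close>

lemma one_le_sum:
  "1 \<le> beta_s * ((\<Sum>m<2 * k + 1. a (int k - int m) * Psi m) + exp (- 2 * c * k) * H)"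
proof -
  have "1 \<le> lieb_sum k beta_s" by (rule lieb_sum_ge_1)
  also have "\<dots> \<le> beta_s * (\<Sum>u\<in>int_box k. a u * Psi (nat (int k - u)) + exp (- 2 * c * k) * Psi (nat (int k + u)))"
    unfolding lieb_sum_def
  proof (intro mult_left_mono sum_mono)
    fix u assume "u \<in> int_box k"
    have "corr J beta_s (int_box k) 0 u * exp (c * of_int u) \<le> a u"
      unfolding a_def using corr_box_le_corr_inf[of k u] by (simp add: mult.commute)
    then have "corr J beta_s (int_box k) 0 u * exp (c * of_int u) * W k u \<le> a u * W k u"
      by (rule mult_right_mono) (rule W_nonneg)
    also have "\<dots> = a u * Psi (nat (int k - u)) + (a u * exp (- 2 * c * (real k + of_int u))) * Psi (nat (int k + u))"
      by (simp add: W_def algebra_simps)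
    also have "(a u * exp (- 2 * c * (real k + of_int u))) * Psi (nat (int k + u)) \<le> exp (- 2 * c * k) * Psi (nat (int k + u))"
    proof (rule mult_right_mono[OF _ Psi_nonneg])
      \<comment> \<open>For u < 0 the bound \<open>a u \<le> 1\<close> is too weak near the left
        end; \<open>G_upper\<close> gives exp(2cu), which compensates the growth of the other
        factor.\<close>
      have "a u * exp (- 2 * c * (real k + of_int u)) \<le> (exp (c * of_int u) * exp (- c * \<bar>of_int u\<bar>)) * exp (- 2 * c * (real k + of_int u))"
        unfolding a_def by (intro mult_right_mono mult_left_mono G_upper) auto
      also have "\<dots> = exp (c * of_int u + - c * \<bar>of_int u\<bar> + - 2 * c * (real k + of_int u))"
        by (simp only: exp_add)
      also have "\<dots> \<le> exp (- 2 * c * k)"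
      proof -
        have "c * of_int u + - c * \<bar>of_int u\<bar> + - 2 * c * (real k + of_int u) = - 2 * c * k - c * (of_int u + \<bar>of_int u\<bar>)"
          by (simp add: algebra_simps)
        moreover have "0 \<le> c * (of_int u + \<bar>of_int u\<bar>)" using c by (intro mult_nonneg_nonneg) auto
        ultimately show ?thesis by simp
      qed
      finally show "a u * exp (- 2 * c * (real k + of_int u)) \<le> exp (- 2 * c * k)" .
    qed
    finally show "corr J beta_s (int_box k) 0 u * exp (c * of_int u) * W k u \<le> a u * Psi (nat (int k - u)) + exp (- 2 * c * k) * Psi (nat (int k + u))"
      by simp
  qed (use beta_s_pos in simp)
  also have "(\<Sum>u\<in>int_box k. a u * Psi (nat (int k - u)) + exp (- 2 * c * k) * Psi (nat (int k + u))) =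
    (\<Sum>u\<in>int_box k. a u * Psi (nat (int k - u))) + exp (- 2 * c * k) * (\<Sum>u\<in>int_box k. Psi (nat (int k + u)))"
    by (simp add: sum.distrib sum_distrib_left)
  also have "(\<Sum>u\<in>int_box k. a u * Psi (nat (int k - u))) = (\<Sum>m<2 * k + 1. a (int k - int m) * Psi m)"
    by (rule sum.reindex_bij_witness[where i = "\<lambda>m. int k - int m" and j = "\<lambda>u. nat (int k - u)"]) (auto simp: int_box_def)
  also have "(\<Sum>u\<in>int_box k. Psi (nat (int k + u))) = (\<Sum>m<2 * k + 1. Psi m)"
    by (rule sum.reindex_bij_witness[where i = "\<lambda>m. int m - int k" and j = "\<lambda>u. nat (int k + u)"]) (auto simp: int_box_def)
  also have "beta_s * ((\<Sum>m<2 * k + 1. a (int k - int m) * Psi m) + exp (- 2 * c * k) * (\<Sum>m<2 * k + 1. Psi m)) \<le>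
     beta_s * ((\<Sum>m<2 * k + 1. a (int k - int m) * Psi m) + exp (- 2 * c * k) * H)"
    using beta_s_pos by (intro mult_left_mono add_left_mono sum_Psi_le) auto
  finally show ?thesis .
qed

lemma a_bounded_below: "\<exists>C>0. \<forall>n::nat. C \<le> a (int n)"
proof -
  \<comment> \<open>Three error terms of size at most e would give 3/4 in \<open>one_le_sum\<close>,
    a contradiction.\<close>
  define e where "e = 1 / (4 * beta_s)"
  have e: "0 < e" using beta_s_pos by (simp add: e_def)
  obtain M where M: "\<And>m n. M \<le> m \<Longrightarrow> norm (\<Sum>i\<in>{m..<n}. Psi i) < e"
    using summable_Psi e unfolding summable_Cauchy by metis
  have "(\<lambda>k::nat. exp (- 2 * c * k)) \<longlonglongrightarrow> 0" using c by real_asymp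
  then have "(\<lambda>k::nat. exp (- 2 * c * k) * H) \<longlonglongrightarrow> 0" by (rule tendsto_mult_left_zero)
  then have "eventually (\<lambda>k::nat. exp (- 2 * c * k) * H < e) sequentially" using e by (intro order_tendstoD) auto
  then obtain K0 where K0: "\<And>k. K0 \<le> k \<Longrightarrow> exp (- 2 * c * real k) * H < e" by (auto simp: eventually_sequentially)
  define K where "K = max M K0"
  \<comment> \<open>If \<open>a\<close> were below \<delta> on a whole window, the window would
    contribute at most \<delta> H, hence at most e; the added 1 guards against division by
    zero.\<close>
  define \<delta> where "\<delta> = e / (H + 1)"
  have d: "0 < \<delta>" using e H_nonneg by (simp add: \<delta>_def)
  have win: "\<exists>m<M. \<delta> \<le> a (int k - int m)" if k: "K \<le> k" for k
  proof (rule ccontr)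
    assume "\<not> (\<exists>m<M. \<delta> \<le> a (int k - int m))"
    then have small: "a (int k - int m) \<le> \<delta>" if "m < M" for m using that by (auto simp: not_le less_imp_le)
    have Mk: "M \<le> 2 * k + 1" using k by (auto simp: K_def)
    have "{..<2 * k + 1} = {..<M} \<union> {M..<2 * k + 1}" using Mk by auto
    then have "(\<Sum>m<2 * k + 1. a (int k - int m) * Psi m) = (\<Sum>m<M. a (int k - int m) * Psi m) + (\<Sum>m\<in>{M..<2 * k + 1}. a (int k - int m) * Psi m)"
      by (rule ssubst) (rule sum.union_disjoint, auto)
    also have "(\<Sum>m<M. a (int k - int m) * Psi m) \<le> (\<Sum>m<M. \<delta> * Psi m)"
      by (intro sum_mono mult_right_mono Psi_nonneg small) auto
    also have "\<dots> = \<delta> * (\<Sum>m<M. Psi m)" by (simp add: sum_distrib_left)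
    also have "\<dots> \<le> \<delta> * H" using d by (intro mult_left_mono sum_Psi_le) auto
    also have "\<dots> \<le> e"
    proof -
      have "\<delta> * (H + 1) = e" using H_nonneg by (simp add: \<delta>_def)
      then show ?thesis using d by (simp add: distrib_left)
    qed
    also have "(\<Sum>m\<in>{M..<2 * k + 1}. a (int k - int m) * Psi m) \<le> (\<Sum>m\<in>{M..<2 * k + 1}. 1 * Psi m)"
      by (intro sum_mono mult_right_mono Psi_nonneg a_le_1)
    also have "\<dots> < e" using M[of M "2 * k + 1"] by simp
    finally have "(\<Sum>m<2 * k + 1. a (int k - int m) * Psi m) + exp (- 2 * c * k) * H < 3 * e"
      using K0[of k] k by (simp add: K_def)
    then have "beta_s * ((\<Sum>m<2 * k + 1. a (int k - int m) * Psi m) + exp (- 2 * c * k) * H) < beta_s * (3 * e)"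
      using beta_s_pos by (intro mult_strict_left_mono) auto
    then show False using one_le_sum[of k] beta_s_pos by (simp add: e_def)
  qed
  \<comment> \<open>The offset m from n to a good site in its window is less than M, hence at most
    K. So \<mu> bounds \<open>a (int m)\<close> and supermultiplicativity reaches n.\<close>
  define \<mu> where "\<mu> = Min ((\<lambda>n. a (int n)) ` {..K})"
  have mu: "\<mu> \<le> a (int n)" if "n \<le> K" for n unfolding \<mu>_def using that by (intro Min_le) auto
  have mu0: "0 < \<mu>" unfolding \<mu>_def by (subst Min_gr_iff) (auto simp: a_pos)
  show ?thesis
  proof (intro exI conjI allI)
    show "0 < \<mu> * min 1 \<delta>" using mu0 d by simp
    fix n
    show "\<mu> * min 1 \<delta> \<le> a (int n)"
    proof (cases "n \<le> K")
      case True
      have "\<mu> * min 1 \<delta> \<le> \<mu> * 1" using mu0 by (intro mult_left_mono) auto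
      then show ?thesis using mu[OF True] by simp
    next
      case False
      then obtain m where m: "m < M" "\<delta> \<le> a (int n - int m)" using win[of n] by auto
      have "\<mu> * min 1 \<delta> \<le> a (int m) * a (int n - int m)"
        using m mu0 d mu[of m] by (intro mult_mono less_imp_le[OF a_pos]) (auto simp: K_def)
      also have "\<dots> \<le> a (int n)" using a_super[of "int m" "int n - int m"] by simp
      finally show ?thesis .
    qed
  qed
qed

text \<open>Provides the summability that \<open>measure_connected\<close> demands, from the
  exponential bound that is available at saturation.\<close>

lemma sum_box_le: "(\<Sum>y\<in>int_box k. corr_inf J beta_s y) \<le> 2 * (1 / (1 - exp (- c)))"
proof -
  have q: "0 < exp (- c)" "exp (- c) < 1" using c by auto
  have "(\<Sum>y\<in>int_box k. corr_inf J beta_s y) \<le> (\<Sum>y\<in>int_box k. exp (- c * \<bar>of_int y\<bar>))" by (intro sum_mono G_upper)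
  also have "\<dots> \<le> (\<Sum>y\<in>int ` {..k} \<union> (\<lambda>n. - int n) ` {..k}. exp (- c * \<bar>of_int y\<bar>))"
  proof (rule sum_mono2)
    show "int_box k \<subseteq> int ` {..k} \<union> (\<lambda>n. - int n) ` {..k}"
    proof
      fix y assume "y \<in> int_box k"
      then have "\<bar>y\<bar> \<le> int k" by (simp add: mem_int_box)
      then show "y \<in> int ` {..k} \<union> (\<lambda>n. - int n) ` {..k}"
        by (cases "0 \<le> y") (auto intro!: image_eqI[of _ _ "nat \<bar>y\<bar>"])
    qed
  qed auto
  also have "\<dots> \<le> (\<Sum>y\<in>int ` {..k}. exp (- c * \<bar>of_int y\<bar>)) + (\<Sum>y\<in>(\<lambda>n. - int n) ` {..k}. exp (- c * \<bar>of_int y\<bar>))"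
    by (subst sum_Un) (auto intro!: sum_nonneg)
  also have "\<dots> = 2 * (\<Sum>n\<le>k. exp (- c) ^ n)"
    by (simp add: sum.reindex inj_on_def exp_of_nat_mult[symmetric] mult.commute)
  also have "(\<Sum>n\<le>k. exp (- c) ^ n) \<le> (\<Sum>n. exp (- c) ^ n)"
    using q by (intro sum_le_suminf summable_geometric) auto
  also have "\<dots> = 1 / (1 - exp (- c))" using q by (intro suminf_geometric) auto
  finally show ?thesis by simp
qed

theorem saturation_bounds:
  "\<exists>C>0. \<forall>x::int. C \<le> exp (\<rho> (of_int x)) * measure (fk J (beta_sat \<psi> \<rho> 1)) (connected_event 0 x) \<and>
     exp (\<rho> (of_int x)) * measure (fk J (beta_sat \<psi> \<rho> 1)) (connected_event 0 x) \<le> 1"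
proof -
  have m: "measure (fk J beta_s) (connected_event 0 x) = corr_inf J beta_s x" for x
    by (rule measure_connected[OF sum_box_le])
  have e: "exp (\<rho> (of_int x)) * corr_inf J beta_s x = a \<bar>x\<bar>" for x
    using corr_inf_even[of x] by (cases "0 \<le> x") (auto simp: a_def rho)
  obtain C where C: "0 < C" "\<And>n::nat. C \<le> a (int n)" using a_bounded_below by blast
  show ?thesis unfolding beta_sat_eq m e
    using C C(2)[of "nat \<bar>_\<bar>"] a_le_1 by (intro exI[of _ C]) auto
qed

end

theorem theorem3p4:
  fixes \<rho> :: "real \<Rightarrow> real" and \<psi> :: "int \<Rightarrow> real"
  assumes "is_norm \<rho>"
    and "(\<exists>\<alpha>>2. \<forall>x. x \<noteq> 0 \<longrightarrow> \<psi> x = \<bar>real_of_int x\<bar> powr (- \<alpha>)) \<or>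
         (\<exists>c \<eta>. c > 0 \<and> 0 < \<eta> \<and> \<eta> < 1 \<and>
            (\<forall>x. x \<noteq> 0 \<longrightarrow> \<psi> x = exp (- c * \<bar>real_of_int x\<bar> powr \<eta>)))"
  shows "\<exists>C>0. \<forall>x::int.
      C \<le> exp (\<rho> (of_int x)) *
            measure (fk (coupling \<psi> \<rho>) (beta_sat \<psi> \<rho> 1)) (connected_event 0 x) \<and>
      exp (\<rho> (of_int x)) *
            measure (fk (coupling \<psi> \<rho>) (beta_sat \<psi> \<rho> 1)) (connected_event 0 x) \<le> 1"
proof (rule saturation.saturation_bounds)
  have n: "\<And>x. \<rho> x = 0 \<longleftrightarrow> x = 0" "\<And>a x. \<rho> (a * x) = \<bar>a\<bar> * \<rho> x" "\<And>x y. \<rho> (x + y) \<le> \<rho> x + \<rho> y"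
    using assms(1) by (auto simp: is_norm_def)
  \<comment> \<open>Homogeneity makes every norm on the line a multiple of the absolute value, which
    gives the constant c of the locale.\<close>
  have r: "\<rho> x = \<rho> 1 * \<bar>x\<bar>" for x using n(2)[of x 1] by simp
  have "0 \<le> \<rho> 1" using n(3)[of 1 "-1"] n(1)[of 0] n(2)[of "-1" 1] by simp
  then have c: "0 < \<rho> 1" using n(1)[of 1] by simp
  \<comment> \<open>The formulas for \<psi> say nothing about 0, so sequences are compared from n =
    1 on.\<close>
  have gibbs: "eventually (\<lambda>n::nat. f n = g n) sequentially" if "\<And>n. 0 < n \<Longrightarrow> f n = g n" for f g :: "nat \<Rightarrow> real"
    using eventually_gt_at_top[of 0] by eventually_elim (rule that)
  show "saturation \<rho> \<psi> (\<rho> 1)"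
  proof
    show "0 < \<psi> x" if "x \<noteq> 0" for x using assms(2) that by auto
    show "\<psi> (- x) = \<psi> x" for x using assms(2) by (cases "x = 0") auto
    show "summable (\<lambda>r. real r * \<psi> (int r))"
      using assms(2)
    proof (elim disjE exE conjE)
      fix \<alpha> :: real assume a: "2 < \<alpha>" "\<forall>x. x \<noteq> 0 \<longrightarrow> \<psi> x = \<bar>real_of_int x\<bar> powr (- \<alpha>)"
      have "real r * \<psi> (int r) = real r powr (1 - \<alpha>)" for r
      proof (cases "r = 0")
        case False
        then have "\<psi> (int r) = real r powr (- \<alpha>)" using a(2)[rule_format, of "int r"] by simp
        then show ?thesis using powr_mult_base[of "real r" "- \<alpha>"] by simp
      qed simp
      then show ?thesis using a by (simp add: summable_real_powr_iff)
    next
      fix d \<eta> :: real assume a: "0 < d" "0 < \<eta>" "\<eta> < 1" "\<forall>x. x \<noteq> 0 \<longrightarrow> \<psi> x = exp (- d * \<bar>real_of_int x\<bar> powr \<eta>)"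
      have "real r * \<psi> (int r) = real r * exp (- d * real r powr \<eta>)" for r
        using a by (cases "r = 0") auto
      moreover have "summable (\<lambda>r. real r * exp (- d * real r powr \<eta>))"
      proof (rule summable_comparison_test_bigo)
        show "summable (\<lambda>r. norm (real r powr - 2))" by (simp add: summable_real_powr_iff)
        show "(\<lambda>r. real r * exp (- d * real r powr \<eta>)) \<in> O(\<lambda>r. real r powr - 2)" using a by real_asymp
      qed
      ultimately show ?thesis by (simp only:)
    qed
    show "(\<lambda>n. ln (\<psi> (int n)) / real n) \<longlonglongrightarrow> 0"
      using assms(2)
    proof (elim disjE exE conjE)
      fix \<alpha> :: real assume a: "2 < \<alpha>" "\<forall>x. x \<noteq> 0 \<longrightarrow> \<psi> x = \<bar>real_of_int x\<bar> powr (- \<alpha>)"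
      have "(\<lambda>n. ln (real n powr (- \<alpha>)) / real n) \<longlonglongrightarrow> 0" by real_asymp
      then show ?thesis by (rule Lim_transform_eventually) (rule gibbs, use a in auto)
    next
      fix d \<eta> :: real assume a: "0 < d" "0 < \<eta>" "\<eta> < 1" "\<forall>x. x \<noteq> 0 \<longrightarrow> \<psi> x = exp (- d * \<bar>real_of_int x\<bar> powr \<eta>)"
      have "(\<lambda>n. - d * real n powr \<eta> / real n) \<longlonglongrightarrow> 0" using a by real_asymp
      then show ?thesis by (rule Lim_transform_eventually) (rule gibbs, use a in auto)
    qed
  qed (rule r c)+
qed

end
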